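(* Let $X=E_7^{\mathrm{sc}}/P_7$ be the Freudenthal variety, and fix the reduced expression $$w^P=s_{r_1}\cdots s_{r_{27}}=s_7s_6s_5s_4s_2s_3s_4s_5s_6s_7s_1s_3s_4s_2s_5s_6s_4s_5s_3s_4s_2s_1s_3s_4s_5s_6s_7 .$$ Then $w'$ has reduced expression $w'=s_7s_6s_5s_4s_2s_3s_4s_5s_6s_7$, and for $z=u_+t\bar w_Pu_-\in\mathcal{Z}_P^\circ$ with $u_+\in U_+^\vee$, $t\in T^P$ and $(u_-)^{-1}=y_7^\vee(-a_1)y_6^\vee(-a_2)\cdots y_7^\vee(-a_{27})$ (the sequence of indices being that of the fixed reduced expression of $w^P$, $a_i\in\mathbb{C}^*$) and $q=\alpha_7^\vee(t)$, the restriction of the potential to $\mathcal{Z}_P^\circ$ is $$\mathcal{W}_{\mathcal{Z}_P^\circ}(z)=\sum_{i=1}^{27}a_i+q\,\frac{P(a_i)}{\prod_{i=1}^{27}a_i},$$ where $P(a_i)=\sum_{(i_1,\dots,i_{10})\in\mathcal{I}}\prod_{j=1}^{10}a_{i_j}$ with $$\mathcal{I}=\{(i_1,\dots,i_{10})\mid1\le i_1<\dots<i_{10}\le27,\ w'=s_{r_{i_1}}\cdots s_{r_{i_{10}}}\}$$ is a homogeneous polynomial of degree $10$ with $78$ terms.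
   Context: $G=E_7^{\mathrm{sc}}$ is the simply-connected simple complex algebraic group of type $E_7$, with Dynkin diagram numbered so that $1-3-4-5-6-7$ is a chain and vertex $2$ is attached to vertex $4$. $P=P_7$ is the maximal parabolic subgroup attached to vertex $k=7$ (its Lie algebra is generated by all Chevalley generators $e_i,h_i$ and by the $f_j$ with $j\ne7$). $G^\vee$ is the Langlands dual group (the adjoint group of type $E_7$), with maximal torus $T^\vee$, simple roots $\alpha_1^\vee,\dots,\alpha_7^\vee$ (the simple coroots of $G$, viewed as characters of $T^\vee$), opposite Borel subgroups $B_\pm^\vee$ with unipotent radicals $U_\pm^\vee$, and Chevalley generators $e_i^\vee,f_i^\vee,h_i^\vee$. Put $x_i^\vee(a)=\exp(ae_i^\vee)$, $y_i^\vee(a)=\exp(af_i^\vee)$. $W$ is the Weyl group with simple reflections $s_i$ and longest element $w_0$; $W_P=\langle s_i\mid i\neq 7\rangle$ has longest element $w_P$; $W^P$ is the set of minimal length representatives of $W/W_P$; $w^P\in W^P$ is the representative of $w_0W_P$; $w''\in W^P$ is the representative of $w_Ps_7W_P$; $w'=w^P(w'')^{-1}$. Put $\dot s_i=x_i^\vee(1)y_i^\vee(-1)x_i^\vee(1)$, $\bar s_i=\dot s_i^{-1}=x_i^\vee(-1)y_i^\vee(1)x_i^\vee(-1)$, and $\dot w=\dot s_{i_1}\cdots\dot s_{i_d}$, $\bar w=\bar s_{i_1}\cdots\bar s_{i_d}$ for a reduced expression $w=s_{i_1}\cdots s_{i_d}$. $T^P=(T^\vee)^{W_P}$ for the action $(w,t)\mapsto\dot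 wt\dot w^{-1}$. $\mathcal{Z}_P^\vee=B_-^\vee\bar w_0^{-1}\cap U_+^\vee T^P\bar w_PU_-^\vee$ and $U_-^P=U_-^\vee\cap B_+^\vee\bar w_P\bar w_0B_+^\vee$; every $z\in\mathcal{Z}_P^\vee$ has a unique decomposition $z=u_+t\bar w_Pu_-$ with $u_+\in U_+^\vee$, $t\in T^P$, $u_-\in U_-^P$. The potential $\mathcal{W}_{\mathcal{Z}_P^\vee}:\mathcal{Z}_P^\vee\to\mathbb{C}$ is $z\mapsto\sum_i(e_i^\vee)^*(u_+^{-1})+\sum_i(f_i^\vee)^*(u_-)$ for this decomposition, where $(e_i^\vee)^*:U_+^\vee\to\mathbb{C}$, $(f_i^\vee)^*:U_-^\vee\to\mathbb{C}$ are the group homomorphisms with $(e_i^\vee)^*(x_j^\vee(a))=a\delta_{ij}=(f_i^\vee)^*(y_j^\vee(a))$. $U_-^\circ=\{y^\vee_{r_{27}}(a_{27})\cdots y^\vee_{r_1}(a_1)\mid a_i\in\mathbb{C}^*\}\subset U_-^P$, and $\mathcal{Z}_P^\circ=B_-^\vee\bar w_0^{-1}\cap U_+^\vee T^P\bar w_PU_-^\circ$; $\mathcal{W}_{\mathcal{Z}_P^\circ}$ is the restriction of $\mathcal{W}_{\mathcal{Z}_P^\vee}$ to $\mathcal{Z}_P^\circ$. *)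

theory Defs
  imports
    "HOL-Analysis.Analysis"
    "HOL-Algebra.Generated_Groups"
    "HOL-Library.Poly_Mapping"
begin

section \<open>Root system and Weyl group of type \<open>E\<^sub>7\<close>\<close>

text \<open>
  The nodes of the Dynkin diagram are the elements \<open>1, \<dots>, 7\<close> of the numeral type \<open>7\<close>, in which
  \<open>7 = 0\<close>. Since the Cartan matrix is symmetric, the simple roots of \<open>G\<^sup>\<or>\<close> (the simple coroots
  of \<open>G\<close>) again form a system of type \<open>E\<^sub>7\<close> with the same numbering. Elements of its root lattice,
  which is the character lattice of the maximal torus of the adjoint group \<open>G\<^sup>\<or>\<close>, are written in
  coordinates with respect to the simple roots.
\<close>

definition e7_edges :: "(7 \<times> 7) set" where
  "e7_edges = {(1, 3), (3, 4), (4, 5), (5, 6), (6, 7), (2, 4)}"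

definition cartan :: "7 \<Rightarrow> 7 \<Rightarrow> int" where
  "cartan i j = (if i = j then 2 else if (i, j) \<in> e7_edges \<or> (j, i) \<in> e7_edges then -1 else 0)"

definition ip :: "int ^ 7 \<Rightarrow> int ^ 7 \<Rightarrow> int" where
  "ip v w = (\<Sum>i\<in>UNIV. \<Sum>j\<in>UNIV. v $ i * cartan i j * w $ j)"

definition simple_root :: "7 \<Rightarrow> int ^ 7" where
  "simple_root i = axis i 1"

lemma UNIV_7: "(UNIV :: 7 set) = {1, 2, 3, 4, 5, 6, 7}"
  by (rule sym, rule card_subset_eq) simp_all

lemma ip_simple_root: "ip (simple_root i) (simple_root j) = cartan i j"
proof -
  have "simple_root i $ k * cartan k l * simple_root j $ l
      = (if l = j then if k = i then cartan k l else 0 else 0)" for k l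
    by (simp add: simple_root_def axis_def)
  then show ?thesis by (simp add: ip_def)
qed

lemma simple_root_is_root:
  "ip (simple_root i) (simple_root i) = 2" "ip (- simple_root i) (- simple_root i) = 2"
proof -
  show *: "ip (simple_root i) (simple_root i) = 2"
    by (simp add: ip_simple_root cartan_def)
  have "ip (- v) (- v) = ip v v" for v by (simp add: ip_def)
  then show "ip (- simple_root i) (- simple_root i) = 2" using * by simp
qed

text \<open>The root lattice is even and simply laced, so that the roots are its vectors of norm \<open>2\<close>.\<close>

typedef e7_root = "{v :: int ^ 7. ip v v = 2}"
  morphisms root_vec Abs_root
  by (rule exI[of _ "simple_root 1"]) (simp add: simple_root_is_root)

lemma sum_7: "sum f (UNIV :: 7 set) = f 1 + f 2 + f 3 + f 4 + f 5 + f 6 + f 7"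
  unfolding UNIV_7 by (simp add: add.assoc)

lemma ip_self:
  "ip v v = 2 * ((v$1)\<^sup>2 + (v$2)\<^sup>2 + (v$3)\<^sup>2 + (v$4)\<^sup>2 + (v$5)\<^sup>2 + (v$6)\<^sup>2 + (v$7)\<^sup>2
    - v$1 * v$3 - v$3 * v$4 - v$4 * v$5 - v$5 * v$6 - v$6 * v$7 - v$2 * v$4)"
  unfolding ip_def sum_7 by (simp add: cartan_def e7_edges_def power2_eq_square algebra_simps)

lemma e7_root_bound:
  assumes "ip v v = 2"
  shows "v $ i \<in> {-4..4}"
proof -
  have sq: "\<bar>x\<bar> \<le> 4" if "x\<^sup>2 \<le> 24" for x :: int
  proof (rule ccontr)
    assume "\<not> \<bar>x\<bar> \<le> 4"
    then have "5\<^sup>2 \<le> \<bar>x\<bar>\<^sup>2" by (intro power_mono) auto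
    with that show False by simp
  qed
  have "(v$4)\<^sup>2 + (4 * v$5 - 3 * v$4)\<^sup>2 + 2 * (3 * v$3 - 2 * v$4)\<^sup>2 + 2 * (3 * v$6 - 2 * v$5)\<^sup>2
      + 6 * (2 * v$1 - v$3)\<^sup>2 + 6 * (2 * v$2 - v$4)\<^sup>2 + 6 * (2 * v$7 - v$6)\<^sup>2 = 12 * ip v v"
    unfolding ip_self by (simp add: power2_eq_square algebra_simps)
  also have "\<dots> = 24" using assms by simp
  finally have e: "(v$4)\<^sup>2 + (4 * v$5 - 3 * v$4)\<^sup>2 + 2 * (3 * v$3 - 2 * v$4)\<^sup>2
      + 2 * (3 * v$6 - 2 * v$5)\<^sup>2 + 6 * (2 * v$1 - v$3)\<^sup>2 + 6 * (2 * v$2 - v$4)\<^sup>2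
      + 6 * (2 * v$7 - v$6)\<^sup>2 = 24" .
  note nn = zero_le_power2[of "v$4"] zero_le_power2[of "4 * v$5 - 3 * v$4"]
    zero_le_power2[of "3 * v$3 - 2 * v$4"] zero_le_power2[of "3 * v$6 - 2 * v$5"]
    zero_le_power2[of "2 * v$1 - v$3"] zero_le_power2[of "2 * v$2 - v$4"]
    zero_le_power2[of "2 * v$7 - v$6"]
  have "\<bar>v$4\<bar> \<le> 4" "\<bar>4 * v$5 - 3 * v$4\<bar> \<le> 4" "\<bar>3 * v$3 - 2 * v$4\<bar> \<le> 4"
    "\<bar>3 * v$6 - 2 * v$5\<bar> \<le> 4" "\<bar>2 * v$1 - v$3\<bar> \<le> 4" "\<bar>2 * v$2 - v$4\<bar> \<le> 4"
    "\<bar>2 * v$7 - v$6\<bar> \<le> 4"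
    by (rule sq; use e nn in linarith)+
  note b = this
  have b3: "\<bar>v$3\<bar> \<le> 4" and b5: "\<bar>v$5\<bar> \<le> 4" and "\<bar>v$2\<bar> \<le> 4"
    using b(1,2,3,6) by arith+
  moreover have "\<bar>v$1\<bar> \<le> 4" using b3 b(5) by arith
  moreover have b6: "\<bar>v$6\<bar> \<le> 4" using b5 b(4) by arith
  moreover have "\<bar>v$7\<bar> \<le> 4" using b6 b(7) by arith
  moreover have "i \<in> {1, 2, 3, 4, 5, 6, 7}" using UNIV_7 by blast
  ultimately have "\<bar>v $ i\<bar> \<le> 4" using b(1) by (metis empty_iff insert_iff)
  then show ?thesis by (simp add: abs_le_iff)
qed

instance e7_root :: finite
proof
  have "{v. ip v v = 2} \<subseteq> vec_lambda ` (UNIV \<rightarrow>\<^sub>E {-4..4})"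
    (is "_ \<subseteq> ?B")
  proof
    fix v assume "v \<in> {v. ip v v = 2}"
    then have "v = vec_lambda (($) v)" "($) v \<in> UNIV \<rightarrow>\<^sub>E {-4..4}"
      using e7_root_bound by auto
    then show "v \<in> ?B" by blast
  qed
  moreover have "finite ?B" by (intro finite_imageI finite_PiE) auto
  ultimately have "finite {v. ip v v = 2}" by (rule finite_subset)
  then have "finite (Abs_root ` {v. ip v v = 2})" by simp
  moreover have "(UNIV :: e7_root set) = Abs_root ` {v. ip v v = 2}"
    using type_definition.Abs_image[OF type_definition_e7_root] by simp
  ultimately show "finite (UNIV :: e7_root set)" by simp
qed

text \<open>A word \<open>[i\<^sub>1, \<dots>, i\<^sub>d]\<close> stands for the product \<open>s\<^bsub>i\<^sub>1\<^esub> \<cdots> s\<^bsub>i\<^sub>d\<^esub>\<close>, acting on the root lattice.\<close>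

definition refl :: "7 \<Rightarrow> int ^ 7 \<Rightarrow> int ^ 7" where
  "refl i v = v - ip v (simple_root i) *s simple_root i"

definition weyl_word :: "7 list \<Rightarrow> (int ^ 7 \<Rightarrow> int ^ 7)" where
  "weyl_word is = foldr (\<lambda>i g. refl i \<circ> g) is id"

definition parabolic :: "7 set \<Rightarrow> (int ^ 7 \<Rightarrow> int ^ 7) set" where
  "parabolic J = {weyl_word is | is. set is \<subseteq> J}"

abbreviation weyl_group :: "(int ^ 7 \<Rightarrow> int ^ 7) set" where
  "weyl_group \<equiv> parabolic UNIV"

abbreviation weyl_group_P :: "(int ^ 7 \<Rightarrow> int ^ 7) set" where
  "weyl_group_P \<equiv> parabolic (UNIV - {7})"

definition len :: "(int ^ 7 \<Rightarrow> int ^ 7) \<Rightarrow> nat" where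
  "len w = (LEAST d. \<exists>is. weyl_word is = w \<and> length is = d)"

definition reduced_expr :: "7 list \<Rightarrow> (int ^ 7 \<Rightarrow> int ^ 7) \<Rightarrow> bool" where
  "reduced_expr is w \<longleftrightarrow> weyl_word is = w \<and> length is = len w"

definition longest :: "7 set \<Rightarrow> (int ^ 7 \<Rightarrow> int ^ 7)" where
  "longest J = (THE w. w \<in> parabolic J \<and> (\<forall>v\<in>parabolic J. len v \<le> len w))"

abbreviation w_0 :: "int ^ 7 \<Rightarrow> int ^ 7" where
  "w_0 \<equiv> longest UNIV"

abbreviation w_P :: "int ^ 7 \<Rightarrow> int ^ 7" where
  "w_P \<equiv> longest (UNIV - {7})"

definition min_reps :: "(int ^ 7 \<Rightarrow> int ^ 7) set" where
  "min_reps = {w \<in> weyl_group. \<forall>v\<in>weyl_group_P. len w \<le> len (w \<circ> v)}"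

definition min_rep :: "(int ^ 7 \<Rightarrow> int ^ 7) \<Rightarrow> (int ^ 7 \<Rightarrow> int ^ 7)" where
  "min_rep w = (THE x. x \<in> min_reps \<and> (\<exists>v\<in>weyl_group_P. x = w \<circ> v))"

text \<open>The elements \<open>w\<^sup>P\<close>, \<open>w''\<close> and \<open>w'\<close>.\<close>

definition w_sup_P :: "int ^ 7 \<Rightarrow> int ^ 7" where
  "w_sup_P = min_rep w_0"

definition w_pp :: "int ^ 7 \<Rightarrow> int ^ 7" where
  "w_pp = min_rep (w_P \<circ> refl 7)"

definition w_p :: "int ^ 7 \<Rightarrow> int ^ 7" where
  "w_p = w_sup_P \<circ> inv_into UNIV w_pp"

definition r_word :: "7 list" where
  "r_word = [7,6,5,4,2,3,4,5,6,7,1,3,4,2,5,6,4,5,3,4,2,1,3,4,5,6,7]"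


section \<open>The adjoint group of type \<open>E\<^sub>7\<close>\<close>

text \<open>
  The Lie algebra has the basis consisting of the \<open>h\<^sub>i\<close> (index \<open>Inl i\<close>) and of root vectors
  \<open>E\<^sub>\<alpha>\<close> (index \<open>Inr \<alpha>\<close>), and the bracket (Kac, Infinite-dimensional Lie algebras, 7.8)
  \<open>[h\<^sub>i, h\<^sub>j] = 0\<close>, \<open>[h\<^sub>i, E\<^sub>\<beta>] = (\<alpha>\<^sub>i|\<beta>) E\<^sub>\<beta>\<close>, \<open>[E\<^sub>\<alpha>, E\<^bsub>-\<alpha>\<^esub>] = - \<Sum>\<^sub>m \<alpha>\<^sub>m h\<^sub>m\<close>,
  \<open>[E\<^sub>\<alpha>, E\<^sub>\<beta>] = \<epsilon>(\<alpha>,\<beta>) E\<^bsub>\<alpha>+\<beta>\<^esub>\<close> if \<open>\<alpha> + \<beta>\<close> is a root and \<open>0\<close> if \<open>\<alpha> + \<beta>\<close> is neither \<open>0\<close> nor a root.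
  Here \<open>\<epsilon>\<close> is the bimultiplicative sign with \<open>\<epsilon>(\<alpha>,\<alpha>) = (-1)\<^bsup>(\<alpha>|\<alpha>)/2\<^esup>\<close>
  attached to the orientation \<open>e7_edges\<close> of the diagram.
\<close>

type_synonym e7_idx = "7 + e7_root"
type_synonym e7_alg = "complex ^ e7_idx"
type_synonym e7_mat = "complex ^ e7_idx ^ e7_idx"

definition cocycle :: "int ^ 7 \<Rightarrow> int ^ 7 \<Rightarrow> complex" where
  "cocycle v w = (-1) powi ((\<Sum>i\<in>UNIV. v $ i * w $ i) + (\<Sum>(i, j)\<in>e7_edges. v $ i * w $ j))"

fun bracket_basis :: "e7_idx \<Rightarrow> e7_idx \<Rightarrow> e7_alg" where
  "bracket_basis (Inl i) (Inl j) = 0"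
| "bracket_basis (Inl i) (Inr \<beta>) = axis (Inr \<beta>) (of_int (ip (simple_root i) (root_vec \<beta>)))"
| "bracket_basis (Inr \<alpha>) (Inl j) = axis (Inr \<alpha>) (- of_int (ip (simple_root j) (root_vec \<alpha>)))"
| "bracket_basis (Inr \<alpha>) (Inr \<beta>) =
    (\<chi> k. case k of
       Inl m \<Rightarrow> (if root_vec \<alpha> + root_vec \<beta> = 0 then - of_int (root_vec \<alpha> $ m) else 0)
     | Inr \<gamma> \<Rightarrow> (if root_vec \<gamma> = root_vec \<alpha> + root_vec \<beta> then cocycle (root_vec \<alpha>) (root_vec \<beta>) else 0))"

definition ad :: "e7_alg \<Rightarrow> e7_mat" where
  "ad x = (\<chi> k j. \<Sum>i\<in>UNIV. x $ i * bracket_basis i j $ k)"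

text \<open>With the sign in \<open>f\<close> one has \<open>[e\<^sub>i, f\<^sub>i] = h\<^sub>i\<close>.\<close>

definition chev_e :: "7 \<Rightarrow> e7_alg" where
  "chev_e i = axis (Inr (Abs_root (simple_root i))) 1"

definition chev_f :: "7 \<Rightarrow> e7_alg" where
  "chev_f i = axis (Inr (Abs_root (- simple_root i))) (-1)"

definition mat_exp :: "e7_mat \<Rightarrow> e7_mat" where
  "mat_exp A = suminf (\<lambda>n. (1 / fact n) *\<^sub>R (((**) A ^^ n) (mat 1)))"

definition x_el :: "7 \<Rightarrow> complex \<Rightarrow> e7_mat" where
  "x_el i a = mat_exp (ad (a *s chev_e i))"

definition y_el :: "7 \<Rightarrow> complex \<Rightarrow> e7_mat" where
  "y_el i a = mat_exp (ad (a *s chev_f i))"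

definition GL_e7 :: "e7_mat monoid" where
  "GL_e7 = \<lparr>carrier = {A. invertible A}, mult = (**), one = mat 1\<rparr>"

text \<open>The adjoint group \<open>G\<^sup>\<or>\<close>, as the group generated by the \<open>x\<^sub>i(a)\<close> and \<open>y\<^sub>i(a)\<close> on the Lie algebra.\<close>

definition G_dual :: "e7_mat set" where
  "G_dual = generate GL_e7 ({x_el i a | i a. True} \<union> {y_el i a | i a. True})"

definition U_plus :: "e7_mat set" where
  "U_plus = generate GL_e7 {x_el i a | i a. True}"

definition U_minus :: "e7_mat set" where
  "U_minus = generate GL_e7 {y_el i a | i a. True}"

text \<open>
  The element of the torus on which the simple root \<open>\<alpha>\<^sub>i\<close> takes the value \<open>c\<^sub>i\<close>: it fixes
  the \<open>h\<^sub>i\<close> and acts on \<open>E\<^sub>\<beta>\<close> by \<open>\<beta>\<close>.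
\<close>

definition torus_el :: "complex ^ 7 \<Rightarrow> e7_mat" where
  "torus_el c = (\<chi> k l. if k = l
     then (case l of Inl m \<Rightarrow> 1 | Inr \<beta> \<Rightarrow> \<Prod>i\<in>UNIV. (c $ i) powi (root_vec \<beta> $ i))
     else 0)"

definition T_dual :: "e7_mat set" where
  "T_dual = G_dual \<inter> {torus_el c | c. \<forall>i. c $ i \<noteq> 0}"

definition simple_root_char :: "7 \<Rightarrow> e7_mat \<Rightarrow> complex" where
  "simple_root_char i t = (THE c. t *v chev_e i = c *s chev_e i)"

definition B_plus :: "e7_mat set" where
  "B_plus = T_dual <#>\<^bsub>GL_e7\<^esub> U_plus"

definition B_minus :: "e7_mat set" where
  "B_minus = T_dual <#>\<^bsub>GL_e7\<^esub> U_minus"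

definition mat_prod :: "e7_mat list \<Rightarrow> e7_mat" where
  "mat_prod gs = foldr (**) gs (mat 1)"

definition s_dot :: "7 \<Rightarrow> e7_mat" where
  "s_dot i = x_el i 1 ** y_el i (-1) ** x_el i 1"

definition s_bar :: "7 \<Rightarrow> e7_mat" where
  "s_bar i = x_el i (-1) ** y_el i 1 ** x_el i (-1)"

text \<open>By the braid relations, the choice of the reduced expression is immaterial.\<close>

definition w_dot :: "(int ^ 7 \<Rightarrow> int ^ 7) \<Rightarrow> e7_mat" where
  "w_dot w = mat_prod (map s_dot (SOME is. reduced_expr is w))"

definition w_bar :: "(int ^ 7 \<Rightarrow> int ^ 7) \<Rightarrow> e7_mat" where
  "w_bar w = mat_prod (map s_bar (SOME is. reduced_expr is w))"

definition T_P :: "e7_mat set" where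
  "T_P = {t \<in> T_dual. \<forall>w\<in>weyl_group_P. w_dot w ** t ** matrix_inv (w_dot w) = t}"


section \<open>The mirror and its potential\<close>

definition U_minus_P :: "e7_mat set" where
  "U_minus_P = U_minus \<inter>
     (((B_plus #>\<^bsub>GL_e7\<^esub> w_bar w_P) #>\<^bsub>GL_e7\<^esub> w_bar w_0) <#>\<^bsub>GL_e7\<^esub> B_plus)"

definition Z_P :: "e7_mat set" where
  "Z_P = (B_minus #>\<^bsub>GL_e7\<^esub> matrix_inv (w_bar w_0)) \<inter>
     (((U_plus <#>\<^bsub>GL_e7\<^esub> T_P) #>\<^bsub>GL_e7\<^esub> w_bar w_P) <#>\<^bsub>GL_e7\<^esub> U_minus)"

definition C_add :: "complex monoid" where
  "C_add = \<lparr>carrier = UNIV, mult = (+), one = 0\<rparr>"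

definition e_star :: "7 \<Rightarrow> e7_mat \<Rightarrow> complex" where
  "e_star i = (THE \<phi>. \<phi> \<in> extensional U_plus \<and> \<phi> \<in> hom (GL_e7\<lparr>carrier := U_plus\<rparr>) C_add \<and>
     (\<forall>j a. \<phi> (x_el j a) = (if i = j then a else 0)))"

definition f_star :: "7 \<Rightarrow> e7_mat \<Rightarrow> complex" where
  "f_star i = (THE \<phi>. \<phi> \<in> extensional U_minus \<and> \<phi> \<in> hom (GL_e7\<lparr>carrier := U_minus\<rparr>) C_add \<and>
     (\<forall>j a. \<phi> (y_el j a) = (if i = j then a else 0)))"

definition decomposition :: "e7_mat \<Rightarrow> e7_mat \<times> e7_mat \<times> e7_mat" where
  "decomposition z = (THE (u\<^sub>p, t, u\<^sub>m). u\<^sub>p \<in> U_plus \<and> t \<in> T_P \<and> u\<^sub>m \<in> U_minus_P \<and>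
     z = u\<^sub>p ** t ** w_bar w_P ** u\<^sub>m)"

definition potential :: "e7_mat \<Rightarrow> complex" where
  "potential = (\<lambda>z\<in>Z_P. case decomposition z of (u\<^sub>p, t, u\<^sub>m) \<Rightarrow>
     (\<Sum>i\<in>UNIV. e_star i (matrix_inv u\<^sub>p)) + (\<Sum>i\<in>UNIV. f_star i u\<^sub>m))"

definition U_minus_circ :: "e7_mat set" where
  "U_minus_circ = {mat_prod (rev (map2 y_el r_word (map a [1..<28]))) | a.
     \<forall>i\<in>{1..27::nat}. a i \<noteq> 0}"

definition Z_P_circ :: "e7_mat set" where
  "Z_P_circ = (B_minus #>\<^bsub>GL_e7\<^esub> matrix_inv (w_bar w_0)) \<inter>
     (((U_plus <#>\<^bsub>GL_e7\<^esub> T_P) #>\<^bsub>GL_e7\<^esub> w_bar w_P) <#>\<^bsub>GL_e7\<^esub> U_minus_circ)"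

definition potential_circ :: "e7_mat \<Rightarrow> complex" where
  "potential_circ = restrict potential Z_P_circ"


section \<open>The polynomial \<open>P\<close>\<close>

text \<open>
  A polynomial in variables \<open>X\<^sub>1, X\<^sub>2, \<dots>\<close> is a finitely supported map from monomials to
  coefficients, and a monomial is a finitely supported map from variables to exponents.
\<close>

type_synonym polynomial = "(nat \<Rightarrow>\<^sub>0 nat) \<Rightarrow>\<^sub>0 complex"

definition Var :: "nat \<Rightarrow> polynomial" where
  "Var i = Poly_Mapping.single (Poly_Mapping.single i 1) 1"

definition poly_eval :: "polynomial \<Rightarrow> (nat \<Rightarrow> complex) \<Rightarrow> complex" where
  "poly_eval p a = (\<Sum>m\<in>Poly_Mapping.keys p.
     Poly_Mapping.lookup p m * (\<Prod>i\<in>Poly_Mapping.keys m. a i ^ Poly_Mapping.lookup m i))"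

definition homogeneous :: "nat \<Rightarrow> polynomial \<Rightarrow> bool" where
  "homogeneous d p \<longleftrightarrow>
     (\<forall>m\<in>Poly_Mapping.keys p. (\<Sum>i\<in>Poly_Mapping.keys m. Poly_Mapping.lookup m i) = d)"

text \<open>Tuples are lists; \<open>r\<^sub>i\<close> is \<open>r_word ! (i - 1)\<close>.\<close>

definition index_tuples :: "nat list set" where
  "index_tuples = {is. length is = 10 \<and> sorted_wrt (<) is \<and> set is \<subseteq> {1..27} \<and>
     w_p = weyl_word (map (\<lambda>i. r_word ! (i - 1)) is)}"

definition P_poly :: polynomial where
  "P_poly = (\<Sum>is\<in>index_tuples. prod_list (map Var is))"

end

theory Submission
  imports Defs
begin

text \<open>
  The formula compares the adjoint representation of \<open>G\<^sup>\<or>\<close> with the 56-dimensional minuscule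
  representation of its universal cover. A word in the generators \<open>x\<^sub>i(a)\<close>, \<open>y\<^sub>i(a)\<close> acts in both;
  the minuscule representation of the Lie algebra is faithful, so an identity of words there implies
  one in \<open>G\<^sup>\<or>\<close>, and conversely two words that agree in \<open>G\<^sup>\<or>\<close> differ by scalars on
  minuscule weight vectors.

  Write \<open>u\<^sub>+\<^sup>-\<^sup>1 b\<^sub>- = t w\<^sub>P u\<^sub>- w\<^sub>0\<close>. Applied to the lowest weight vector \<open>v\<^sup>-\<close>, the left
  hand side is a multiple of \<open>v\<^sup>- + e\<^sub>7\<^sup>*(u\<^sub>+\<^sup>-\<^sup>1) e\<^sub>7 v\<^sup>- + \<dots>\<close>, while \<open>u\<^sub>-\<close> applied to the highest
  weight vector is a sum over lowering paths, that is over subwords of the reduced expression of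
  \<open>w\<^sup>P\<close>. The only path down to \<open>v\<^sup>-\<close> is the full word, and the paths to the weight that \<open>t w\<^sub>P\<close>
  moves to that of \<open>e\<^sub>7 v\<^sup>-\<close> are the subwords with product \<open>w'\<close>. For \<open>i \<noteq> 7\<close> the character \<open>e\<^sub>i\<^sup>*\<close>
  vanishes on \<open>u\<^sub>+\<^sup>-\<^sup>1\<close> because \<open>u\<^sub>- \<in> B\<^sub>+ w\<^sub>P w\<^sub>0 B\<^sub>+\<close>.
\<close>

subsection \<open>The root lattice\<close>

text \<open>The minuscule representation serves because its weights have multiplicity one and pair
  with roots to -1, 0 or 1. Hence each \<open>e_i\<close> and \<open>f_i\<close> squares to zero,
  \<open>x_i(a)\<close> and \<open>y_i(a)\<close> have degree one in \<open>a\<close>, and each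
  coefficient of \<open>u_-\<close> is a sum of square-free monomials. In the adjoint representation
  quadratic terms and the seven-dimensional zero weight space would interfere. The basis signs are
  chosen so that \<open>e_i\<close> and \<open>f_i\<close> have entries 0 and 1. The representative
  of \<open>w_P\<close> adds no sign in the two rows that matter, since both weights are
  antidominant for \<open>W_P\<close>, and the remaining unknown scalars are common to both rows and
  cancel.

  The other obstacle is that the potential is defined through a definite description. Uniqueness of
  the decomposition, like the vanishing of \<open>e_i^*\<close>, is obtained in the adjoint
  representation by following the weights that occur in images of the Cartan elements
  \<open>h_i\<close>. That \<open>U_minus_circ\<close> lies in \<open>U_minus_P\<close> is the
  multiplication rule for Bruhat cells along a reduced word.\<close>

lemma exhaust_7: "(i :: 7) = 1 \<or> i = 2 \<or> i = 3 \<or> i = 4 \<or> i = 5 \<or> i = 6 \<or> i = 7"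
  using UNIV_7 by blast

lemma all_7: "(\<forall>i :: 7. P i) \<longleftrightarrow> P 1 \<and> P 2 \<and> P 3 \<and> P 4 \<and> P 5 \<and> P 6 \<and> P 7"
  by (metis exhaust_7)

definition v7 :: "int \<Rightarrow> int \<Rightarrow> int \<Rightarrow> int \<Rightarrow> int \<Rightarrow> int \<Rightarrow> int \<Rightarrow> int ^ 7" where
  "v7 a b c d e f g = (\<chi> i. if i = 1 then a else if i = 2 then b else if i = 3 then c else
     if i = 4 then d else if i = 5 then e else if i = 6 then f else g)"

lemma v7_nth [simp]:
  "v7 a b c d e f g $ 1 = a" "v7 a b c d e f g $ 2 = b" "v7 a b c d e f g $ 3 = c"
  "v7 a b c d e f g $ 4 = d" "v7 a b c d e f g $ 5 = e" "v7 a b c d e f g $ 6 = f"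
  "v7 a b c d e f g $ 7 = g"
  by (simp_all add: v7_def)

lemma v7_eq_iff [simp]: "v7 a b c d e f g = v7 a' b' c' d' e' f' g' \<longleftrightarrow>
    a = a' \<and> b = b' \<and> c = c' \<and> d = d' \<and> e = e' \<and> f = f' \<and> g = g'"
  by (auto simp: vec_eq_iff all_7)

lemma ip_expand: "ip v w = 2 * (v$1 * w$1 + v$2 * w$2 + v$3 * w$3 + v$4 * w$4 + v$5 * w$5 + v$6 *
  w$6
    + v$7 * w$7) - v$1 * w$3 - v$3 * w$1 - v$3 * w$4 - v$4 * w$3 - v$4 * w$5 - v$5 * w$4
    - v$5 * w$6 - v$6 * w$5 - v$6 * w$7 - v$7 * w$6 - v$2 * w$4 - v$4 * w$2"
  unfolding ip_def sum_7 by (simp add: cartan_def e7_edges_def algebra_simps)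

lemma ip_sym: "ip v w = ip w v"
  by (simp add: ip_expand algebra_simps)

lemma ip_bilinear [simp]:
  "ip (v + v') w = ip v w + ip v' w" "ip w (v + v') = ip w v + ip w v'"
  "ip (v - v') w = ip v w - ip v' w" "ip w (v - v') = ip w v - ip w v'"
  "ip (- v) w = - ip v w" "ip w (- v) = - ip w v"
  "ip (c *s v) w = c * ip v w" "ip w (c *s v) = c * ip w v"
  "ip 0 w = 0" "ip w 0 = 0"
  by (simp_all add: ip_expand algebra_simps)

lemma even_ip_self: "even (ip v v)"
  by (simp add: ip_self)

text \<open>Lagrange diagonalisation: variables are eliminated from the ends of the three arms
  towards node 4, and 12 clears the denominators. It shows that the form is positive
  definite.\<close>

lemma ip_squares: "12 * ip v v = (v$4)\<^sup>2 + (4 * v$5 - 3 * v$4)\<^sup>2 + 2 * (3 * v$3 - 2 * v$4)\<^sup>2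
      + 2 * (3 * v$6 - 2 * v$5)\<^sup>2
      + 6 * (2 * v$1 - v$3)\<^sup>2 + 6 * (2 * v$2 - v$4)\<^sup>2 + 6 * (2 * v$7 - v$6)\<^sup>2"
  unfolding ip_self by (simp add: power2_eq_square algebra_simps)

lemma ip_self_nonneg: "0 \<le> ip v v"
  using ip_squares[of v] by (smt (verit) zero_le_power2)

lemma ip_self_eq_0: "ip v v = 0 \<longleftrightarrow> v = 0"
proof
  assume *: "ip v v = 0"
  note nn = zero_le_power2[of "v$4"] zero_le_power2[of "4 * v$5 - 3 * v$4"]
    zero_le_power2[of "3 * v$3 - 2 * v$4"] zero_le_power2[of "3 * v$6 - 2 * v$5"]
    zero_le_power2[of "2 * v$1 - v$3"] zero_le_power2[of "2 * v$2 - v$4"]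
    zero_le_power2[of "2 * v$7 - v$6"]
  note e = ip_squares[of v, unfolded *]
  have "(v$4)\<^sup>2 = 0" "(4 * v$5 - 3 * v$4)\<^sup>2 = 0" "(3 * v$3 - 2 * v$4)\<^sup>2 = 0"
    "(3 * v$6 - 2 * v$5)\<^sup>2 = 0" "(2 * v$1 - v$3)\<^sup>2 = 0" "(2 * v$2 - v$4)\<^sup>2 = 0"
    "(2 * v$7 - v$6)\<^sup>2 = 0"
    using e nn by linarith+
  then show "v = 0" by (simp add: vec_eq_iff all_7)
qed simp

lemma ip_self_ge_2: "v \<noteq> 0 \<Longrightarrow> 2 \<le> ip v v"
  using ip_self_nonneg[of v] ip_self_eq_0[of v] even_ip_self[of v] by presburger

lemma ip_simple_root_right:
  "ip v (simple_root 1) = 2 * v$1 - v$3"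
  "ip v (simple_root 2) = 2 * v$2 - v$4"
  "ip v (simple_root 3) = 2 * v$3 - v$1 - v$4"
  "ip v (simple_root 4) = 2 * v$4 - v$2 - v$3 - v$5"
  "ip v (simple_root 5) = 2 * v$5 - v$4 - v$6"
  "ip v (simple_root 6) = 2 * v$6 - v$5 - v$7"
  "ip v (simple_root 7) = 2 * v$7 - v$6"
  by (simp_all add: ip_expand simple_root_def axis_def)

lemma simple_root_nth: "simple_root i $ j = (if j = i then 1 else 0)"
  by (simp add: simple_root_def axis_def)

lemma simple_root_v7:
  "simple_root 1 = v7 1 0 0 0 0 0 0" "simple_root 2 = v7 0 1 0 0 0 0 0"
  "simple_root 3 = v7 0 0 1 0 0 0 0" "simple_root 4 = v7 0 0 0 1 0 0 0"
  "simple_root 5 = v7 0 0 0 0 1 0 0" "simple_root 6 = v7 0 0 0 0 0 1 0"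
  "simple_root 7 = v7 0 0 0 0 0 0 1"
  by (simp_all add: vec_eq_iff all_7 simple_root_nth)

lemma simple_root_eq_iff [simp]: "simple_root i = simple_root j \<longleftrightarrow> i = j"
  by (metis simple_root_nth zero_neq_one)

lemma lattice_expand: "(v :: int ^ 7) = (\<Sum>i\<in>UNIV. v $ i *s simple_root i)"
  by (simp add: vec_eq_iff all_7 sum_7 simple_root_nth)

definition is_root :: "int ^ 7 \<Rightarrow> bool" where "is_root v \<longleftrightarrow> ip v v = 2"

definition nonneg :: "int ^ 7 \<Rightarrow> bool" where "nonneg v \<longleftrightarrow> (\<forall>i. 0 \<le> v $ i)"

lemma nonneg_v7 [simp]: "nonneg (v7 a b c d e f g) \<longleftrightarrow>
   0 \<le> a \<and> 0 \<le> b \<and> 0 \<le> c \<and> 0 \<le> d \<and> 0 \<le> e \<and> 0 \<le> f \<and> 0 \<le> g"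
  by (simp add: nonneg_def all_7)

lemma is_root_uminus [simp]: "is_root (- v) \<longleftrightarrow> is_root v"
  by (simp add: is_root_def)

lemma is_root_simple_root [simp]: "is_root (simple_root i)"
  by (simp add: is_root_def simple_root_is_root)

lemma nonneg_simple_root [simp]: "nonneg (simple_root i)"
  by (simp add: nonneg_def simple_root_nth)

lemma is_root_root_vec [simp]: "is_root (root_vec \<alpha>)"
  using root_vec[of \<alpha>] by (simp add: is_root_def)

lemma root_vec_Abs_root [simp]: "is_root v \<Longrightarrow> root_vec (Abs_root v) = v"
  by (simp add: Abs_root_inverse is_root_def)

lemma is_root_nonzero: "is_root v \<Longrightarrow> v \<noteq> 0"
  by (auto simp: is_root_def)

lemma finite_roots: "finite {v. is_root v}"
proof -
  have "{v. is_root v} \<subseteq> range root_vec"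
    by (metis mem_Collect_eq rangeI root_vec_Abs_root subsetI)
  then show ?thesis by (rule finite_subset) simp
qed

lemma nonneg_uminus_both: "nonneg v \<Longrightarrow> nonneg (- v) \<Longrightarrow> v = 0"
  by (auto simp: nonneg_def vec_eq_iff intro: antisym)

lemma nonneg_add: "nonneg v \<Longrightarrow> nonneg w \<Longrightarrow> nonneg (v + w)"
  by (simp add: nonneg_def)

section \<open>Every root has coordinates of one sign\<close>

definition pos_part :: "int ^ 7 \<Rightarrow> int ^ 7" where "pos_part v = (\<chi> i. max (v $ i) 0)"

lemma pos_part_diff: "v = pos_part v - pos_part (- v)"
  by (auto simp: pos_part_def vec_eq_iff max_def)

lemma ip_pos_parts: "ip (pos_part v) (pos_part (- v)) \<le> 0"
  unfolding ip_def
proof (intro sum_nonpos)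
  fix i j :: 7
  show "pos_part v $ i * cartan i j * pos_part (- v) $ j \<le> 0"
  proof (cases "i = j")
    case True
    then show ?thesis by (auto simp: pos_part_def max_def)
  next
    case False
    then have "cartan i j \<le> 0" by (simp add: cartan_def)
    moreover have "0 \<le> pos_part v $ i" "0 \<le> pos_part (- v) $ j" by (simp_all add: pos_part_def)
    ultimately show ?thesis by (simp add: mult_nonneg_nonpos mult_nonpos_nonneg)
  qed
qed

lemma pos_part_eq_0: "pos_part v = 0 \<longleftrightarrow> nonneg (- v)"
  by (auto simp: pos_part_def nonneg_def vec_eq_iff max_def split: if_splits)

text \<open>A root of mixed sign would be the difference of two nonzero nonnegative vectors, each of
  norm at least 2 and with nonpositive pairing; its norm would be at least 4.\<close>

lemma root_sign: "is_root v \<Longrightarrow> nonneg v \<or> nonneg (- v)"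
proof (rule ccontr)
  assume r: "is_root v" and "\<not> (nonneg v \<or> nonneg (- v))"
  then have "pos_part v \<noteq> 0" "pos_part (- v) \<noteq> 0"
    using pos_part_eq_0[of v] pos_part_eq_0[of "- v"] by auto
  then have "2 \<le> ip (pos_part v) (pos_part v)" "2 \<le> ip (pos_part (- v)) (pos_part (- v))"
    by (auto intro: ip_self_ge_2)
  moreover have "ip v v = ip (pos_part v) (pos_part v) + ip (pos_part (- v)) (pos_part (- v))
      - 2 * ip (pos_part v) (pos_part (- v))"
    by (subst (1 2) pos_part_diff[of v]) (simp add: ip_sym[of "pos_part (- v)" "pos_part v"])
  ultimately show False using ip_pos_parts[of v] r by (simp add: is_root_def)
qed

lemma root_neg_iff: "is_root v \<Longrightarrow> \<not> nonneg v \<longleftrightarrow> nonneg (- v)"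
  using root_sign nonneg_uminus_both is_root_nonzero by blast

text \<open>Cauchy-Schwarz with its equality cases, read off from the norms 4 - 2(v|w) and 4 +
  2(v|w) of the difference and the sum.\<close>

lemma root_ip_bounds:
  assumes "is_root v" "is_root w"
  shows "ip v w \<in> {-2..2}" "ip v w = 2 \<longleftrightarrow> v = w" "ip v w = -2 \<longleftrightarrow> v = - w"
proof -
  have 1: "ip (v - w) (v - w) = 4 - 2 * ip v w" "ip (v + w) (v + w) = 4 + 2 * ip v w"
    using assms by (simp_all add: is_root_def ip_sym[of w v])
  then show "ip v w \<in> {-2..2}" using ip_self_nonneg[of "v - w"] ip_self_nonneg[of "v + w"] by auto
  show "ip v w = 2 \<longleftrightarrow> v = w" using ip_self_eq_0[of "v - w"] 1 by auto
  show "ip v w = -2 \<longleftrightarrow> v = - w" using ip_self_eq_0[of "v + w"] 1 by (auto simp: add_eq_0_iff2)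
qed

lemma root_add_iff: "is_root v \<Longrightarrow> is_root w \<Longrightarrow> is_root (v + w) \<longleftrightarrow> ip v w = -1"
  by (auto simp: is_root_def ip_sym[of w v])

subsection \<open>Lengths in the Weyl group\<close>

lemma refl_nth: "refl i v $ k = v $ k - (if k = i then ip v (simple_root i) else 0)"
  by (simp add: refl_def simple_root_nth)

lemma refl_v7 [simp]:
  "refl 1 (v7 a b c d e f g) = v7 (c - a) b c d e f g"
  "refl 2 (v7 a b c d e f g) = v7 a (d - b) c d e f g"
  "refl 3 (v7 a b c d e f g) = v7 a b (a + d - c) d e f g"
  "refl 4 (v7 a b c d e f g) = v7 a b c (b + c + e - d) e f g"
  "refl 5 (v7 a b c d e f g) = v7 a b c d (d + f - e) f g"
  "refl 6 (v7 a b c d e f g) = v7 a b c d e (e + g - f) g"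
  "refl 7 (v7 a b c d e f g) = v7 a b c d e f (f - g)"
  by (simp_all add: vec_eq_iff all_7 refl_nth ip_simple_root_right)

lemma refl_linear [simp]:
  "refl i (v + w) = refl i v + refl i w" "refl i (v - w) = refl i v - refl i w"
  "refl i (- v) = - refl i v" "refl i (c *s v) = c *s refl i v" "refl i 0 = 0"
  by (simp_all add: refl_def vec_eq_iff algebra_simps)

lemma refl_simple_root [simp]: "refl i (simple_root i) = - simple_root i"
  by (simp add: refl_def vec_eq_iff simple_root_is_root)

lemma refl_refl [simp]: "refl i (refl i v) = v"
proof -
  have "refl i (refl i v) = refl i (v - ip v (simple_root i) *s simple_root i)"
    by (simp add: refl_def)
  also have "\<dots> = v" by (simp only: refl_linear refl_simple_root) (simp add: refl_def vec_eq_iff)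
  finally show ?thesis .
qed

lemma ip_refl [simp]: "ip (refl i v) (refl i w) = ip v w"
  by (simp add: refl_def simple_root_is_root ip_sym[of "simple_root i"])

lemma ip_refl_left: "ip (refl i v) w = ip v (refl i w)"
  by (metis ip_refl refl_refl)

lemma weyl_word_Nil [simp]: "weyl_word [] = id"
  by (simp add: weyl_word_def)

lemma weyl_word_Cons: "weyl_word (i # is) = refl i \<circ> weyl_word is"
  by (simp add: weyl_word_def)

lemma weyl_word_Cons_apply [simp]: "weyl_word (i # is) v = refl i (weyl_word is v)"
  by (simp add: weyl_word_def)

lemma weyl_word_append: "weyl_word (is @ js) = weyl_word is \<circ> weyl_word js"
  by (induction "is") (auto simp: weyl_word_Cons fun_eq_iff)

lemma weyl_word_append_apply [simp]: "weyl_word (is @ js) v = weyl_word is (weyl_word js v)"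
  by (simp add: weyl_word_append)

lemma weyl_word_snoc: "weyl_word (is @ [i]) = weyl_word is \<circ> refl i"
  by (simp add: fun_eq_iff)

lemma weyl_word_linear [simp]:
  "weyl_word is (v + w) = weyl_word is v + weyl_word is w"
  "weyl_word is (v - w) = weyl_word is v - weyl_word is w"
  "weyl_word is (- v) = - weyl_word is v" "weyl_word is (c *s v) = c *s weyl_word is v"
  "weyl_word is 0 = 0"
  by (induction "is") auto

lemma weyl_word_sum: "finite A \<Longrightarrow> weyl_word is (\<Sum>x\<in>A. f x) = (\<Sum>x\<in>A. weyl_word is (f x))"
  by (induction A rule: finite_induct) auto

lemma ip_weyl_word [simp]: "ip (weyl_word is v) (weyl_word is w) = ip v w"
  by (induction "is") auto

lemma weyl_word_rev [simp]: "weyl_word (rev is) (weyl_word is v) = v"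
  "weyl_word is (weyl_word (rev is) v) = v"
proof -
  show *: "weyl_word (rev is) (weyl_word is v) = v" for "is" v by (induction "is") auto
  show "weyl_word is (weyl_word (rev is) v) = v" using *[of "rev is"] by simp
qed

lemma weyl_word_rev_comp: "weyl_word (rev is) \<circ> weyl_word is = id"
  "weyl_word is \<circ> weyl_word (rev is) = id"
  by (auto simp: fun_eq_iff)

lemma weyl_word_inv: "inv_into UNIV (weyl_word is) = weyl_word (rev is)"
  by (rule inv_unique_comp) (auto simp: fun_eq_iff)

lemma is_root_weyl_word [simp]: "is_root (weyl_word is v) \<longleftrightarrow> is_root v"
  by (simp add: is_root_def)

lemma is_root_refl [simp]: "is_root (refl i v) \<longleftrightarrow> is_root v"
  by (simp add: is_root_def)

lemma weyl_word_expand: "weyl_word is v = (\<Sum>i\<in>UNIV. v $ i *s weyl_word is (simple_root i))"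
  by (subst lattice_expand[of v]) (simp add: weyl_word_sum)

lemma weyl_word_eqI:
  assumes "\<And>i. weyl_word is (simple_root i) = weyl_word js (simple_root i)"
  shows "weyl_word is = weyl_word js"
proof
  fix v show "weyl_word is v = weyl_word js v"
    using weyl_word_expand[of "is" v] weyl_word_expand[of js v] assms by simp
qed

lemma parabolic_word: "set is \<subseteq> J \<Longrightarrow> weyl_word is \<in> parabolic J"
  by (auto simp: parabolic_def)

lemma parabolic_fix_coord: "w \<in> parabolic J \<Longrightarrow> k \<notin> J \<Longrightarrow> w v $ k = v $ k"
proof -
  have "set is \<subseteq> J \<Longrightarrow> k \<notin> J \<Longrightarrow> weyl_word is v $ k = v $ k" for "is"
    by (induction "is") (auto simp: refl_nth)
  then show "w \<in> parabolic J \<Longrightarrow> k \<notin> J \<Longrightarrow> w v $ k = v $ k" by (auto simp: parabolic_def)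
qed

lemma parabolic_mono: "w \<in> parabolic J \<Longrightarrow> w \<in> weyl_group"
  by (auto simp: parabolic_def)

lemma parabolic_comp: "v \<in> parabolic J \<Longrightarrow> w \<in> parabolic J \<Longrightarrow> v \<circ> w \<in> parabolic J"
  by (auto simp: parabolic_def) (metis set_append Un_least weyl_word_append)

lemma parabolic_inverse:
  assumes "v \<in> parabolic J"
  obtains w where "w \<in> parabolic J" "v \<circ> w = id" "w \<circ> v = id"
proof -
  obtain "is" where "v = weyl_word is" "set is \<subseteq> J" using assms by (auto simp: parabolic_def)
  then show ?thesis
    by (metis that parabolic_word set_rev weyl_word_rev_comp)
qed

text \<open>Only coordinate \<open>i\<close> changes, and a root has coordinates of one sign. If
  that coordinate turned negative, all others would be zero and \<open>v\<close> a positive multiple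
  of \<open>simple_root i\<close>, hence equal to it.\<close>

lemma refl_nonneg:
  assumes "is_root v" "nonneg v" "v \<noteq> simple_root i"
  shows "nonneg (refl i v)"
proof (rule ccontr)
  assume "\<not> nonneg (refl i v)"
  then have n: "nonneg (- refl i v)" using assms(1) root_neg_iff is_root_refl by blast
  have z: "v $ k = 0" if "k \<noteq> i" for k
    using n assms(2) that by (auto simp: nonneg_def refl_nth) (smt (verit))
  then have v: "v = v $ i *s simple_root i" by (auto simp: vec_eq_iff simple_root_nth)
  have "ip v v = 2 * (v $ i)\<^sup>2"
    by (subst (1 2) v) (simp add: simple_root_is_root power2_eq_square)
  then have "(v $ i)\<^sup>2 = 1" using assms(1) by (simp add: is_root_def)
  then have "v $ i = 1" using assms(2) by (auto simp: nonneg_def power2_eq_1_iff) (smt (verit))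
  then show False using v assms(3) by (simp add: vec_eq_iff)
qed

definition inversions :: "(int ^ 7 \<Rightarrow> int ^ 7) \<Rightarrow> (int ^ 7) set" where
  "inversions w = {v. is_root v \<and> nonneg v \<and> \<not> nonneg (w v)}"

lemma finite_inversions [simp]: "finite (inversions w)"
  by (rule finite_subset[OF _ finite_roots]) (auto simp: inversions_def)

text \<open>The root criterion for reduced words, letter by letter. It can be evaluated by
  rewriting, unlike the minimum over all words in \<open>len\<close>.\<close>

definition ascending :: "7 list \<Rightarrow> bool" where
  "ascending is \<longleftrightarrow> (\<forall>k<length is. nonneg (weyl_word (take k is) (simple_root (is ! k))))"

lemma ascending_Nil [simp]: "ascending []" by (simp add: ascending_def)

lemma ascending_snoc:
  "ascending (is @ [i]) \<longleftrightarrow> ascending is \<and> nonneg (weyl_word is (simple_root i))"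
  by (auto simp: ascending_def nth_append less_Suc_eq)

text \<open>\<open>refl i\<close> permutes the positive roots other than
  \<open>simple_root i\<close>, and the latter becomes a new inversion. So an ascending letter adds
  exactly one inversion.\<close>

lemma inversions_comp_refl:
  assumes "w = weyl_word is" "nonneg (w (simple_root i))"
  shows "inversions (w \<circ> refl i) = insert (simple_root i) (refl i ` inversions w)"
proof (intro equalityI subsetI)
  fix v assume v: "v \<in> inversions (w \<circ> refl i)"
  show "v \<in> insert (simple_root i) (refl i ` inversions w)"
  proof (cases "v = simple_root i")
    case False
    then have "refl i v \<in> inversions w" using v refl_nonneg by (auto simp: inversions_def)
    then show ?thesis by (metis imageI insertCI refl_refl)
  qed simp
next
  fix v assume v: "v \<in> insert (simple_root i) (refl i ` inversions w)"
  have "\<not> nonneg (w (- simple_root i))"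
    using assms root_neg_iff[of "w (- simple_root i)"] by simp
  moreover have "nonneg (refl i x)" if "is_root x" "nonneg x" "\<not> nonneg (w x)" for x
    using that assms refl_nonneg[of x i] by (cases "x = simple_root i") auto
  ultimately show "v \<in> inversions (w \<circ> refl i)"
    using v assms by (auto simp: inversions_def)
qed

lemma simple_root_notin_refl_inversions:
  "simple_root i \<notin> refl i ` inversions w"
proof
  assume "simple_root i \<in> refl i ` inversions w"
  then obtain v where v: "simple_root i = refl i v" "v \<in> inversions w" by auto
  then have "v = - simple_root i" by (metis refl_refl refl_simple_root)
  moreover have "\<not> nonneg (- simple_root i)" using nonneg_uminus_both[of "simple_root i"]
    by (metis is_root_nonzero is_root_simple_root nonneg_simple_root)
  ultimately show False using v by (simp add: inversions_def)
qed

lemma inj_refl: "inj_on (refl i) A"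
  by (metis inj_onI refl_refl)

lemma card_inversions_ascending: "ascending is \<Longrightarrow> card (inversions (weyl_word is)) = length is"
proof (induction "is" rule: rev_induct)
  case Nil
  then show ?case by (simp add: inversions_def)
next
  case (snoc i "is")
  then have "inversions (weyl_word (is @ [i]))
      = insert (simple_root i) (refl i ` inversions (weyl_word is))"
    unfolding weyl_word_snoc ascending_snoc by (intro inversions_comp_refl) auto
  moreover have "card (insert (simple_root i) (refl i ` inversions (weyl_word is)))
    = length (is @ [i])"
    using snoc simple_root_notin_refl_inversions[of i]
    by (simp add: ascending_snoc card_image[OF inj_refl])
  ultimately show ?case by metis
qed

text \<open>Exchange condition. Reading the word from the right, the letter \<open>j\<close> that
  first makes the root negative must meet it at \<open>simple_root j\<close>. The suffix after
  \<open>j\<close> then conjugates \<open>refl i\<close> into \<open>refl j\<close>, so that these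
  two letters cancel.\<close>

lemma exchange:
  "\<not> nonneg (weyl_word is (simple_root i)) \<Longrightarrow>
    \<exists>js. length js + 1 = length is \<and> weyl_word js = weyl_word (is @ [i])"
proof (induction "is")
  case Nil
  then show ?case by simp
next
  case (Cons j "is")
  show ?case
  proof (cases "nonneg (weyl_word is (simple_root i))")
    case True
    then have e: "weyl_word is (simple_root i) = simple_root j"
      using Cons.prems refl_nonneg[of "weyl_word is (simple_root i)" j] by auto
    have "weyl_word is (refl i v) = refl j (weyl_word is v)" for v
      using e ip_weyl_word[of "is" v "simple_root i"] by (simp add: refl_def)
    then have "weyl_word is = weyl_word ((j # is) @ [i])" by (intro ext) simp
    then show ?thesis by (intro exI[of _ "is"] conjI) (simp, assumption)
  next
    case False
    from Cons.IH[OF this] obtain js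
      where js: "length js + 1 = length is" "weyl_word js = weyl_word (is @ [i])"
      by (elim exE conjE)
    have "weyl_word (j # js) = weyl_word ((j # is) @ [i])"
      unfolding append_Cons weyl_word_Cons js ..
    then show ?thesis using js(1) by (intro exI[of _ "j # js"] conjI) (simp, assumption)
  qed
qed

lemma len_le: "weyl_word is = w \<Longrightarrow> len w \<le> length is"
  unfolding len_def by (rule Least_le) auto

lemma ex_reduced: 
  assumes "w \<in> weyl_group" obtains "is" where "reduced_expr is w"
proof -
  have "\<exists>d is. weyl_word is = w \<and> length is = d" using assms by (auto simp: parabolic_def)
  then have "\<exists>is. weyl_word is = w \<and> length is = len w" unfolding len_def by (rule LeastI_ex)
  then show ?thesis using that by (auto simp: reduced_expr_def)
qed

lemma reduced_imp_ascending:
  assumes "reduced_expr is w" shows "ascending is"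
  unfolding ascending_def
proof (intro allI impI)
  fix k assume k: "k < length is"
  show "nonneg (weyl_word (take k is) (simple_root (is ! k)))"
  proof (rule ccontr)
    assume "\<not> ?thesis"
    then obtain js where js: "length js + 1 = length (take k is)"
      "weyl_word js = weyl_word (take k is @ [is ! k])" using exchange by blast
    have "is = take k is @ [is ! k] @ drop (Suc k) is" using k by (simp add: id_take_nth_drop)
    then have "weyl_word is = weyl_word (js @ drop (Suc k) is)" using js(2)
      by (metis append.assoc weyl_word_append)
    then have "len w \<le> length (js @ drop (Suc k) is)" using assms len_le
      by (metis reduced_expr_def)
    then show False using js(1) k assms by (auto simp: reduced_expr_def)
  qed
qed

lemma len_eq_card_inversions: "w \<in> weyl_group \<Longrightarrow> len w = card (inversions w)"
  by (metis card_inversions_ascending ex_reduced reduced_expr_def reduced_imp_ascending)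

lemma reduced_iff_ascending: "reduced_expr is w \<longleftrightarrow> weyl_word is = w \<and> ascending is"
  using card_inversions_ascending len_eq_card_inversions parabolic_word[of "is" UNIV]
  by (metis reduced_expr_def reduced_imp_ascending subset_UNIV)

lemma no_inversions_imp_id: "w \<in> weyl_group \<Longrightarrow> inversions w = {} \<Longrightarrow> w = id"
  by (metis card.empty ex_reduced len_eq_card_inversions length_0_conv reduced_expr_def
      weyl_word_Nil)

subsection \<open>Longest elements and minimal representatives\<close>

definition pos_roots :: "7 set \<Rightarrow> (int ^ 7) set" where
  "pos_roots J = {v. is_root v \<and> nonneg v \<and> (\<forall>k. k \<notin> J \<longrightarrow> v $ k = 0)}"

lemma finite_pos_roots [simp]: "finite (pos_roots J)"
  by (rule finite_subset[OF _ finite_roots]) (auto simp: pos_roots_def)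

lemma parabolic_stays_nonneg:
  assumes "w \<in> parabolic J" "is_root v" "nonneg v" "k \<notin> J" "v $ k \<noteq> 0"
  shows "nonneg (w v)"
proof (rule ccontr)
  assume "\<not> nonneg (w v)"
  moreover have "is_root (w v)" using assms by (auto simp: parabolic_def)
  ultimately have "nonneg (- w v)" using root_neg_iff by blast
  then have "w v $ k \<le> 0" unfolding nonneg_def by simp
  then show False using assms parabolic_fix_coord[of w J k v] unfolding nonneg_def by (smt (verit))
qed

lemma inversions_parabolic: "w \<in> parabolic J \<Longrightarrow> inversions w \<subseteq> pos_roots J"
  using parabolic_stays_nonneg by (fastforce simp: inversions_def pos_roots_def)

lemma parabolic_root: "w \<in> weyl_group \<Longrightarrow> is_root (w v) \<longleftrightarrow> is_root v"
  by (auto simp: parabolic_def)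

lemma parabolic_uminus: "w \<in> weyl_group \<Longrightarrow> w (- v) = - w v"
  by (auto simp: parabolic_def)

lemma nonneg_sum: "(\<And>x. x \<in> A \<Longrightarrow> nonneg (f x)) \<Longrightarrow> nonneg (\<Sum>x\<in>A. f x)"
  by (auto simp: nonneg_def sum_nonneg)

lemma weyl_nonneg_on_parabolic:
  assumes "w \<in> weyl_group" "\<And>j. j \<in> J \<Longrightarrow> nonneg (w (simple_root j))" "v \<in> pos_roots J"
  shows "nonneg (w v)"
proof -
  obtain "is" where w: "w = weyl_word is" using assms by (auto simp: parabolic_def)
  have "nonneg (\<Sum>i\<in>UNIV. v $ i *s weyl_word is (simple_root i))"
  proof (rule nonneg_sum)
    fix i show "nonneg (v $ i *s weyl_word is (simple_root i))"
      using assms(2)[of i] assms(3) w by (cases "i \<in> J") (auto simp: pos_roots_def nonneg_def)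
  qed
  then show ?thesis using w weyl_word_expand[of "is" v] by simp
qed

lemma weyl_nonpos_on_parabolic:
  assumes "w \<in> weyl_group" "\<And>j. j \<in> J \<Longrightarrow> nonneg (- w (simple_root j))" "v \<in> pos_roots J"
  shows "nonneg (- w v)"
proof -
  obtain "is" where w: "w = weyl_word is" using assms by (auto simp: parabolic_def)
  have "nonneg (\<Sum>i\<in>UNIV. - (v $ i *s weyl_word is (simple_root i)))"
  proof (rule nonneg_sum)
    fix i show "nonneg (- (v $ i *s weyl_word is (simple_root i)))"
      using assms(2)[of i] assms(3) w by (cases
        "i \<in> J") (auto simp: pos_roots_def nonneg_def mult_nonneg_nonpos)
  qed
  then show ?thesis using w weyl_word_expand[of "is" v] by (simp add: sum_negf)
qed

lemma pos_roots_weyl_uminus: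
  assumes "w \<in> parabolic J" "v \<in> pos_roots J" "nonneg (- w v)"
  shows "- w v \<in> pos_roots J"
  using assms parabolic_fix_coord[OF assms(1)] parabolic_root[OF parabolic_mono[OF assms(1)]]
  by (auto simp: pos_roots_def)

text \<open>Negativity on the simple roots of \<open>J\<close> makes every positive root of
  \<open>J\<close> an inversion, the largest inversion set possible. Composing \<open>w\<close> with
  any element that has this full set leaves no inversions. Hence that element is inverse to
  \<open>w\<close>; this applies to \<open>w\<close> itself, which gives uniqueness.\<close>

lemma longest_eqI:
  assumes w: "w \<in> parabolic J" and neg: "\<And>j. j \<in> J \<Longrightarrow> nonneg (- w (simple_root j))"
  shows "longest J = w" "inversions w = pos_roots J"
proof -
  show iw: "inversions w = pos_roots J"
  proof (intro equalityI inversions_parabolic[OF w] subsetI)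
    fix v assume v: "v \<in> pos_roots J"
    then have "nonneg (- w v)" by (metis weyl_nonpos_on_parabolic neg parabolic_mono w)
    moreover have "is_root (w v)" using v w parabolic_root parabolic_mono
      by (auto simp: pos_roots_def)
    ultimately show "v \<in> inversions w" using v root_neg_iff
      by (auto simp: inversions_def pos_roots_def)
  qed
  have le: "len v \<le> len w" if "v \<in> parabolic J" for v
    using that w inversions_parabolic[OF that] iw
    by (metis card_mono finite_pos_roots len_eq_card_inversions parabolic_mono)
  have wv: "w \<circ> v = id" if v: "v \<in> parabolic J" and iv: "inversions v = pos_roots J" for v
  proof (rule no_inversions_imp_id)
    have c: "w \<circ> v \<in> parabolic J" using v w parabolic_comp by blast
    then show "w \<circ> v \<in> weyl_group" by (rule parabolic_mono)
    show "inversions (w \<circ> v) = {}"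
    proof (rule ccontr)
      assume "inversions (w \<circ> v) \<noteq> {}"
      then obtain x where x: "x \<in> inversions (w \<circ> v)" by auto
      then have xp: "x \<in> pos_roots J" using inversions_parabolic[OF c] by auto
      then have "\<not> nonneg (v x)" using iv by (auto simp: inversions_def)
      moreover have "is_root (v x)"
        using xp v parabolic_root parabolic_mono by (auto simp: pos_roots_def)
      ultimately have "- v x \<in> pos_roots J"
        using pos_roots_weyl_uminus[OF v xp] root_neg_iff by blast
      then have "\<not> nonneg (w (- v x))" using iw by (auto simp: inversions_def)
      then have "\<not> nonneg (- w (v x))" using parabolic_uminus parabolic_mono w by metis
      moreover have "\<not> nonneg (w (v x))" using x by (auto simp: inversions_def)
      ultimately show False using x root_sign[of
        "w (v x)"] c parabolic_root[OF parabolic_mono[OF c]]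
        by (auto simp: inversions_def)
    qed
  qed
  show "longest J = w" unfolding longest_def
  proof (rule the_equality)
    fix v assume v: "v \<in> parabolic J \<and> (\<forall>u\<in>parabolic J. len u \<le> len v)"
    then have "len w \<le> len v" using w by auto
    then have "card (pos_roots J) \<le> card (inversions v)"
      using iw v w by (metis len_eq_card_inversions parabolic_mono)
    then have "inversions v = pos_roots J"
      using v inversions_parabolic[of v J] by (metis card_seteq finite_pos_roots)
    then have "w \<circ> v = id" "w \<circ> w = id" using wv v w iw by auto
    then show "v = w" by (metis comp_assoc comp_id id_comp)
  qed (use w le in auto)
qed

lemma pos_roots_parabolic_image:
  assumes v: "v \<in> parabolic J" and x: "is_root x" "nonneg x" "x \<notin> pos_roots J"
  shows "is_root (v x)" "nonneg (v x)" "v x \<notin> pos_roots J"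
proof -
  obtain k where k: "k \<notin> J" "x $ k \<noteq> 0" using x by (auto simp: pos_roots_def)
  show "is_root (v x)" using x v parabolic_root parabolic_mono by auto
  show "nonneg (v x)" using parabolic_stays_nonneg[OF v] x k by auto
  show "v x \<notin> pos_roots J" using parabolic_fix_coord[OF v k(1)] k by (auto simp: pos_roots_def)
qed

text \<open>Lengths add on the coset: the inversions of \<open>x \<circ> u\<close> contain those of
  \<open>u\<close> and the image of those of \<open>x\<close> under the inverse of \<open>u\<close>.
  The two sets are disjoint because \<open>x\<close> keeps the positive roots of the parabolic
  subsystem positive.\<close>

lemma min_rep_eqI:
  assumes x: "x \<in> weyl_group" and pos: "\<And>j. j \<noteq> 7 \<Longrightarrow> nonneg (x (simple_root j))"
    and v: "v \<in> weyl_group_P" "x = w \<circ> v"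
  shows "min_rep w = x"
proof -
  let ?J = "UNIV - {7 :: 7}"
  have xp: "nonneg (x y)" if "y \<in> pos_roots ?J" for y
    using weyl_nonneg_on_parabolic[OF x _ that] pos by auto
  have notin: "y \<notin> pos_roots ?J" if "y \<in> inversions x" for y
    using that xp by (auto simp: inversions_def)
  have sub: "u' ` inversions x \<union> inversions u \<subseteq> inversions (x \<circ> u)"
    "u' ` inversions x \<inter> inversions u = {}" "card (u' ` inversions x) = card (inversions x)"
    if u: "u \<in> parabolic ?J" "u' \<in> parabolic ?J" "u \<circ> u' = id" for u u'
  proof -
    have i: "u (u' y) = y" for y using u(3) by (metis comp_apply id_apply)
    have 1: "u' y \<in> inversions (x \<circ> u)" "u' y \<notin> pos_roots ?J" if "y \<in> inversions x" for y
      using that pos_roots_parabolic_image[OF u(2), of y] notin[OF that] i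
        by (auto simp: inversions_def)
    have 2: "y \<in> inversions (x \<circ> u)" if y: "y \<in> inversions u" for y
    proof -
      have yp: "y \<in> pos_roots ?J" using y inversions_parabolic[OF u(1)] by auto
      have r: "is_root (u y)" "is_root (x (u y))"
        using y parabolic_root[OF parabolic_mono[OF u(1)]] parabolic_root[OF x]
          by (auto simp: inversions_def)
      then have "- u y \<in> pos_roots ?J"
        using pos_roots_weyl_uminus[OF u(1) yp] y root_neg_iff[of "u y"]
          by (auto simp: inversions_def)
      then have "nonneg (- x (u y))" using xp parabolic_uminus[OF x] by metis
      then show ?thesis using y r root_neg_iff by (auto simp: inversions_def)
    qed
    show "u' ` inversions x \<union> inversions u \<subseteq> inversions (x \<circ> u)" using 1 2 by auto
    show "u' ` inversions x \<inter> inversions u = {}" using 1 inversions_parabolic[OF u(1)] by auto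
    show "card (u' ` inversions x) = card (inversions x)"
      by (rule card_image) (metis i inj_onI)
  qed
  have le: "card (inversions x) + card (inversions u) \<le> card (inversions (x \<circ> u))"
    if u: "u \<in> parabolic ?J" for u
  proof -
    obtain u' where u': "u' \<in> parabolic ?J" "u \<circ> u' = id" using parabolic_inverse[OF u] by auto
    note s = sub[OF u u']
    have "card (u' ` inversions x \<union> inversions u) = card (inversions x) + card (inversions u)"
      using s by (simp add: card_Un_disjoint)
    then show ?thesis using s(1) by (metis card_mono finite_inversions)
  qed
  have xu: "x \<circ> u \<in> weyl_group" if "u \<in> parabolic ?J" for u
    using parabolic_comp[OF x parabolic_mono[OF that]] .
  have mr: "x \<in> min_reps" unfolding min_reps_def
    using x le xu len_eq_card_inversions by (auto) (metis add_leD1)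
  show ?thesis unfolding min_rep_def
  proof (rule the_equality)
    show "x \<in> min_reps \<and> (\<exists>v\<in>weyl_group_P. x = w \<circ> v)" using mr v by auto
    fix y assume y: "y \<in> min_reps \<and> (\<exists>v\<in>weyl_group_P. y = w \<circ> v)"
    then obtain v2 where v2: "v2 \<in> weyl_group_P" "y = w \<circ> v2" by auto
    obtain v' where v': "v' \<in> parabolic ?J" "v \<circ> v' = id" using parabolic_inverse[OF v(1)] by auto
    have w: "w = x \<circ> v'" using v v' by (metis comp_assoc comp_id)
    define u where "u = v' \<circ> v2"
    have u: "u \<in> parabolic ?J" using v' v2 parabolic_comp u_def by blast
    have yu: "y = x \<circ> u" using v2 w by (simp add: u_def comp_assoc)
    obtain u' where u': "u' \<in> parabolic ?J" "u \<circ> u' = id" using parabolic_inverse[OF u] by auto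
    have "len y \<le> len (y \<circ> u')" using y u' by (auto simp: min_reps_def)
    also have "y \<circ> u' = x" using yu u' by (simp add: comp_assoc)
    finally have "card (inversions (x \<circ> u)) \<le> card (inversions x)"
      using len_eq_card_inversions x xu[OF u] yu by metis
    then have "card (inversions u) = 0" using le[OF u] by linarith
    then have "u = id" using no_inversions_imp_id parabolic_mono[OF u] by auto
    then show "y = x" using yu by simp
  qed
qed

section \<open>Words for the longest elements, \<open>w_sup_P\<close>, \<open>w_pp\<close> and
  \<open>w_p\<close>\<close>

definition w0_word :: "7 list" where
  "w0_word = [1,2,3,1,4,2,3,1,4,3,5,4,2,3,1,4,3,5,4,2,6,5,4,2,3,1,4,3,5,4,2,6,5,4,3,1,
    7,6,5,4,2,3,1,4,3,5,4,2,6,5,4,3,1,7,6,5,4,2,3,4,5,6,7]"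

text \<open>The 36 letters match the 36 positive roots of the \<open>E_6\<close> subsystem;
  \<open>w0_word\<close> continues this word by 27 letters to the 63 of \<open>E_7\<close>.\<close>

definition wP_word :: "7 list" where
  "wP_word = [1,2,3,1,4,2,3,1,4,3,5,4,2,3,1,4,3,5,4,2,6,5,4,2,3,1,4,3,5,4,2,6,5,4,3,1]"

lemma w0_word_simple: "weyl_word w0_word (simple_root i) = - simple_root i"
proof -
  have "\<forall>i. weyl_word w0_word (simple_root i) = - simple_root i"
    unfolding all_7 simple_root_v7 w0_word_def
    by (simp add: vec_eq_iff all_7)
  then show ?thesis by blast
qed

lemma w_0_eq: "w_0 = weyl_word w0_word" "w_0 v = - v"
proof -
  show *: "w_0 = weyl_word w0_word"
    by (rule longest_eqI) (auto intro: parabolic_word simp: w0_word_simple)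
  show "w_0 v = - v"
    unfolding * by (subst weyl_word_expand, subst (2) lattice_expand)
      (simp add: w0_word_simple sum_negf)
qed

text \<open>On the simple roots of \<open>E_6\<close> this is minus the diagram automorphism; the
  image of \<open>simple_root 7\<close> is the highest root of \<open>E_7\<close>.\<close>

lemma wP_word_simple:
  "weyl_word wP_word (simple_root 1) = - simple_root 6"
  "weyl_word wP_word (simple_root 2) = - simple_root 2"
  "weyl_word wP_word (simple_root 3) = - simple_root 5"
  "weyl_word wP_word (simple_root 4) = - simple_root 4"
  "weyl_word wP_word (simple_root 5) = - simple_root 3"
  "weyl_word wP_word (simple_root 6) = - simple_root 1"
  "weyl_word wP_word (simple_root 7) = v7 2 2 3 4 3 2 1"
  unfolding simple_root_v7 wP_word_def by (simp_all add: vec_eq_iff all_7)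

lemma minus_7_cases: "j \<in> UNIV - {7 :: 7} \<Longrightarrow> j = 1 \<or> j = 2 \<or> j = 3 \<or> j = 4 \<or> j = 5 \<or> j = 6"
  using exhaust_7[of j] by auto

lemma wP_in: "weyl_word wP_word \<in> weyl_group_P"
  by (rule parabolic_word) (simp add: wP_word_def)

lemma w_P_eq: "w_P = weyl_word wP_word" "inversions w_P = pos_roots (UNIV - {7})"
proof -
  have *: "nonneg (- weyl_word wP_word (simple_root j))" if "j \<in> UNIV - {7 :: 7}" for j
    using minus_7_cases[OF that] by (auto simp: wP_word_simple)
  show "w_P = weyl_word wP_word" using longest_eqI(1)[OF wP_in *] by simp
  then show "inversions w_P = pos_roots (UNIV - {7})" using longest_eqI(2)[OF wP_in *] by simp
qed

lemma r_word_simple: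
  "weyl_word r_word (simple_root i) = - weyl_word wP_word (simple_root i)"
proof -
  have "\<forall>i. weyl_word r_word (simple_root i) = - weyl_word wP_word (simple_root i)"
    unfolding all_7 wP_word_simple unfolding simple_root_v7 r_word_def
    by (simp add: vec_eq_iff all_7)
  then show ?thesis by blast
qed

lemma weyl_word_r_word: "weyl_word r_word = w_0 \<circ> w_P"
  unfolding w_0_eq(1) w_P_eq(1) weyl_word_append[symmetric]
  by (rule weyl_word_eqI) (simp add: r_word_simple w_0_eq(2)[unfolded w_0_eq(1)])

lemma r_word_min: "j \<noteq> 7 \<Longrightarrow> nonneg (weyl_word r_word (simple_root j))"
  using minus_7_cases[of j] by (auto simp: r_word_simple wP_word_simple)

lemma w_sup_P_eq: "w_sup_P = weyl_word r_word"
  unfolding w_sup_P_def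
  by (rule min_rep_eqI[OF parabolic_word r_word_min wP_in]) 
    (auto simp: weyl_word_r_word w_P_eq(1))

definition wpp_word :: "7 list" where "wpp_word = drop 10 r_word"

text \<open>The longest element of the \<open>D_5\<close> on the nodes 1 to 5, which commutes with
  \<open>s_7\<close>. If \<open>w_P = u w_D\<close> with \<open>w_D\<close> this element, then
  \<open>w_P s_7 = u s_7 w_D\<close>, so the short representative is \<open>u s_7\<close>, of length
  36 - 20 + 1 = 17.\<close>

definition wpp_coset_word :: "7 list" where
  "wpp_coset_word = [2,4,5,3,4,1,3,2,4,5,3,4,1,3,2,4,1,3,2,1]"

lemma w_pp_eq: "w_pp = weyl_word wpp_word"
  unfolding w_pp_def
proof (rule min_rep_eqI)
  show "nonneg (weyl_word wpp_word (simple_root j))" if "j \<noteq> 7" for j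
    using minus_7_cases[of j] that
    by (auto simp: wpp_word_def r_word_def simple_root_v7)
  show "weyl_word wpp_coset_word \<in> weyl_group_P"
    by (rule parabolic_word) (simp add: wpp_coset_word_def)
  have "\<forall>i. weyl_word wpp_word (simple_root i) = weyl_word (wP_word @ [7] @ wpp_coset_word)
    (simple_root i)"
    unfolding all_7 by (simp add: simple_root_v7 wpp_word_def r_word_def wP_word_def
      wpp_coset_word_def)
  then have "weyl_word wpp_word = weyl_word (wP_word @ [7] @ wpp_coset_word)"
    by (intro weyl_word_eqI) blast
  then show "weyl_word wpp_word = w_P \<circ> refl 7 \<circ> weyl_word wpp_coset_word"
    by (simp add: w_P_eq(1) fun_eq_iff)
qed (auto intro: parabolic_word)

lemma w_p_eq: "w_p = weyl_word [7,6,5,4,2,3,4,5,6,7]"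
proof -
  have r: "r_word = [7,6,5,4,2,3,4,5,6,7] @ wpp_word" by (simp add: wpp_word_def r_word_def)
  have "weyl_word r_word \<circ> weyl_word (rev wpp_word) = weyl_word [7,6,5,4,2,3,4,5,6,7]"
    unfolding r weyl_word_append comp_assoc weyl_word_rev_comp by simp
  then show ?thesis unfolding w_p_def w_pp_eq weyl_word_inv w_sup_P_eq .
qed

lemma ascending_iff: "ascending is \<longleftrightarrow>
   (\<forall>k\<in>set [0..<length is]. nonneg (weyl_word (take k is) (simple_root (is ! k))))"
  by (auto simp: ascending_def)

lemma ascending_r_word: "ascending r_word" "ascending (rev r_word)"
  unfolding ascending_iff r_word_def by (simp_all add: upt_conv_Cons simple_root_v7)

lemma reduced_r_word: "reduced_expr r_word w_sup_P"
  using ascending_r_word by (simp add: reduced_iff_ascending w_sup_P_eq)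

lemma reduced_w_p: "reduced_expr [7,6,5,4,2,3,4,5,6,7] w_p"
  unfolding reduced_iff_ascending ascending_iff
  by (simp add: w_p_eq upt_conv_Cons simple_root_v7)

subsection \<open>The weights of the minuscule representation\<close>

text \<open>\<open>omega2\<close> is twice the fundamental weight \<open>\<omega>\<^sub>7\<close>, which does not lie in the root lattice.\<close>

definition omega2 :: "int ^ 7" where "omega2 = v7 2 3 4 6 5 4 3"

text \<open>The weights have norm 3/2, the least norm in the nontrivial coset of the root lattice,
  hence norm 6 after doubling. The congruence modulo 2 selects that coset.\<close>

definition wts :: "(int ^ 7) set" where
  "wts = {v. ip v v = 6 \<and> (\<forall>i. even (v $ i - omega2 $ i))}"

definition coset_coord :: "int ^ 7 \<Rightarrow> int ^ 7" where
  "coset_coord v = (\<chi> i. (v $ i - omega2 $ i) div 2)"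

lemma wts_v7: "v7 a b c d e f g \<in> wts \<longleftrightarrow> ip (v7 a b c d e f g) (v7 a b c d e f g) = 6 \<and>
  even a \<and> odd b \<and> even c \<and> even d \<and> odd e \<and> even f \<and> odd g"
  by (auto simp: wts_def omega2_def all_7)

lemma wts_expand: "v \<in> wts \<Longrightarrow> v = omega2 + 2 *s coset_coord v"
  by (simp add: wts_def coset_coord_def vec_eq_iff)

lemma ip_omega2: "ip omega2 v = 2 * v $ 7"
  by (simp add: omega2_def ip_expand)

lemma even_ip_wts: "v \<in> wts \<Longrightarrow> even (ip v a)"
  by (subst wts_expand) (simp_all add: ip_omega2)

text \<open>The minuscule property, with doubled values. Adding or subtracting \<open>2 *s a\<close>
  gives the norms 14 + 4(v|a) and 14 - 4(v|a), so the pairing lies strictly between -4 and 4; it is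
  also even.\<close>

lemma ip_wts_root:
  assumes "v \<in> wts" "is_root a" shows "ip v a = -2 \<or> ip v a = 0 \<or> ip v a = 2"
proof -
  have "ip (v - 2 *s a) (v - 2 *s a) = 14 - 4 * ip v a"
    "ip (v + 2 *s a) (v + 2 *s a) = 14 + 4 * ip v a"
    using assms by (simp_all add: wts_def is_root_def ip_sym[of a v])
  then have "-4 < ip v a" "ip v a < 4"
    using ip_self_nonneg[of "v - 2 *s a"] ip_self_nonneg[of "v + 2 *s a"] by linarith+
  then show ?thesis using even_ip_wts[OF assms(1), of a] by presburger
qed

lemma wts_add:
  assumes "v \<in> wts" "is_root a" "ip v a = -2"
  shows "v + 2 *s a \<in> wts" "ip (v + 2 *s a) a = 2" "coset_coord (v + 2 *s a) = coset_coord v + a"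
  using assms by (auto simp: wts_def is_root_def ip_sym[of a v] coset_coord_def vec_eq_iff)

lemma wts_diff:
  assumes "v \<in> wts" "is_root a" "ip v a = 2"
  shows "v - 2 *s a \<in> wts" "ip (v - 2 *s a) a = -2" "coset_coord (v - 2 *s a) = coset_coord v - a"
  using assms by (auto simp: wts_def is_root_def ip_sym[of a v] coset_coord_def vec_eq_iff)

lemma refl_wts [simp]: "refl i v \<in> wts \<longleftrightarrow> v \<in> wts"
proof -
  have *: "refl i v \<in> wts" if "v \<in> wts" for v
    using that even_ip_wts[OF that, of "simple_root i"] by (auto simp: wts_def refl_nth)
  show ?thesis using *[of v] *[of "refl i v"] by auto
qed

lemma weyl_word_wts [simp]: "weyl_word is v \<in> wts \<longleftrightarrow> v \<in> wts"
  by (induction "is" arbitrary: v) auto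

lemma uminus_wts: "v \<in> wts \<Longrightarrow> - v \<in> wts"
  by (auto simp: wts_def)

lemma omega2_wts [simp]: "omega2 \<in> wts" "- omega2 \<in> wts"
  by (auto intro!: uminus_wts simp: wts_def omega2_def ip_expand)

lemma ip_simple_roots_eq_0: "(\<And>i. ip v (simple_root i) = 0) \<Longrightarrow> v = 0"
proof -
  assume *: "\<And>i. ip v (simple_root i) = 0"
  show "v = 0" using *[of 1] *[of 2] *[of 3] *[of 4] *[of 5] *[of 6] *[of 7]
    by (simp add: ip_simple_root_right vec_eq_iff all_7)
qed

lemma ip_simple_roots_eqI: "(\<And>i. ip v (simple_root i) = ip w (simple_root i)) \<Longrightarrow> v = w"
  using ip_simple_roots_eq_0[of "v - w"] by simp

lemma finite_wts [simp]: "finite wts"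
proof -
  let ?h = "\<lambda>v :: int ^ 7. (\<chi> i. ip v (simple_root i)) :: int ^ 7"
  have "?h ` wts \<subseteq> vec_lambda ` (UNIV \<rightarrow>\<^sub>E {-2, 0, 2})"
  proof
    fix w assume "w \<in> ?h ` wts"
    then obtain v where v: "v \<in> wts" "w = ?h v" by auto
    have "w $ i \<in> {-2, 0, 2}" for i
      using ip_wts_root[OF v(1) is_root_simple_root, of i] v(2) by auto
    then have "($) w \<in> UNIV \<rightarrow>\<^sub>E {-2, 0, 2}" by auto
    then show "w \<in> vec_lambda ` (UNIV \<rightarrow>\<^sub>E {-2, 0, 2})"
      by (metis image_eqI vec_nth_inverse)
  qed
  then have "finite (?h ` wts)"
    by (rule finite_subset) (intro finite_imageI finite_PiE, auto)
  moreover have "inj_on ?h wts"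
    by (rule inj_onI) (auto simp: vec_eq_iff intro!: ip_simple_roots_eqI[THEN vec_eq_iff[THEN iffD1,
      rule_format]])
  ultimately show ?thesis by (rule finite_imageD)
qed

text \<open>Seven linearly independent weights at the top of the representation. A lattice vector
  orthogonal to all of them is zero, and so is a Cartan element on which all of them vanish.\<close>

lemma some_wts:
  "v7 2 3 4 6 5 4 3 \<in> wts" "v7 2 3 4 6 5 4 1 \<in> wts" "v7 2 3 4 6 5 2 1 \<in> wts"
  "v7 2 3 4 6 3 2 1 \<in> wts" "v7 2 3 4 4 3 2 1 \<in> wts" "v7 2 1 4 4 3 2 1 \<in> wts"
  "v7 2 3 2 4 3 2 1 \<in> wts"
  by (simp_all add: wts_v7 ip_expand)

lemma root_below_some_wt:
  assumes a: "is_root a" obtains v where "v \<in> wts" "ip v a = -2"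
proof -
  have "\<exists>v\<in>wts. ip v a \<noteq> 0"
  proof (rule ccontr)
    assume "\<not> ?thesis"
    then have z: "\<And>v. v \<in> wts \<Longrightarrow> ip v a = 0" by auto
    have "a = 0" using some_wts[THEN z] by (simp add: ip_expand vec_eq_iff all_7)
    then show False using a is_root_nonzero by blast
  qed
  then obtain v where v: "v \<in> wts" "ip v a \<noteq> 0" by auto
  then show ?thesis using that[of v] that[of "v - 2 *s a"] wts_diff[of v a] ip_wts_root[OF v(1) a] a
    by auto
qed

text \<open>The fundamental weight has least norm in its coset: the norm of
  \<open>omega2 + 2 *s v\<close> being nonnegative gives a bound above -2, which parity improves to
  0.\<close>

lemma wt_sign: "0 \<le> ip v v + 2 * v $ 7"
proof -
  have "0 \<le> ip (omega2 + 2 *s v) (omega2 + 2 *s v)" by (rule ip_self_nonneg)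
  also have "\<dots> = 6 + 8 * v $ 7 + 4 * ip v v"
    by (simp add: ip_omega2 ip_sym[of v omega2]) (simp add: omega2_def)
  finally have "-2 < ip v v + 2 * v $ 7" by linarith
  then show ?thesis using even_ip_self[of v] by presburger
qed

text \<open>Equality of norms makes \<open>ip b b + 2 * b $ 7\<close> vanish for the coset
  coordinate \<open>b\<close>. Split into positive and negative parts, this is a sum of nonnegative
  terms, the negative part being covered by \<open>wt_sign\<close>. So the positive part has norm
  zero.\<close>

lemma coset_coord_nonpos:
  assumes "v \<in> wts" shows "nonneg (- coset_coord v)"
proof -
  let ?b = "coset_coord v" let ?p = "pos_part ?b" let ?n = "pos_part (- ?b)"
  have "6 = ip (omega2 + 2 *s ?b) (omega2 + 2 *s ?b)"
    using assms wts_expand[OF assms, symmetric] by (simp add: wts_def)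
  also have "\<dots> = 6 + 8 * ?b $ 7 + 4 * ip ?b ?b"
    by (simp add: ip_omega2 ip_sym[of ?b omega2]) (simp add: omega2_def)
  finally have "ip ?b ?b + 2 * ?b $ 7 = 0" by linarith
  moreover have "ip ?b ?b = ip ?p ?p + ip ?n ?n - 2 * ip ?p ?n"
    by (subst (1 2) pos_part_diff[of ?b]) (simp add: ip_sym[of ?n ?p])
  moreover have "?b $ 7 = ?p $ 7 - ?n $ 7" using pos_part_diff[of ?b]
    by (metis vector_minus_component)
  moreover have "0 \<le> ip (- ?n) (- ?n) + 2 * (- ?n) $ 7" by (rule wt_sign)
  moreover have "0 \<le> ?p $ 7" by (simp add: pos_part_def)
  ultimately have "ip ?p ?p \<le> 0" using ip_pos_parts[of ?b] by simp
  then have "?p = 0" using ip_self_ge_2[of ?p] by linarith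
  then show ?thesis by (simp add: pos_part_eq_0)
qed

text \<open>\<open>omega2\<close> is the only dominant weight. If \<open>v\<close> is dominant, its
  pairing with the nonpositive coset coordinate is at most 0; but that pairing equals the norm of
  the coordinate, which is positive unless \<open>v\<close> is \<open>omega2\<close>.\<close>

lemma ex_raising:
  assumes v: "v \<in> wts" "v \<noteq> omega2" obtains i where "ip v (simple_root i) = -2"
proof (rule ccontr)
  assume "\<not> thesis"
  then have nn: "0 \<le> ip v (simple_root i)" for i
    using that ip_wts_root[OF v(1) is_root_simple_root, of i] by force
  let ?b = "coset_coord v"
  have e: "v = omega2 + 2 *s ?b" by (rule wts_expand[OF v(1)])
  have "6 = ip v v" using v by (simp add: wts_def)
  also have "\<dots> = 6 + 8 * ?b $ 7 + 4 * ip ?b ?b"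
    by (subst (1 2) e) (simp add: ip_omega2 ip_sym[of ?b omega2], simp add: omega2_def)
  finally have q: "ip ?b ?b + 2 * ?b $ 7 = 0" by linarith
  have "ip v ?b = 2 * ?b $ 7 + 2 * ip ?b ?b" by (subst (1) e) (simp add: ip_omega2)
  then have q2: "ip v ?b = ip ?b ?b" using q by linarith
  have b: "?b \<noteq> 0" using v(2) e by (metis add.right_neutral vector_smult_rzero)
  have "ip v ?b = (\<Sum>i\<in>UNIV. ?b $ i * ip v (simple_root i))"
    unfolding sum_7 ip_simple_root_right by (simp add: ip_expand algebra_simps)
  also have "\<dots> \<le> 0" using nn coset_coord_nonpos[OF v(1)]
    by (intro sum_nonpos mult_nonpos_nonneg) (auto simp: nonneg_def)
  finally show False using q2 ip_self_ge_2[OF b] by linarith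
qed

subsection \<open>Signs\<close>

definition sg :: "int \<Rightarrow> complex" where "sg n = (-1) powi n"

lemma sg_add: "sg (m + n) = sg m * sg n" by (simp add: sg_def power_int_add)
lemma sg_even: "even n \<Longrightarrow> sg n = 1" by (simp add: sg_def)
lemma sg_odd: "odd n \<Longrightarrow> sg n = -1" by (simp add: sg_def)
lemma sg_eqI: "even (m + n) \<Longrightarrow> sg m = sg n" by (cases "even m") (auto simp: sg_even sg_odd)
lemma sg_eq_minusI: "odd (m + n) \<Longrightarrow> sg m = - sg n"
  by (cases "even m") (auto simp: sg_even sg_odd)
lemma sg_nonzero [simp]: "sg n \<noteq> 0" by (simp add: sg_def)

definition cexp :: "int ^ 7 \<Rightarrow> int ^ 7 \<Rightarrow> int" where
  "cexp v w = v$1 * w$1 + v$2 * w$2 + v$3 * w$3 + v$4 * w$4 + v$5 * w$5 + v$6 * w$6 + v$7 * w$7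
    + v$1 * w$3 + v$3 * w$4 + v$4 * w$5 + v$5 * w$6 + v$6 * w$7 + v$2 * w$4"

lemma cocycle_eq: "cocycle v w = sg (cexp v w)"
  unfolding cocycle_def sg_def cexp_def sum_7 e7_edges_def by (simp add: add.assoc)

lemma cexp_bilinear [simp]:
  "cexp (u + v) w = cexp u w + cexp v w" "cexp w (u + v) = cexp w u + cexp w v"
  "cexp (u - v) w = cexp u w - cexp v w" "cexp w (u - v) = cexp w u - cexp w v"
  "cexp (- v) w = - cexp v w" "cexp w (- v) = - cexp w v"
  by (simp_all add: cexp_def algebra_simps)

text \<open>Exchanging the arguments of the cocycle costs the sign with exponent
  \<open>ip v w\<close>; this is the source of the antisymmetry of the bracket.\<close>

lemma cexp_swap: "even (cexp v w + cexp w v + ip v w)"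
proof -
  have "cexp v w + cexp w v + ip v w = 2 * (2 * (v$1 * w$1 + v$2 * w$2 + v$3 * w$3 + v$4 * w$4
    + v$5 * w$5 + v$6 * w$6 + v$7 * w$7))"
    by (simp add: cexp_def ip_expand algebra_simps)
  then show ?thesis by simp
qed

lemma cexp_self: "is_root v \<Longrightarrow> odd (cexp v v)"
proof -
  have "ip v v = 2 * cexp v v - 4 * (v$1 * v$3 + v$3 * v$4 + v$4 * v$5 + v$5 * v$6 + v$6 * v$7 + v$2
    * v$4)"
    by (simp add: cexp_def ip_expand algebra_simps)
  then show "is_root v \<Longrightarrow> odd (cexp v v)" unfolding is_root_def by presburger
qed

text \<open>
  With the bare cocycle the simple root vectors act on the weight basis with signs. Multiplying the
  basis vector with coset coordinates \<open>b\<close> by \<open>(-1)\<^bsup>gexp b\<^esup>\<close> makes these coefficients 1. In \<open>gexp\<close>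
  every other edge of the bipartite diagram occurs: at each node either all outgoing or all incoming
  edges, whose contributions agree up to a constant by the parity of the pairing with the root.
\<close>

definition gexp :: "int ^ 7 \<Rightarrow> int" where
  "gexp b = (\<Sum>i\<in>UNIV. b$i * (b$i + 1) div 2) + b$1 * b$3 + b$4 * b$5 + b$6 * b$7
     + b$1 + b$4 + b$6 + b$7"

definition eta :: "int ^ 7 \<Rightarrow> int ^ 7 \<Rightarrow> complex" where
  "eta a v = sg (gexp (coset_coord v) + gexp (coset_coord v + a) + cexp a (coset_coord v))"

lemma eta_nonzero [simp]: "eta a v \<noteq> 0" by (simp add: eta_def)

lemma tri_step: "(x + 1) * (x + 1 + 1) div 2 = x * (x + 1) div 2 + (x + 1)" for x :: int
proof -
  have "(x + 1) * (x + 1 + 1) = x * (x + 1) + (x + 1) * 2" by (simp add: algebra_simps)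
  then show ?thesis by simp
qed

text \<open>Raising coordinate \<open>i\<close> by one changes the triangular number in
  \<open>gexp\<close> by \<open>b$i + 1\<close>, which cancels the diagonal term of
  \<open>cexp\<close> up to a constant. The linear terms of \<open>gexp\<close> correct the constant
  at the nodes 1, 4, 6 and 7.\<close>

lemma eta_simple:
  assumes v: "v \<in> wts" "ip v (simple_root i) = -2"
  shows "eta (simple_root i) v = 1"
proof -
  let ?b = "coset_coord v"
  have "ip v (simple_root i) = 2 * simple_root i $ 7 + 2 * ip ?b (simple_root i)"
    by (subst wts_expand[OF v(1)]) (simp add: ip_omega2)
  \<comment> \<open>The right side is -1 for \<open>i \<noteq> 7\<close> and -2 for
    \<open>i = 7\<close>. At the nodes 2, 3, 5, 7 its parity trades the outgoing edges in
    \<open>cexp\<close> for the incoming ones in \<open>gexp\<close>; at 1, 4, 6 the edge terms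
    agree literally.\<close>
  then have p: "ip ?b (simple_root i) = - 1 - simple_root i $ 7" using v(2) by linarith
  have "even (gexp ?b + gexp (?b + simple_root i) + cexp (simple_root i) ?b)"
    using exhaust_7[of i]
  proof (elim disjE)
    assume i: "i = 1"
    have "gexp (?b + simple_root i) = gexp ?b + ?b$1 + 1 + ?b$3 + 1"
      unfolding i gexp_def sum_7 by (simp add: simple_root_nth tri_step algebra_simps del:
        add_2_eq_Suc' )
    moreover have "cexp (simple_root i) ?b = ?b$1 + ?b$3" by (simp add: i cexp_def simple_root_nth)
    ultimately show ?thesis by simp
  next
    assume i: "i = 2"
    have "gexp (?b + simple_root i) = gexp ?b + ?b$2 + 1"
      unfolding i gexp_def sum_7 by (simp add: simple_root_nth tri_step algebra_simps)
    moreover have "cexp (simple_root i) ?b = ?b$2 + ?b$4" by (simp add: i cexp_def simple_root_nth)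
    moreover have "odd (?b$4)" using p by (simp add: i ip_simple_root_right simple_root_nth)
      presburger
    ultimately show ?thesis by simp
  next
    assume i: "i = 3"
    have "gexp (?b + simple_root i) = gexp ?b + ?b$3 + 1 + ?b$1"
      unfolding i gexp_def sum_7 by (simp add: simple_root_nth tri_step algebra_simps)
    moreover have "cexp (simple_root i) ?b = ?b$3 + ?b$4" by (simp add: i cexp_def simple_root_nth)
    moreover have "odd (?b$1 + ?b$4)" using p
      by (simp add: i ip_simple_root_right simple_root_nth) presburger
    ultimately show ?thesis by simp
  next
    assume i: "i = 4"
    have "gexp (?b + simple_root i) = gexp ?b + ?b$4 + 1 + ?b$5 + 1"
      unfolding i gexp_def sum_7 by (simp add: simple_root_nth tri_step algebra_simps)
    moreover have "cexp (simple_root i) ?b = ?b$4 + ?b$5" by (simp add: i cexp_def simple_root_nth)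
    ultimately show ?thesis by simp
  next
    assume i: "i = 5"
    have "gexp (?b + simple_root i) = gexp ?b + ?b$5 + 1 + ?b$4"
      unfolding i gexp_def sum_7 by (simp add: simple_root_nth tri_step algebra_simps)
    moreover have "cexp (simple_root i) ?b = ?b$5 + ?b$6" by (simp add: i cexp_def simple_root_nth)
    moreover have "odd (?b$4 + ?b$6)" using p
      by (simp add: i ip_simple_root_right simple_root_nth) presburger
    ultimately show ?thesis by simp
  next
    assume i: "i = 6"
    have "gexp (?b + simple_root i) = gexp ?b + ?b$6 + 1 + ?b$7 + 1"
      unfolding i gexp_def sum_7 by (simp add: simple_root_nth tri_step algebra_simps)
    moreover have "cexp (simple_root i) ?b = ?b$6 + ?b$7" by (simp add: i cexp_def simple_root_nth)
    ultimately show ?thesis by simp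
  next
    assume i: "i = 7"
    have "gexp (?b + simple_root i) = gexp ?b + ?b$7 + 1 + ?b$6 + 1"
      unfolding i gexp_def sum_7 by (simp add: simple_root_nth tri_step algebra_simps)
    moreover have "cexp (simple_root i) ?b = ?b$7" by (simp add: i cexp_def simple_root_nth)
    moreover have "even (?b$6)" using p by (simp add: i ip_simple_root_right simple_root_nth)
      presburger
    ultimately show ?thesis by simp
  qed
  then show ?thesis by (simp add: eta_def sg_even)
qed

lemma eta_inverse:
  assumes "v \<in> wts" "is_root a" "ip v a = 2"
  shows "eta a (v - 2 *s a) * eta (- a) v = -1"
proof -
  let ?b = "coset_coord v"
  have "eta a (v - 2 *s a) * eta (- a) v
     = sg (2 * (gexp (?b - a) + gexp ?b) + cexp a (?b - a) + cexp (- a) ?b)"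
    unfolding eta_def wts_diff(3)[OF assms] sg_add[symmetric] by (simp add: algebra_simps)
  also have "\<dots> = -1" by (rule sg_odd) (use cexp_self[OF assms(2)] in simp)
  finally show ?thesis .
qed

lemma eta_minus_simple:
  assumes v: "v \<in> wts" "ip v (simple_root i) = 2"
  shows "eta (- simple_root i) v = -1"
  using eta_inverse[OF v(1) is_root_simple_root v(2)]
    eta_simple[of "v - 2 *s simple_root i" i] wts_diff[OF v(1) is_root_simple_root v(2)] by simp

text \<open>The second sign is symmetric in \<open>a\<close> and \<open>b\<close>. So the order of
  two shifts is felt only through \<open>cexp b a\<close>, exactly as in the structure constants of
  the Lie algebra.\<close>

lemma eta_mult:
  assumes "v \<in> wts" "is_root a" "is_root b" "ip v b = 2" "ip v a - 2 * ip a b = 2"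
  shows "v - 2 *s b \<in> wts" "eta b (v - 2 *s b) * eta a (v - 2 *s b - 2 *s a)
    = sg (cexp b a) * sg (gexp (coset_coord v - b - a) + gexp (coset_coord v)
        + cexp (a + b) (coset_coord v - b - a))"
proof -
  note d = wts_diff[OF assms(1,3,4)]
  have ia: "ip (v - 2 *s b) a = 2" using assms(5) by (simp add: ip_sym[of b a])
  note d' = wts_diff[OF d(1) assms(2) ia]
  let ?c = "coset_coord v"
  show "v - 2 *s b \<in> wts" by (rule d)
  have "eta b (v - 2 *s b) * eta a (v - 2 *s b - 2 *s a)
    = sg (gexp (?c - b) + gexp ?c + cexp b (?c - b)
      + (gexp (?c - b - a) + gexp (?c - b) + cexp a (?c - b - a)))"
    unfolding eta_def d'(3) d(3) sg_add[symmetric] by simp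
  also have "\<dots> = sg (cexp b a + (gexp (?c - b - a) + gexp ?c + cexp (a + b) (?c - b - a)))"
    by (rule sg_eqI) simp
  finally show "eta b (v - 2 *s b) * eta a (v - 2 *s b - 2 *s a)
    = sg (cexp b a) * sg (gexp (coset_coord v - b - a) + gexp (coset_coord v)
        + cexp (a + b) (coset_coord v - b - a))" by (simp only: sg_add)
qed

subsection \<open>The minuscule representation\<close>

text \<open>
  It acts on functions on the lattice of which only the values on \<open>wts\<close> matter; \<open>wts\<close> consists
  of the doubles of the 56 weights, so that the shift by a root \<open>a\<close> becomes a shift by \<open>2 a\<close>.
\<close>

type_synonym wfun = "int ^ 7 \<Rightarrow> complex"

text \<open>The root vector of \<open>a\<close> maps the basis vector of weight \<open>u\<close> to
  \<open>eta a u\<close> times that of weight \<open>u + 2 *s a\<close>. On coefficient functions,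
  the value at \<open>v\<close> therefore comes from \<open>v - 2 *s a\<close>.\<close>

definition rho_root :: "int ^ 7 \<Rightarrow> wfun \<Rightarrow> wfun" where
  "rho_root a f v = (if v \<in> wts \<and> ip v a = 2 then eta a (v - 2 *s a) * f (v - 2 *s a) else 0)"

definition rho_h :: "7 \<Rightarrow> wfun \<Rightarrow> wfun" where
  "rho_h i f v = (if v \<in> wts then of_int (ip v (simple_root i)) / 2 * f v else 0)"

fun rho_basis :: "e7_idx \<Rightarrow> wfun \<Rightarrow> wfun" where
  "rho_basis (Inl i) = rho_h i"
| "rho_basis (Inr a) = rho_root (root_vec a)"

definition rho :: "e7_alg \<Rightarrow> wfun \<Rightarrow> wfun" where
  "rho X f v = (\<Sum>k\<in>UNIV. X $ k * rho_basis k f v)"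

lemma sum_idx: "(\<Sum>k\<in>(UNIV :: e7_idx set). F k) = (\<Sum>i\<in>UNIV. F (Inl i)) + (\<Sum>a\<in>UNIV. F (Inr a))"
proof -
  have "(\<Sum>k\<in>(UNIV :: e7_idx set). F k) = (\<Sum>k\<in>UNIV <+> UNIV. F k)" by (simp only: UNIV_Plus_UNIV)
  also have "\<dots> = (\<Sum>i\<in>UNIV. F (Inl i)) + (\<Sum>a\<in>UNIV. F (Inr a))" by (subst sum.Plus) auto
  finally show ?thesis .
qed

lemma rho_axis [simp]: "rho (axis k c) f v = c * rho_basis k f v"
proof -
  have "axis k c $ j * rho_basis j f v = (if j = k then c * rho_basis j f v else 0)" for j
    by (simp add: axis_def)
  then show ?thesis by (simp add: rho_def)
qed

lemma rho_linear:
  "rho (X + Y) f v = rho X f v + rho Y f v" "rho (c *s X) f v = c * rho X f v"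
  "rho 0 f v = 0" "rho (- X) f v = - rho X f v" "rho (X - Y) f v = rho X f v - rho Y f v"
  by (simp_all add: rho_def distrib_right sum.distrib sum_distrib_left mult.assoc sum_negf
      left_diff_distrib sum_subtractf)

lemma rho_sum: "rho (\<Sum>k\<in>A. g k) f v = (\<Sum>k\<in>A. rho (g k) f v)"
  by (induction A rule: infinite_finite_induct) (simp_all add: rho_linear)

lemma rho_root_lincomb: "rho_root a (\<lambda>w. \<Sum>k\<in>A. c k * g k w) v = (\<Sum>k\<in>A. c k * rho_root a (g k) v)"
  by (cases "v \<in> wts"; cases "ip v a = 2") (simp_all add: rho_root_def sum_distrib_left
    mult.left_commute)

lemma root_vec_inj: "root_vec a = root_vec b \<longleftrightarrow> a = b"
  by (simp add: root_vec_inject)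

lemma sum_root_delta:
  assumes "is_root w"
  shows "(\<Sum>a\<in>UNIV. (if root_vec a = w then F (root_vec a) else 0)) = F w"
proof -
  have "(root_vec a = w) = (a = Abs_root w)" for a
    using assms by (metis root_vec_Abs_root root_vec_inj)
  then show ?thesis using assms by simp
qed

lemma ip_expand_right: "ip v w = (\<Sum>m\<in>UNIV. w $ m * ip v (simple_root m))"
  unfolding sum_7 ip_simple_root_right by (simp add: ip_expand algebra_simps)

lemma rho_bracket_roots:
  "rho (bracket_basis (Inr a) (Inr b)) f v =
   (if root_vec a + root_vec b = 0 then
      (if v \<in> wts then - of_int (ip v (root_vec a)) / 2 * f v else 0)
    else if is_root (root_vec a + root_vec b) then
      sg (cexp (root_vec a) (root_vec b)) * rho_root (root_vec a + root_vec b) f v else 0)"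
proof -
  let ?a = "root_vec a" and ?b = "root_vec b"
  have "rho (bracket_basis (Inr a) (Inr b)) f v
    = (\<Sum>m\<in>UNIV. (if ?a + ?b = 0 then - of_int (?a $ m) else 0) * rho_h m f v)
    + (\<Sum>c\<in>UNIV. (if root_vec c = ?a + ?b then sg (cexp ?a ?b) else 0) * rho_root (root_vec c) f v)"
    unfolding rho_def sum_idx by (simp add: cocycle_eq cong: if_cong)
  also have "(\<Sum>m\<in>UNIV. (if ?a + ?b = 0 then - of_int (?a $ m) else 0) * rho_h m f v)
    = (if ?a + ?b = 0 \<and> v \<in> wts then - of_int (ip v ?a) / 2 * f v else 0)"
    unfolding ip_expand_right[of v ?a]
    by (cases "v \<in> wts"; cases "?a + ?b = 0")
      (simp_all add: rho_h_def sum_negf sum_distrib_right sum_divide_distrib mult.assoc)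
  also have "(\<Sum>c\<in>UNIV. (if root_vec c = ?a + ?b then sg (cexp ?a ?b) else 0) * rho_root (root_vec c)
    f v)
    = (if is_root (?a + ?b) then sg (cexp ?a ?b) * rho_root (?a + ?b) f v else 0)"
  proof (cases "is_root (?a + ?b)")
    case True
    have "(\<Sum>c\<in>UNIV. (if root_vec c = ?a + ?b then sg (cexp ?a ?b) else 0) * rho_root (root_vec c) f
      v)
      = (\<Sum>c\<in>UNIV. (if root_vec c = ?a + ?b then sg (cexp ?a ?b) * rho_root (root_vec c) f v
        else 0))"
      by (rule sum.cong) auto
    then show ?thesis using True sum_root_delta[OF True, of "\<lambda>w. sg (cexp ?a ?b) * rho_root w f v"]
      by simp
  next
    case False
    then have "root_vec c \<noteq> ?a + ?b" for c by (metis is_root_root_vec)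
    then show ?thesis using False by simp
  qed
  finally show ?thesis using is_root_nonzero by auto
qed

lemma rho_root_comp:
  assumes "is_root a" "is_root b"
  shows "rho_root b (rho_root a f) v = (if v \<in> wts \<and> ip v b = 2 \<and> ip v a - 2 * ip a b = 2
    then sg (cexp b a) * sg (gexp (coset_coord v - b - a) + gexp (coset_coord v)
        + cexp (a + b) (coset_coord v - b - a)) * f (v - 2 *s b - 2 *s a) else 0)"
  using eta_mult[OF _ assms, of v] by (auto simp: rho_root_def ip_sym[of b a] mult.assoc[symmetric])

text \<open>The representation property for brackets with a root vector. The cases follow the
  pairing of the two roots: opposite roots give a Cartan element, pairing -1 gives a root vector,
  and otherwise the operators commute.\<close>

lemma rho_bracket:
  "rho (bracket_basis (Inr a) k) f v
   = rho_root (root_vec a) (rho_basis k f) v - rho_basis k (rho_root (root_vec a) f) v"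
proof (cases k)
  case (Inl j)
  then show ?thesis
    by (auto simp: rho_root_def rho_h_def ip_sym[of
      "root_vec a"] wts_diff algebra_simps diff_divide_distrib)
next
  case (Inr b)
  let ?a = "root_vec a" and ?b = "root_vec b"
  have ra: "is_root ?a" and rb: "is_root ?b" by simp_all
  have bd: "ip ?a ?b \<in> {-2..2}" by (rule root_ip_bounds(1)[OF ra rb])
  note sw = cexp_swap[of ?a ?b]
  have com: "v - 2 *s ?a - 2 *s ?b = v - 2 *s ?b - 2 *s ?a"
    "coset_coord v - ?a - ?b = coset_coord v - ?b - ?a" "?b + ?a = ?a + ?b"
    by (simp_all add: algebra_simps)
  note comp = rho_root_comp[OF ra rb, of f v] rho_root_comp[OF rb ra, of f v, unfolded com ip_sym[of
    ?b ?a]]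
  show ?thesis
  proof (cases "v \<in> wts")
    case False
    then show ?thesis unfolding Inr rho_bracket_roots by (simp add: rho_root_def)
  next
    case v: True
    note va = ip_wts_root[OF v ra] and vb = ip_wts_root[OF v rb]
    consider (neg2) "ip ?a ?b = -2" | (neg1) "ip ?a ?b = -1" | (zero) "ip ?a ?b = 0"
      | (pos) "ip ?a ?b = 1 \<or> ip ?a ?b = 2" using bd by force
    then show ?thesis
    proof cases
      case neg2
      then have ba: "?b = - ?a" using root_ip_bounds(3)[OF ra rb] by simp
      have nr: "rho_root ?a (rho_root ?b f) v = (if ip v ?a = 2 then - f v else 0)"
        using eta_inverse[OF v ra] wts_diff[OF v ra] unfolding ba
        by (auto simp: rho_root_def v mult.assoc[symmetric])
      have nr2: "rho_root ?b (rho_root ?a f) v = (if ip v ?a = -2 then - f v else 0)"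
        using eta_inverse[OF v rb] wts_diff[OF v rb] unfolding ba
        by (auto simp: rho_root_def v mult.assoc[symmetric])
      show ?thesis unfolding Inr rho_bracket_roots rho_basis.simps nr nr2
        using va v by (auto simp: ba)
    next
      case neg1
      then have r: "is_root (?a + ?b)" using root_add_iff ra rb by blast
      then have nz: "?a + ?b \<noteq> 0" using is_root_nonzero by blast
      have sgn: "sg (cexp ?b ?a) = - sg (cexp ?a ?b)"
        by (rule sg_eq_minusI) (use sw neg1 in presburger)
      have 2: "rho_root (?a + ?b) f v = (if ip v ?a + ip v ?b = 2 then
        sg (gexp (coset_coord v - ?b - ?a) + gexp (coset_coord v)
        + cexp (?a + ?b) (coset_coord v - ?b - ?a)) * f (v - 2 *s ?b - 2 *s ?a) else 0)"
      proof -
        have e: "v - 2 *s (?a + ?b) = v - 2 *s ?b - 2 *s ?a"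
          "coset_coord v - (?a + ?b) = coset_coord v - ?b - ?a"
          by (simp_all add: vec_eq_iff algebra_simps)
        have "coset_coord v - ?b - ?a + (?a + ?b) = coset_coord v" by simp
        then show ?thesis using wts_diff(3)[OF v r] v
          unfolding rho_root_def e eta_def ip_bilinear by auto
      qed
      \<comment> \<open>One order of composition needs pairings 0 with \<open>?a\<close> and 2 with
        \<open>?b\<close>, the other the reverse. Together they cover the weights that pair to 2
        with the sum, and \<open>sgn\<close> matches the minus sign of the commutator.\<close>
      show ?thesis unfolding Inr rho_bracket_roots rho_basis.simps comp 2 sgn neg1
        using va vb v r nz by auto
    next
      case zero
      then have nr: "\<not> is_root (?a + ?b)" "?a + ?b \<noteq> 0"
        using root_add_iff[OF ra rb] root_ip_bounds(3)[OF ra rb] by (auto simp: eq_neg_iff_add_eq_0)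
      have sgn: "sg (cexp ?b ?a) = sg (cexp ?a ?b)"
        by (rule sg_eqI) (use sw zero in presburger)
      show ?thesis unfolding Inr rho_bracket_roots rho_basis.simps comp sgn zero
        using v nr by auto
    next
      case pos
      then have nr: "\<not> is_root (?a + ?b)" "?a + ?b \<noteq> 0"
        using root_add_iff[OF ra rb] root_ip_bounds(3)[OF ra rb] by (auto simp: eq_neg_iff_add_eq_0)
      \<comment> \<open>Either composition would need a weight that pairs to at least 4 with a root,
        so both vanish.\<close>
      show ?thesis unfolding Inr rho_bracket_roots rho_basis.simps comp
        using v nr va vb pos by auto
    qed
  qed
qed

subsection \<open>Exponentials in the adjoint representation\<close>

declare simple_root_is_root(1) [simp]

definition raise_op :: "7 \<Rightarrow> wfun \<Rightarrow> wfun" where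
  "raise_op i f v = (if v \<in> wts \<and> ip v (simple_root i) = 2 then f (v - 2 *s simple_root i) else 0)"

definition lower_op :: "7 \<Rightarrow> wfun \<Rightarrow> wfun" where
  "lower_op i f v = (if v \<in> wts \<and> ip v (simple_root i) = -2 then f (v + 2 *s simple_root i) else 0)"

lemma rho_root_simple: "rho_root (simple_root i) = raise_op i"
  by (intro ext) (auto simp: rho_root_def raise_op_def wts_diff eta_simple)

lemma rho_root_minus_simple: "rho_root (- simple_root i) f v = - lower_op i f v"
proof -
  have "v - 2 *s - simple_root i = v + 2 *s simple_root i" by (simp add: vec_eq_iff)
  moreover have "eta (- simple_root i) (v + 2 *s simple_root i) = -1"
    if "v \<in> wts" "ip v (simple_root i) = -2"
    using eta_minus_simple[of "v + 2 *s simple_root i" i] wts_add[OF that(1) is_root_simple_root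
      that(2)] by simp
  ultimately show ?thesis by (auto simp: rho_root_def lower_op_def)
qed

lemma rho_basis_lin: "rho_basis k (\<lambda>w. f w + c * g w) v = rho_basis k f v + c * rho_basis k g v"
  by (cases k) (auto simp: rho_root_def rho_h_def algebra_simps add_divide_distrib)

lemma rho_lin: "rho X (\<lambda>w. f w + c * g w) v = rho X f v + c * rho X g v"
  by (simp add: rho_def rho_basis_lin sum.distrib sum_distrib_left algebra_simps)

lemma rho_0: "rho X (\<lambda>w. 0) v = 0"
  using rho_lin[of X "\<lambda>w. 0" "-1" "\<lambda>w. 0" v] by simp

lemma rho_zero: "rho X (\<lambda>w. 0) = (\<lambda>w. 0)"
  by (rule ext) (rule rho_0)

lemma rho_scale: "rho X (\<lambda>w. c * g w) v = c * rho X g v"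
  using rho_lin[of X "\<lambda>w. 0" c g v] by (simp add: rho_0)

lemma ad_axis_mult: "ad (axis k c) *v Y = (\<Sum>j\<in>UNIV. (c * Y $ j) *s bracket_basis k j)"
proof (rule vec_eq_iff[THEN iffD2], rule allI)
  fix l
  have "axis k c $ i * bracket_basis i j $ l = (if i = k then c * bracket_basis k j $ l else 0)"
    for i j
    by (simp add: axis_def)
  then show "(ad (axis k c) *v Y) $ l = (\<Sum>j\<in>UNIV. (c * Y $ j) *s bracket_basis k j) $ l"
    by (simp add: ad_def matrix_vector_mult_def mult.commute mult.left_commute)
qed

lemma rho_ad_root:
  "rho (ad (axis (Inr a) c) *v Y) f v
    = c * (rho_root (root_vec a) (rho Y f) v - rho Y (rho_root (root_vec a) f) v)"
proof -
  have "rho (ad (axis (Inr a) c) *v Y) f v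
    = (\<Sum>j\<in>UNIV. c * Y $ j * (rho_root (root_vec a) (rho_basis j f) v - rho_basis j (rho_root
      (root_vec a) f) v))"
    by (simp add: ad_axis_mult rho_sum rho_linear rho_bracket)
  also have "\<dots> = c * ((\<Sum>j\<in>UNIV. Y $ j * rho_root (root_vec a) (rho_basis j f) v) - rho Y (rho_root
    (root_vec a) f) v)"
    by (simp add: rho_def sum_distrib_left right_diff_distrib sum_subtractf mult.assoc)
  also have "(\<Sum>j\<in>UNIV. Y $ j * rho_root (root_vec a) (rho_basis j f) v)
    = rho_root (root_vec a) (rho Y f) v"
    unfolding rho_def[abs_def] rho_root_lincomb ..
  finally show ?thesis .
qed

lemma chev_e_axis: "a *s chev_e i = axis (Inr (Abs_root (simple_root i))) a"
  by (simp add: chev_e_def vec_eq_iff axis_def)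

lemma chev_f_axis: "a *s chev_f i = axis (Inr (Abs_root (- simple_root i))) (- a)"
  by (simp add: chev_f_def vec_eq_iff axis_def)

lemma rho_ad_e:
  "rho (ad (a *s chev_e i) *v Y) f = (\<lambda>v. a * (raise_op i (rho Y f) v - rho Y (raise_op i f) v))"
  by (rule ext) (simp add: chev_e_axis rho_ad_root rho_root_simple)

lemma rho_ad_f:
  "rho (ad (a *s chev_f i) *v Y) f = (\<lambda>v. a * (lower_op i (rho Y f) v - rho Y (lower_op i f) v))"
proof (rule ext)
  fix v
  have e: "rho_root (- simple_root i) f = (\<lambda>v. -1 * lower_op i f v)" for f
    by (rule ext) (simp add: rho_root_minus_simple)
  show "rho (ad (a *s chev_f i) *v Y) f v = a * (lower_op i (rho Y f) v - rho Y (lower_op i f) v)"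
    by (simp only: chev_f_axis rho_ad_root root_vec_Abs_root is_root_uminus is_root_simple_root e
      rho_scale)
      (simp add: algebra_simps)
qed

section \<open>Faithfulness of the minuscule representation\<close>

definition delta :: "int ^ 7 \<Rightarrow> wfun" where "delta u v = (if v = u then 1 else 0)"

lemma delta_simps [simp]: "delta u u = 1" "v \<noteq> u \<Longrightarrow> delta u v = 0"
  by (simp_all add: delta_def)

lemma wt_shift_eq: "u + 2 *s b - 2 *s c = u \<longleftrightarrow> c = (b :: int ^ 7)"
  "u - 2 *s c = u \<longleftrightarrow> c = 0"
  by (auto simp: vec_eq_iff)

lemma wt_shift_neq: "is_root b \<Longrightarrow> u + 2 *s b \<noteq> u" "is_root b \<Longrightarrow> u - 2 *s b \<noteq> u"
  using is_root_nonzero by (auto simp: vec_eq_iff)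

text \<open>Weight spaces are lines and only one root leads from \<open>u\<close> to
  \<open>u + 2 *s b\<close>, so a single matrix entry isolates a single root coordinate of
  \<open>X\<close>.\<close>

lemma rho_delta_shift:
  assumes u: "u \<in> wts" and b: "is_root b" "ip u b = -2"
  shows "rho X (delta u) (u + 2 *s b) = X $ Inr (Abs_root b) * eta b u"
proof -
  note w = wts_add[OF u b]
  have 1: "rho_basis (Inl i) (delta u) (u + 2 *s b) = 0" for i
    using wt_shift_neq[OF b(1), of u] by (simp add: rho_h_def)
  have 2: "rho_basis (Inr c) (delta u) (u + 2 *s b) = (if c = Abs_root b then eta b u else 0)" for c
  proof -
    have "c = Abs_root b \<longleftrightarrow> root_vec c = b" using b by (metis root_vec_Abs_root root_vec_inj)
    then show ?thesis using w by (auto simp: rho_root_def wt_shift_eq delta_def)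
  qed
  show ?thesis unfolding rho_def sum_idx 1 2 by (simp add: mult_delta_right)
qed

lemma rho_delta_same:
  assumes u: "u \<in> wts"
  shows "rho X (delta u) u = (\<Sum>i\<in>UNIV. X $ Inl i * (of_int (ip u (simple_root i)) / 2))"
proof -
  have 1: "rho_basis (Inl i) (delta u) u = of_int (ip u (simple_root i)) / 2" for i
    by (simp add: rho_h_def u)
  have 2: "rho_basis (Inr c) (delta u) u = 0" for c
    using wt_shift_neq(2)[OF is_root_root_vec[of c], of u] by (simp add: rho_root_def)
  show ?thesis unfolding rho_def sum_idx 1 2 by simp
qed

lemma cartan_part_eq_0:
  assumes "\<And>u. u \<in> wts \<Longrightarrow> (\<Sum>i\<in>UNIV. X $ Inl i * (of_int (ip u (simple_root i)) / 2)) = 0"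
  shows "(X :: e7_alg) $ Inl i = 0"
proof -
  note e = some_wts[THEN assms, unfolded sum_7 ip_simple_root_right v7_nth, simplified]
  have "\<forall>i. X $ Inl i = 0" unfolding all_7 using e by (auto simp: eq_neg_iff_add_eq_0 add_eq_0_iff)
  then show ?thesis by blast
qed

text \<open>Every root is a difference of two weights, so the off-diagonal entries determine the
  root coordinates. The diagonal entries determine the Cartan part because the weights span.\<close>

lemma rho_eq_0_imp:
  assumes "\<And>u v. u \<in> wts \<Longrightarrow> rho X (delta u) v = 0" shows "X = 0"
proof -
  have "X $ Inl i = 0" for i
  proof (rule cartan_part_eq_0)
    fix u assume u: "u \<in> wts"
    show "(\<Sum>i\<in>UNIV. X $ Inl i * (of_int (ip u (simple_root i)) / 2)) = 0"
      using rho_delta_same[OF u, of X] assms[OF u, of u] by simp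
  qed
  moreover have "X $ Inr b = 0" for b
  proof -
    obtain u where u: "u \<in> wts" "ip u (root_vec b) = -2"
      by (rule root_below_some_wt[OF is_root_root_vec])
    have "X $ Inr b * eta (root_vec b) u = 0"
      using rho_delta_shift[OF u(1) is_root_root_vec u(2), of X] assms[OF u(1)]
        by (simp add: root_vec_inverse)
    then show ?thesis by simp
  qed
  ultimately show ?thesis by (metis vec_eq_iff zero_index sum.exhaust)
qed

lemma rho_inject: "(\<And>f v. rho X f v = rho Y f v) \<Longrightarrow> X = Y"
  using rho_eq_0_imp[of "X - Y"] by (simp add: rho_linear)

lemma mat_exp_cubic:
  assumes "D ** (D ** D) = 0"
  shows "mat_exp D = mat 1 + D + (1/2) *\<^sub>R (D ** D)"
    "mat_exp D *v Y = Y + D *v Y + (1/2) *s (D *v (D *v Y))"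
proof -
  have z: "((**) D ^^ n) (mat 1) = 0" if "n \<ge> 3" for n
    using that
  proof (induction n rule: dec_induct)
    case base
    show ?case using assms by (simp add: eval_nat_numeral)
  next
    case (step n)
    then show ?case by simp
  qed
  have "mat_exp D = (\<Sum>n<3. (1 / fact n) *\<^sub>R ((**) D ^^ n) (mat 1))"
    unfolding mat_exp_def by (rule suminf_finite) (auto simp: z)
  also have "\<dots> = mat 1 + D + (1/2) *\<^sub>R (D ** D)"
    by (simp add: eval_nat_numeral)
  finally show *: "mat_exp D = mat 1 + D + (1/2) *\<^sub>R (D ** D)" .
  have "((1/2) *\<^sub>R (D ** D)) *v Y = (1/2) *s (D *v (D *v Y))"
    unfolding matrix_vector_mul_assoc
    by (simp add: vec_eq_iff matrix_vector_mult_def sum_distrib_left mult.assoc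
        scaleR_conv_of_real[where 'a = complex])
  then show "mat_exp D *v Y = Y + D *v Y + (1/2) *s (D *v (D *v Y))"
    unfolding * by (simp add: matrix_vector_mult_add_rdistrib)
qed

text \<open>For \<open>N\<^sup>2 = 0\<close>, \<open>exp(ad aN)\<close> is conjugation by \<open>1 + aN\<close>, hence of degree 2 in \<open>ad aN\<close>.\<close>

context
  fixes N :: "wfun \<Rightarrow> wfun" and D :: e7_mat and a :: complex
  assumes D: "\<And>Y f. rho (D *v Y) f = (\<lambda>v. a * (N (rho Y f) v - rho Y (N f) v))"
    and lin: "\<And>f g c. N (\<lambda>w. f w + c * g w) = (\<lambda>w. N f w + c * N g w)"
    and sq: "\<And>f. N (N f) = (\<lambda>v. 0)"
begin

lemma square_zero_0: "N (\<lambda>w. 0) = (\<lambda>w. 0)"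
  using lin[of "\<lambda>w. 0" "-1" "\<lambda>w. 0"] by simp

lemma square_zero_scale: "N (\<lambda>w. c * g w) = (\<lambda>w. c * N g w)"
  using lin[of "\<lambda>w. 0" c g] by (simp add: square_zero_0)

lemma square_zero_diff: "N (\<lambda>w. g w - h w) = (\<lambda>w. N g w - N h w)"
  using lin[of g "-1" h] by simp

text \<open>In the double commutator with \<open>N\<close> only the middle term -2
  \<open>N Y N\<close> survives \<open>N\<close> squared being zero. A third commutator kills it,
  which is why \<open>ad_cubic\<close> holds by faithfulness, without root strings.\<close>

lemma rho_ad_square: "rho (D *v (D *v Y)) f = (\<lambda>v. (-2 * a^2) * N (rho Y (N f)) v)"
proof
  fix v
  have "rho (D *v (D *v Y)) f v = a * (N (\<lambda>v. a * (N (rho Y f) v - rho Y (N f) v)) v - a * (N (rho Y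
    (N f)) v - rho Y (N (N f)) v))"
    by (simp only: D)
  also have "\<dots> = a * (a * (N (N (rho Y f)) v - N (rho Y (N f)) v) - a * (N (rho Y (N f)) v))"
    by (simp only: square_zero_scale square_zero_diff sq rho_0 diff_0_right)
  also have "\<dots> = (-2 * a^2) * N (rho Y (N f)) v"
    by (simp add: sq power2_eq_square algebra_simps)
  finally show "rho (D *v (D *v Y)) f v = (-2 * a^2) * N (rho Y (N f)) v" .
qed

lemma ad_cubic: "D ** (D ** D) = 0"
proof -
  have "rho (D *v (D *v (D *v Y))) f v = 0" for Y f v
  proof -
    have "rho (D *v (D *v (D *v Y))) f v
        = a * (N (rho (D *v (D *v Y)) f) v - rho (D *v (D *v Y)) (N f) v)"
      by (rule D[of "D *v (D *v Y)", THEN fun_cong])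
    then show ?thesis by (simp only: rho_ad_square square_zero_scale sq rho_zero square_zero_0) simp
  qed
  then have "D *v (D *v (D *v Y)) = 0" for Y
    by (intro rho_eq_0_imp)
  then show ?thesis by (simp add: matrix_eq matrix_vector_mul_assoc[symmetric])
qed

text \<open>Conjugation by \<open>1 + a N\<close>, stated as an intertwining relation so that no
  inverse appears.\<close>

lemma rho_mat_exp:
  "rho (mat_exp D *v Y) (\<lambda>w. f w + a * N f w) v = rho Y f v + a * N (rho Y f) v"
  unfolding mat_exp_cubic(2)[OF ad_cubic] rho_linear rho_ad_square D[of Y] lin sq rho_lin
  by (simp add: sq square_zero_0 rho_zero power2_eq_square algebra_simps lin)

end

definition X_op :: "7 \<Rightarrow> complex \<Rightarrow> wfun \<Rightarrow> wfun" where
  "X_op i a f = (\<lambda>v. f v + a * raise_op i f v)"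

definition Y_op :: "7 \<Rightarrow> complex \<Rightarrow> wfun \<Rightarrow> wfun" where
  "Y_op i a f = (\<lambda>v. f v + a * lower_op i f v)"

lemma raise_op_lin: "raise_op i (\<lambda>w. f w + c * g w) = (\<lambda>w. raise_op i f w + c * raise_op i g w)"
  by (auto simp: raise_op_def)

lemma lower_op_lin: "lower_op i (\<lambda>w. f w + c * g w) = (\<lambda>w. lower_op i f w + c * lower_op i g w)"
  by (auto simp: lower_op_def)

lemma raise_op_sq: "raise_op i (raise_op i f) = (\<lambda>v. 0)"
  by (rule ext) (auto simp: raise_op_def)

lemma lower_op_sq: "lower_op i (lower_op i f) = (\<lambda>v. 0)"
  by (rule ext) (auto simp: lower_op_def)

lemma ad_e_cubic: "ad (a *s chev_e i) ** (ad (a *s chev_e i) ** ad (a *s chev_e i)) = 0"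
  by (rule ad_cubic[OF rho_ad_e raise_op_lin raise_op_sq])

lemma ad_f_cubic: "ad (a *s chev_f i) ** (ad (a *s chev_f i) ** ad (a *s chev_f i)) = 0"
  by (rule ad_cubic[OF rho_ad_f lower_op_lin lower_op_sq])

lemma rho_x_el: "rho (x_el i a *v Y) (X_op i a f) = X_op i a (rho Y f)"
  unfolding x_el_def X_op_def
  by (rule ext, rule rho_mat_exp[OF rho_ad_e raise_op_lin raise_op_sq])

lemma rho_y_el: "rho (y_el i a *v Y) (Y_op i a f) = Y_op i a (rho Y f)"
  unfolding y_el_def Y_op_def
  by (rule ext, rule rho_mat_exp[OF rho_ad_f lower_op_lin lower_op_sq])

subsection \<open>Lifting from the adjoint to the minuscule representation\<close>

text \<open>A relation and not a function: the group acting on the 56-dimensional space is the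
  simply connected cover, so an adjoint element has two lifts, differing by the central element of
  order 2. A word in the generators picks one.\<close>

inductive lift :: "e7_mat \<Rightarrow> (wfun \<Rightarrow> wfun) \<Rightarrow> bool" where
  lift_one: "lift (mat 1) (\<lambda>f. f)"
| lift_x: "lift g A \<Longrightarrow> lift (x_el i a ** g) (\<lambda>f. X_op i a (A f))"
| lift_y: "lift g A \<Longrightarrow> lift (y_el i a ** g) (\<lambda>f. Y_op i a (A f))"

lemma lift_rho: "lift g A \<Longrightarrow> A (rho Y f) = rho (g *v Y) (A f)"
  by (induction arbitrary: Y f rule: lift.induct)
    (simp_all add: matrix_vector_mul_assoc[symmetric] rho_x_el rho_y_el)

lemma lift_mult: "lift g A \<Longrightarrow> lift h B \<Longrightarrow> lift (g ** h) (\<lambda>f. A (B f))"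
proof (induction rule: lift.induct)
  case lift_one
  then show ?case by simp
next
  case (lift_x g A i a)
  then show ?case using lift.lift_x[of "g ** h" "\<lambda>f. A (B f)" i a] by (simp add: matrix_mul_assoc)
next
  case (lift_y g A i a)
  then show ?case using lift.lift_y[of "g ** h" "\<lambda>f. A (B f)" i a] by (simp add: matrix_mul_assoc)
qed

lemma lift_x_el: "lift (x_el i a) (X_op i a)" and lift_y_el: "lift (y_el i a) (Y_op i a)"
  using lift_x[OF lift_one, of i a] lift_y[OF lift_one, of i a] by simp_all

lemma X_op_add: "X_op i a (X_op i b f) = X_op i (a + b) f"
  by (simp add: X_op_def raise_op_lin raise_op_sq algebra_simps)

lemma Y_op_add: "Y_op i a (Y_op i b f) = Y_op i (a + b) f"
  by (simp add: Y_op_def lower_op_lin lower_op_sq algebra_simps)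

lemma XY_op_0 [simp]: "X_op i 0 f = f" "Y_op i 0 f = f"
  by (simp_all add: X_op_def Y_op_def)

lemma lift_surj: "lift g A \<Longrightarrow> \<exists>f'. A f' = f"
proof (induction arbitrary: f rule: lift.induct)
  case (lift_x g A i a)
  obtain f' where "A f' = X_op i (- a) f" using lift_x.IH by blast
  then show ?case by (intro exI[of _ f']) (simp add: X_op_add)
next
  case (lift_y g A i a)
  obtain f' where "A f' = Y_op i (- a) f" using lift_y.IH by blast
  then show ?case by (intro exI[of _ f']) (simp add: Y_op_add)
qed simp

text \<open>By \<open>lift_rho\<close> a lift determines how the element conjugates the image of
  \<open>rho\<close>, and \<open>rho\<close> is faithful. Relations between generators of the
  adjoint group can therefore be checked on the 56 weights.\<close>

lemma lift_unique: assumes "lift g A" "lift h A" shows "g = h"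
proof -
  have "g *v Y = h *v Y" for Y
  proof (rule rho_inject)
    fix f v
    obtain f' where "f = A f'" using lift_surj[OF assms(1)] by metis
    then show "rho (g *v Y) f v = rho (h *v Y) f v"
      using lift_rho[OF assms(1), of Y f'] lift_rho[OF assms(2), of Y f'] by metis
  qed
  then show ?thesis by (simp add: matrix_eq)
qed

lemma x_el_add: "x_el i a ** x_el i b = x_el i (a + b)"
proof -
  have "lift (x_el i a ** x_el i b) (X_op i (a + b))"
    using lift_mult[OF lift_x_el lift_x_el, of i a i b] by (simp add: X_op_add)
  then show ?thesis by (rule lift_unique) (rule lift_x_el)
qed

lemma y_el_add: "y_el i a ** y_el i b = y_el i (a + b)"
proof -
  have "lift (y_el i a ** y_el i b) (Y_op i (a + b))"
    using lift_mult[OF lift_y_el lift_y_el, of i a i b] by (simp add: Y_op_add)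
  then show ?thesis by (rule lift_unique) (rule lift_y_el)
qed

lemma xy_el_0 [simp]: "x_el i 0 = mat 1" "y_el i 0 = mat 1"
proof -
  have "X_op i 0 = (\<lambda>f. f)" "Y_op i 0 = (\<lambda>f. f)" by auto
  then show "x_el i 0 = mat 1" "y_el i 0 = mat 1"
    using lift_unique lift_one lift_x_el[of i 0] lift_y_el[of i 0] by metis+
qed

lemma lift_inverse:
  "lift g A \<Longrightarrow> \<exists>h B. lift h B \<and> g ** h = mat 1 \<and> h ** g = mat 1 \<and> (\<forall>f. A (B f) = f) \<and> (\<forall>f. B (A f)
    = f)"
proof (induction rule: lift.induct)
  case lift_one
  show ?case by (intro exI conjI, rule lift.lift_one) simp_all
next
  case (lift_x g A i a)
  then obtain h B where h: "lift h B" "g ** h = mat 1" "h ** g = mat 1"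
    "\<forall>f. A (B f) = f" "\<forall>f. B (A f) = f" by auto
  have "x_el i a ** g ** (h ** x_el i (- a)) = x_el i a ** (g ** h) ** x_el i (- a)"
    "h ** x_el i (- a) ** (x_el i a ** g) = h ** (x_el i (- a) ** x_el i a) ** g"
    by (simp_all only: matrix_mul_assoc)
  then have "x_el i a ** g ** (h ** x_el i (- a)) = mat 1"
    "h ** x_el i (- a) ** (x_el i a ** g) = mat 1"
    using h by (simp_all add: x_el_add)
  moreover have "lift (h ** x_el i (- a)) (\<lambda>f. B (X_op i (- a) f))"
    by (rule lift_mult[OF h(1) lift_x_el])
  ultimately show ?case using h(4,5) by (intro exI conjI) (auto simp: X_op_add)
next
  case (lift_y g A i a)
  then obtain h B where h: "lift h B" "g ** h = mat 1" "h ** g = mat 1"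
    "\<forall>f. A (B f) = f" "\<forall>f. B (A f) = f" by auto
  have "y_el i a ** g ** (h ** y_el i (- a)) = y_el i a ** (g ** h) ** y_el i (- a)"
    "h ** y_el i (- a) ** (y_el i a ** g) = h ** (y_el i (- a) ** y_el i a) ** g"
    by (simp_all only: matrix_mul_assoc)
  then have "y_el i a ** g ** (h ** y_el i (- a)) = mat 1"
    "h ** y_el i (- a) ** (y_el i a ** g) = mat 1"
    using h by (simp_all add: y_el_add)
  moreover have "lift (h ** y_el i (- a)) (\<lambda>f. B (Y_op i (- a) f))"
    by (rule lift_mult[OF h(1) lift_y_el])
  ultimately show ?case using h(4,5) by (intro exI conjI) (auto simp: Y_op_add)
qed

lemma matrix_inv_eqI:
  fixes g h :: "'a :: semiring_1 ^ 'n ^ 'n"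
  assumes "g ** h = mat 1" "h ** g = mat 1" shows "matrix_inv g = h"
proof -
  have "\<exists>h. g ** h = mat 1 \<and> h ** g = mat 1" using assms by auto
  then have "g ** matrix_inv g = mat 1" unfolding matrix_inv_def
    by (metis (mono_tags, lifting) someI_ex)
  then have "h ** (g ** matrix_inv g) = h" by simp
  then show ?thesis using assms(2) by (simp add: matrix_mul_assoc)
qed

lemma lift_matrix_inv:
  assumes "lift g A"
  shows "g ** matrix_inv g = mat 1" "matrix_inv g ** g = mat 1" "invertible g"
    "lift (matrix_inv g) (inv_into UNIV A)"
proof -
  obtain h B where h: "lift h B" "g ** h = mat 1" "h ** g = mat 1"
    "\<forall>f. A (B f) = f" "\<forall>f. B (A f) = f"
    using lift_inverse[OF assms] by auto
  have "matrix_inv g = h" by (rule matrix_inv_eqI[OF h(2,3)])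
  moreover have "inv_into UNIV A = B"
  proof (rule inv_unique_comp)
    show "A \<circ> B = id" using h(4) by (intro ext) simp
    show "B \<circ> A = id" using h(5) by (intro ext) simp
  qed
  ultimately show "g ** matrix_inv g = mat 1" "matrix_inv g ** g = mat 1" "invertible g"
    "lift (matrix_inv g) (inv_into UNIV A)" using h(1-3) by (auto simp: invertible_def)
qed

lemma lift_lin: "lift g A \<Longrightarrow> A (\<lambda>w. f w + c * h w) = (\<lambda>w. A f w + c * A h w)"
proof (induction rule: lift.induct)
  case (lift_x g A i a)
  then show ?case by (auto simp: X_op_def raise_op_lin algebra_simps)
next
  case (lift_y g A i a)
  then show ?case by (auto simp: Y_op_def lower_op_lin algebra_simps)
qed simp

lemma lift_zero: "lift g A \<Longrightarrow> A (\<lambda>w. 0) = (\<lambda>w. 0)"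
  using lift_lin[of g A "\<lambda>w. 0" "-1" "\<lambda>w. 0"] by simp

lemma lift_scale: "lift g A \<Longrightarrow> A (\<lambda>w. c * h w) = (\<lambda>w. c * A h w)"
  using lift_lin[of g A "\<lambda>w. 0" c h] lift_zero[of g A] by simp

lemma lift_sum: "lift g A \<Longrightarrow> A (\<lambda>w. \<Sum>k\<in>K. c k * h k w) = (\<lambda>w. \<Sum>k\<in>K. c k * A (h k) w)"
proof (induction K rule: infinite_finite_induct)
  case (insert k K)
  have "(\<lambda>w. \<Sum>j\<in>insert k K. c j * h j w) = (\<lambda>w. (\<Sum>j\<in>K. c j * h j w) + c k * h k w)"
    using insert by (simp add: add.commute)
  then have "A (\<lambda>w. \<Sum>j\<in>insert k K. c j * h j w) = (\<lambda>w. A (\<lambda>w. \<Sum>j\<in>K. c j * h j w) w + c k * A (h k)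
    w)"
    using lift_lin[OF insert.prems] by simp
  then show ?case using insert by (simp add: add.commute)
qed (auto simp: lift_zero)

lemma lift_outside: "lift g A \<Longrightarrow> v \<notin> wts \<Longrightarrow> A f v = f v"
  by (induction arbitrary: f rule: lift.induct) (simp_all add: X_op_def Y_op_def raise_op_def
    lower_op_def)

lemma lift_local:
  "lift g A \<Longrightarrow> \<forall>v\<in>wts. f v = h v \<Longrightarrow> \<forall>v\<in>wts. A f v = A h v"
proof (induction rule: lift.induct)
  case (lift_x g A i a)
  then show ?case by (auto simp: X_op_def raise_op_def wts_diff)
next
  case (lift_y g A i a)
  then show ?case by (auto simp: Y_op_def lower_op_def wts_add)
qed simp

lemma lift_expand:
  assumes "lift g A" "v \<in> wts" shows "A f v = (\<Sum>u\<in>wts. f u * A (delta u) v)"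
proof -
  have "f w = (\<Sum>u\<in>wts. f u * delta u w)" if "w \<in> wts" for w
  proof -
    have "(\<Sum>u\<in>wts. f u * delta u w) = (\<Sum>u\<in>wts. if u = w then f u else 0)"
      by (rule sum.cong) (auto simp: delta_def)
    then show ?thesis using that by simp
  qed
  then have "A f v = A (\<lambda>w. \<Sum>u\<in>wts. f u * delta u w) v"
    using lift_local[OF assms(1), of f "\<lambda>w. \<Sum>u\<in>wts. f u * delta u w"] assms(2) by simp
  also have "\<dots> = (\<Sum>u\<in>wts. f u * A (delta u) v)"
    by (rule lift_sum[OF assms(1), THEN fun_cong])
  finally show ?thesis .
qed

subsection \<open>The groups as sets of words\<close>

lemma GL_simps [simp]: "carrier GL_e7 = {A. invertible A}" "x \<otimes>\<^bsub>GL_e7\<^esub> y = x ** y"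
  "\<one>\<^bsub>GL_e7\<^esub> = mat 1"
  by (simp_all add: GL_e7_def)

lemma group_GL: "group GL_e7"
proof (rule groupI)
  fix x assume "x \<in> carrier GL_e7"
  then obtain y where "x ** y = mat 1" "y ** x = mat 1" by (auto simp: invertible_def)
  then show "\<exists>y\<in>carrier GL_e7. y \<otimes>\<^bsub>GL_e7\<^esub> x = \<one>\<^bsub>GL_e7\<^esub>" by (auto simp: invertible_def)
next
  show "\<one>\<^bsub>GL_e7\<^esub> \<in> carrier GL_e7" by (auto simp: invertible_def)
qed (auto simp: matrix_mul_assoc intro: invertible_mult)

lemma matrix_inv_inverse:
  assumes "invertible (g :: 'a :: semiring_1 ^ 'n ^ 'n)"
  shows "g ** matrix_inv g = mat 1" "matrix_inv g ** g = mat 1"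
proof -
  obtain h where "g ** h = mat 1" "h ** g = mat 1" using assms by (auto simp: invertible_def)
  then show "g ** matrix_inv g = mat 1" "matrix_inv g ** g = mat 1" using matrix_inv_eqI by metis+
qed

lemma inv_GL: assumes "invertible g" shows "inv\<^bsub>GL_e7\<^esub> g = matrix_inv g"
proof -
  have "invertible (matrix_inv g)" using matrix_inv_inverse[OF assms] by (auto simp: invertible_def)
  then show ?thesis using group.inv_equality[OF group_GL, of
    "matrix_inv g" g] matrix_inv_inverse[OF assms] assms
    by simp
qed

lemma generate_GL:
  assumes "\<And>h. h \<in> H \<Longrightarrow> invertible h"
  shows "mat 1 \<in> generate GL_e7 H" "h \<in> H \<Longrightarrow> h \<in> generate GL_e7 H"
    "g \<in> generate GL_e7 H \<Longrightarrow> h \<in> generate GL_e7 H \<Longrightarrow> g ** h \<in> generate GL_e7 H"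
    "g \<in> generate GL_e7 H \<Longrightarrow> invertible g"
    "g \<in> generate GL_e7 H \<Longrightarrow> matrix_inv g \<in> generate GL_e7 H"
proof -
  have sg: "subgroup (generate GL_e7 H) GL_e7"
    by (rule group.generate_is_subgroup[OF group_GL]) (use assms in auto)
  note sgr = subgroup.one_closed[OF sg] subgroup.m_closed[OF sg] subgroup.subset[OF sg]
    subgroup.m_inv_closed[OF sg]
  show "mat 1 \<in> generate GL_e7 H" using sgr(1) by simp
  show "h \<in> H \<Longrightarrow> h \<in> generate GL_e7 H" by (rule generate.incl)
  show "g \<in> generate GL_e7 H \<Longrightarrow> h \<in> generate GL_e7 H \<Longrightarrow> g ** h \<in> generate GL_e7 H"
    using sgr(2) by simp
  show i: "g \<in> generate GL_e7 H \<Longrightarrow> invertible g" using sgr(3) by auto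
  show "g \<in> generate GL_e7 H \<Longrightarrow> matrix_inv g \<in> generate GL_e7 H" using sgr(4) i inv_GL by metis
qed

text \<open>Since \<open>H\<close> contains the inverses of its elements, everything generated is a
  word in \<open>H\<close> built from the left. The product case of \<open>generate\<close> is
  absorbed by proving the claim for \<open>x ** v\<close> with arbitrary \<open>v\<close>.\<close>

lemma generate_induct_left:
  assumes x: "x \<in> generate GL_e7 H"
    and H: "\<And>h. h \<in> H \<Longrightarrow> \<exists>h'\<in>H. h ** h' = mat 1 \<and> h' ** h = mat 1"
    and one: "P (mat 1)" and step: "\<And>h u. h \<in> H \<Longrightarrow> u \<in> generate GL_e7 H \<Longrightarrow> P u \<Longrightarrow> P (h ** u)"
  shows "P x"
proof -
  have inv: "invertible h" if "h \<in> H" for h using H[OF that] by (auto simp: invertible_def)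
  have "\<forall>v. v \<in> generate GL_e7 H \<and> P v \<longrightarrow> x ** v \<in> generate GL_e7 H \<and> P (x ** v)"
    using x
  proof (induction rule: generate.induct)
    case (incl h)
    then show ?case using step generate_GL(2,3)[of H] inv by blast
  next
    case (inv h)
    then obtain h' where h': "h' \<in> H" "h ** h' = mat 1" "h' ** h = mat 1" using H by blast
    then have "inv\<^bsub>GL_e7\<^esub> h = h'" using inv_GL \<open>\<And>h. h \<in> H \<Longrightarrow> invertible h\<close> inv matrix_inv_eqI
      by metis
    then show ?case using h'(1) step generate_GL(2,3)[of H] \<open>\<And>h. h \<in> H \<Longrightarrow> invertible h\<close> by metis
  next
    case (eng h1 h2)
    then show ?case by (simp add: matrix_mul_assoc[symmetric])
  qed simp
  then have "P (x ** mat 1)" using one generate_GL(1)[of H] inv by blast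
  then show ?thesis by simp
qed

lemma G_dual_generators:
  "h \<in> {x_el i a |i a. True} \<union> {y_el i a |i a. True} \<Longrightarrow>
    \<exists>h'\<in>{x_el i a |i a. True} \<union> {y_el i a |i a. True}. h ** h' = mat 1 \<and> h' ** h = mat 1"
proof -
  have "x_el i a ** x_el i (- a) = mat 1 \<and> x_el i (- a) ** x_el i a = mat 1"
    "y_el i a ** y_el i (- a) = mat 1 \<and> y_el i (- a) ** y_el i a = mat 1" for i a
    by (simp_all add: x_el_add y_el_add)
  then show "h \<in> {x_el i a |i a. True} \<union> {y_el i a |i a. True} \<Longrightarrow>
    \<exists>h'\<in>{x_el i a |i a. True} \<union> {y_el i a |i a. True}. h ** h' = mat 1 \<and> h' ** h = mat 1" by blast
qed

lemma invertible_xy [simp]: "invertible (x_el i a)" "invertible (y_el i a)"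
  using lift_matrix_inv(3) lift_x_el lift_y_el by blast+

lemma matrix_inv_xy [simp]: "matrix_inv (x_el i a) = x_el i (- a)"
  "matrix_inv (y_el i a) = y_el i (- a)"
  by (rule matrix_inv_eqI; simp add: x_el_add y_el_add)+

lemma G_dual_iff_lift: "g \<in> G_dual \<longleftrightarrow> (\<exists>A. lift g A)"
proof
  assume "g \<in> G_dual"
  then show "\<exists>A. lift g A" unfolding G_dual_def
    by (rule generate_induct_left[OF _ G_dual_generators]) (use lift_one lift_x lift_y in blast)+
next
  assume "\<exists>A. lift g A"
  then obtain A where "lift g A" by blast
  then show "g \<in> G_dual"
  proof (induction rule: lift.induct)
    case lift_one
    show ?case unfolding G_dual_def by (rule generate_GL) auto
  next
    case (lift_x g A i a)
    have "x_el i a \<in> generate GL_e7 ({x_el i a |i a. True} \<union> {y_el i a |i a. True})"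
      by (rule generate.incl) auto
    from generate.eng[OF this lift_x.IH[unfolded G_dual_def]] show ?case by (simp add: G_dual_def)
  next
    case (lift_y g A i a)
    have "y_el i a \<in> generate GL_e7 ({x_el i a |i a. True} \<union> {y_el i a |i a. True})"
      by (rule generate.incl) auto
    from generate.eng[OF this lift_y.IH[unfolded G_dual_def]] show ?case by (simp add: G_dual_def)
  qed
qed

lemma G_dual_closed:
  "mat 1 \<in> G_dual" "g \<in> G_dual \<Longrightarrow> h \<in> G_dual \<Longrightarrow> g ** h \<in> G_dual"
  "g \<in> G_dual \<Longrightarrow> matrix_inv g \<in> G_dual" "g \<in> G_dual \<Longrightarrow> invertible g"
  "x_el i a \<in> G_dual" "y_el i a \<in> G_dual"
  unfolding G_dual_iff_lift
  using lift_one lift_mult lift_matrix_inv(3,4) lift_x_el lift_y_el by meson+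

definition wt :: "e7_idx \<Rightarrow> int ^ 7" where
  "wt k = (case k of Inl i \<Rightarrow> 0 | Inr a \<Rightarrow> root_vec a)"

lemma wt_simps [simp]: "wt (Inl i) = 0" "wt (Inr a) = root_vec a"
  by (simp_all add: wt_def)

lemma minus_one_smult [simp]: "(-1) *s v = - (v :: int ^ 'n)"
  by (simp add: vec_eq_iff)

text \<open>\<open>sgn_el 1\<close> is \<open>x_el\<close> and \<open>sgn_el (-1)\<close> is \<open>y_el\<close>, so that both unipotent radicals are
  treated at once.\<close>

definition sgn_root :: "int \<Rightarrow> 7 \<Rightarrow> e7_root" where
  "sgn_root s i = Abs_root (s *s simple_root i)"

definition sgn_ad :: "int \<Rightarrow> 7 \<Rightarrow> complex \<Rightarrow> e7_mat" where
  "sgn_ad s i a = ad (axis (Inr (sgn_root s i)) (of_int s * a))"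

definition sgn_el :: "int \<Rightarrow> 7 \<Rightarrow> complex \<Rightarrow> e7_mat" where
  "sgn_el s i a = mat_exp (sgn_ad s i a)"

definition sgn_U :: "int \<Rightarrow> e7_mat set" where
  "sgn_U s = generate GL_e7 {sgn_el s i a | i a. True}"

lemma sgn_ad_eq: "sgn_ad 1 i a = ad (a *s chev_e i)" "sgn_ad (-1) i a = ad (a *s chev_f i)"
  by (simp_all add: sgn_ad_def sgn_root_def chev_e_axis chev_f_axis)

lemma sgn_el_eq: "sgn_el 1 = x_el" "sgn_el (-1) = y_el"
  by (simp_all add: fun_eq_iff sgn_el_def sgn_ad_eq x_el_def y_el_def)

lemma sgn_U_eq: "sgn_U 1 = U_plus" "sgn_U (-1) = U_minus"
  by (simp_all add: sgn_U_def sgn_el_eq U_plus_def U_minus_def)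

definition unit_sign :: "int \<Rightarrow> bool" where "unit_sign s \<longleftrightarrow> s = 1 \<or> s = -1"

lemma root_vec_sgn_root [simp]: "unit_sign s \<Longrightarrow> root_vec (sgn_root s i) = s *s simple_root i"
  by (auto simp: sgn_root_def unit_sign_def)

lemma sgn_el_add:
  assumes "unit_sign s" shows "sgn_el s i a ** sgn_el s i b = sgn_el s i (a + b)"
    "sgn_el s i 0 = mat 1"
    "invertible (sgn_el s i a)"
  using assms by (auto simp: unit_sign_def sgn_el_eq x_el_add y_el_add)

lemma sgn_U_closed:
  assumes s: "unit_sign s"
  shows "mat 1 \<in> sgn_U s" "sgn_el s i a \<in> sgn_U s"
    "g \<in> sgn_U s \<Longrightarrow> h \<in> sgn_U s \<Longrightarrow> g ** h \<in> sgn_U s"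
    "g \<in> sgn_U s \<Longrightarrow> invertible g" "g \<in> sgn_U s \<Longrightarrow> matrix_inv g \<in> sgn_U s"
proof -
  have i: "h \<in> {sgn_el s i a |i a. True} \<Longrightarrow> invertible h" for h using sgn_el_add(3)[OF s] by auto
  note g = generate_GL[of "{sgn_el s i a |i a. True}", OF i, folded sgn_U_def]
  show "mat 1 \<in> sgn_U s" by (rule g(1))
  show "sgn_el s i a \<in> sgn_U s" by (rule g(2)) auto
  show "g \<in> sgn_U s \<Longrightarrow> h \<in> sgn_U s \<Longrightarrow> g ** h \<in> sgn_U s" by (rule g(3))
  show "g \<in> sgn_U s \<Longrightarrow> invertible g" by (rule g(4))
  show "g \<in> sgn_U s \<Longrightarrow> matrix_inv g \<in> sgn_U s" by (rule g(5))
qed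

lemma sgn_U_induct [consumes 2, case_names one step]:
  assumes s: "unit_sign s" and x: "x \<in> sgn_U s" and one: "P (mat 1)"
    and step: "\<And>i a u. u \<in> sgn_U s \<Longrightarrow> P u \<Longrightarrow> P (sgn_el s i a ** u)"
  shows "P x"
  using x unfolding sgn_U_def
proof (rule generate_induct_left)
  fix h assume "h \<in> {sgn_el s i a |i a. True}"
  then obtain i a where h: "h = sgn_el s i a" by auto
  show "\<exists>h'\<in>{sgn_el s i a |i a. True}. h ** h' = mat 1 \<and> h' ** h = mat 1"
    using sgn_el_add[OF s] h by (intro bexI[of _ "sgn_el s i (- a)"]) auto
next
  fix h u assume "h \<in> {sgn_el s i a |i a. True}" "u \<in> generate GL_e7 {sgn_el s i a |i a. True}"
    "P u"
  then show "P (h ** u)" using step by (auto simp: sgn_U_def)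
qed (rule one)

lemmas U_plus_induct = sgn_U_induct[of 1, unfolded sgn_el_eq sgn_U_eq, OF unit_sign_def[THEN iffD2,
  OF disjI1[OF HOL.refl]], consumes 1, case_names one step]
lemmas U_plus_closed = sgn_U_closed[of 1, unfolded sgn_el_eq sgn_U_eq, OF unit_sign_def[THEN iffD2,
  OF disjI1[OF HOL.refl]]]
lemmas U_minus_induct = sgn_U_induct[of "-1", unfolded sgn_el_eq sgn_U_eq, OF unit_sign_def[THEN
  iffD2, OF disjI2[OF HOL.refl]], consumes 1, case_names one step]
lemmas U_minus_closed = sgn_U_closed[of "-1", unfolded sgn_el_eq sgn_U_eq, OF unit_sign_def[THEN
  iffD2, OF disjI2[OF HOL.refl]]]

lemma U_minus_G: "u \<in> U_minus \<Longrightarrow> u \<in> G_dual"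
  by (induction rule: U_minus_induct) (auto intro: G_dual_closed)

subsection \<open>Unitriangularity\<close>

lemma bracket_basis_wt: "bracket_basis i j $ k \<noteq> 0 \<Longrightarrow> wt k = wt i + wt j"
  by (cases i; cases j; cases k) (auto simp: axis_def add_eq_0_iff split: if_splits)

lemma sgn_ad_nth: "sgn_ad s i a $ k $ j = of_int s * a * bracket_basis (Inr (sgn_root s i)) j $ k"
proof -
  have "axis (Inr (sgn_root s i)) (of_int s * a) $ l * bracket_basis l j $ k
    = (if l = Inr (sgn_root s i) then of_int s * a * bracket_basis (Inr (sgn_root s i)) j $ k
      else 0)" for l
    by (simp add: axis_def)
  then show ?thesis by (simp add: sgn_ad_def ad_def)
qed

lemma sgn_ad_wt: "unit_sign s \<Longrightarrow> sgn_ad s i a $ k $ j \<noteq> 0 \<Longrightarrow> wt k = s *s simple_root i + wt j"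
  using bracket_basis_wt[of "Inr (sgn_root s i)" j k] by (auto simp: sgn_ad_nth)

lemma sgn_ad_cubic: "unit_sign s \<Longrightarrow> sgn_ad s i a ** (sgn_ad s i a ** sgn_ad s i a) = 0"
  using ad_e_cubic ad_f_cubic by (auto simp: unit_sign_def sgn_ad_eq)

lemma matrix_mul_nth: "(A ** B) $ k $ j = (\<Sum>l\<in>UNIV. A $ k $ l * B $ l $ j)"
  by (simp add: matrix_matrix_mult_def)

lemma sgn_ad_sq_wt:
  assumes "unit_sign s" "(sgn_ad s i a ** sgn_ad s i a) $ k $ j \<noteq> 0"
  shows "wt k = 2 *s (s *s simple_root i) + wt j"
proof -
  obtain l where "sgn_ad s i a $ k $ l \<noteq> 0" "sgn_ad s i a $ l $ j \<noteq> 0"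
    using assms(2) unfolding matrix_mul_nth
      by (metis (mono_tags, lifting) mult_zero_left mult_zero_right sum.neutral)
  then have "wt k = s *s simple_root i + (s *s simple_root i + wt j)"
    using sgn_ad_wt[OF assms(1)] by metis
  then show ?thesis by (simp add: vec_eq_iff)
qed

lemma sgn_el_nth:
  assumes "unit_sign s"
  shows "sgn_el s i a $ k $ j = (if k = j then 1 else 0) + sgn_ad s i a $ k $ j
    + (sgn_ad s i a ** sgn_ad s i a) $ k $ j / 2"
  unfolding sgn_el_def mat_exp_cubic(1)[OF sgn_ad_cubic[OF assms]]
  by (simp add: mat_def scaleR_conv_of_real[where 'a = complex])

lemma sgn_el_support:
  assumes s: "unit_sign s"
  shows "sgn_el s i a $ k $ k = 1"
    "k \<noteq> j \<Longrightarrow> sgn_el s i a $ k $ j \<noteq> 0 \<Longrightarrow> \<exists>n \<in> {1, 2}. wt k - wt j = n *s (s *s simple_root i)"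
proof -
  have nz: "simple_root i \<noteq> 0" "s \<noteq> 0" using is_root_nonzero[OF is_root_simple_root] s
    by (auto simp: unit_sign_def)
  have "sgn_ad s i a $ k $ k = 0"
    using sgn_ad_wt[OF s, of i a k k] nz by auto
  moreover have "(sgn_ad s i a ** sgn_ad s i a) $ k $ k = 0"
    using sgn_ad_sq_wt[OF s, of i a k k] nz by auto
  ultimately show "sgn_el s i a $ k $ k = 1" by (simp add: sgn_el_nth[OF s])
  assume "k \<noteq> j" "sgn_el s i a $ k $ j \<noteq> 0"
  then have "sgn_ad s i a $ k $ j \<noteq> 0 \<or> (sgn_ad s i a ** sgn_ad s i a) $ k $ j \<noteq> 0"
    by (auto simp: sgn_el_nth[OF s])
  then show "\<exists>n \<in> {1, 2}. wt k - wt j = n *s (s *s simple_root i)"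
    using sgn_ad_wt[OF s, of i a k j] sgn_ad_sq_wt[OF s, of i a k j] by auto
qed

text \<open>Triangularity with respect to weights, upwards for \<open>s = 1\<close> and downwards
  for \<open>s = -1\<close>. The seven Cartan indices share the weight 0; requiring distinct weights
  off the diagonal makes the Cartan block the identity.\<close>

definition unitri :: "int \<Rightarrow> e7_mat \<Rightarrow> bool" where
  "unitri s M \<longleftrightarrow> (\<forall>k. M $ k $ k = 1) \<and>
     (\<forall>k j. k \<noteq> j \<longrightarrow> M $ k $ j \<noteq> 0 \<longrightarrow> wt k \<noteq> wt j \<and> nonneg (s *s (wt k - wt j)))"

lemma unitri_sgn_el: assumes s: "unit_sign s" shows "unitri s (sgn_el s i a)"
  unfolding unitri_def
proof (intro conjI allI impI sgn_el_support(1)[OF s])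
  fix k j assume "k \<noteq> j" "sgn_el s i a $ k $ j \<noteq> 0"
  then obtain n :: int where n: "n = 1 \<or> n = 2" "wt k - wt j = n *s (s *s simple_root i)"
    using sgn_el_support(2)[OF s] by blast
  have "s * s = 1" using s by (auto simp: unit_sign_def)
  then have "s *s (wt k - wt j) = n *s simple_root i" unfolding n
    by (simp add: vec_eq_iff mult.left_commute[of s])
  then show "nonneg (s *s (wt k - wt j))" using n(1) by (auto simp: nonneg_def simple_root_nth)
  show "wt k \<noteq> wt j"
  proof
    assume "wt k = wt j"
    then have "n *s (s *s simple_root i) = 0" using n(2) by simp
    then have "(n * s) * simple_root i $ i = 0"
      by (metis mult.assoc vector_smult_component zero_index)
    then show False using n(1) s by (auto simp: simple_root_nth unit_sign_def)
  qed
qed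

lemma unitri_one: "unitri s (mat 1)" by (simp add: unitri_def mat_def)

lemma nonneg_antisym: "nonneg (s *s (v - w)) \<Longrightarrow> nonneg (s *s (w - u)) \<Longrightarrow> nonneg (s *s (v - u))"
  using nonneg_add[of "s *s (v - w)" "s *s (w - u)"]
    by (simp add: algebra_simps vector_ssub_ldistrib nonneg_def)

lemma nonneg_cycle:
  assumes s: "unit_sign s" and "nonneg (s *s (v - w))" "nonneg (s *s (w - v))" shows "v = w"
  using assms by (auto simp: nonneg_def vec_eq_iff unit_sign_def intro: antisym)

lemma unitri_mult:
  assumes s: "unit_sign s" and M: "unitri s M" and N: "unitri s N" shows "unitri s (M ** N)"
proof -
  have Mn: "nonneg (s *s (wt k - wt l))" if "M $ k $ l \<noteq> 0" for k l
    using M that by (cases "k = l") (auto simp: unitri_def nonneg_def)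
  have Nn: "nonneg (s *s (wt k - wt l))" if "N $ k $ l \<noteq> 0" for k l
    using N that by (cases "k = l") (auto simp: unitri_def nonneg_def)
  have d: "(M ** N) $ k $ k = 1" for k
  proof -
    have "M $ k $ l * N $ l $ k = (if l = k then 1 else 0)" for l
    proof (cases "l = k")
      case False
      have "M $ k $ l = 0 \<or> N $ l $ k = 0"
      proof (rule ccontr)
        assume nz: "\<not> ?thesis"
        then have "wt k = wt l" using Mn Nn nonneg_cycle[OF s] by blast
        moreover have "wt k \<noteq> wt l" using M False nz unfolding unitri_def by metis
        ultimately show False by blast
      qed
      then show ?thesis using False by auto
    qed (use M N in \<open>auto simp: unitri_def\<close>)
    then show ?thesis by (simp add: matrix_mul_nth)
  qed
  have "wt k \<noteq> wt j \<and> nonneg (s *s (wt k - wt j))" if kj: "k \<noteq> j" "(M ** N) $ k $ j \<noteq> 0" for k j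
  proof -
    obtain l where l: "M $ k $ l \<noteq> 0" "N $ l $ j \<noteq> 0"
      using kj(2) unfolding matrix_mul_nth
        by (metis (mono_tags, lifting) mult_zero_left mult_zero_right sum.neutral)
    note n = Mn[OF l(1)] Nn[OF l(2)]
    have "wt k \<noteq> wt j"
    proof
      assume e: "wt k = wt j"
      then have e2: "wt k = wt l" "wt l = wt j" using n nonneg_cycle[OF s] by metis+
      then have "k = l" "l = j" using l M N unfolding unitri_def by metis+
      then show False using kj by simp
    qed
    then show ?thesis using nonneg_antisym[OF n] by blast
  qed
  then show ?thesis using d by (auto simp: unitri_def)
qed

lemma unitri_sgn_U: assumes s: "unit_sign s" and u: "u \<in> sgn_U s" shows "unitri s u"
  using s u by (induction rule: sgn_U_induct) (auto intro: unitri_one unitri_mult[OF s]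
    unitri_sgn_el[OF s])

subsection \<open>The additive characters\<close>

text \<open>The bracket of \<open>e_i\<close> with \<open>h_i\<close> is \<open>-2 e_i\<close>, so
  the entry from \<open>h_i\<close> to the root vector of \<open>e_i\<close> is -2 times the
  coefficient of \<open>e_i\<close>. For \<open>f_i\<close> the two signs cancel and the same factor
  results.\<close>

definition chi :: "int \<Rightarrow> 7 \<Rightarrow> e7_mat \<Rightarrow> complex" where
  "chi s i u = - u $ Inr (sgn_root s i) $ Inl i / 2"

text \<open>Nothing lies strictly between the weight 0 and a simple root, so only the two end points
  contribute to this entry of the product.\<close>

lemma chi_mult:
  assumes s: "unit_sign s" and M: "unitri s M" and N: "unitri s N"
  shows "chi s i (M ** N) = chi s i M + chi s i N"
proof -
  let ?k = "Inr (sgn_root s i) :: e7_idx" and ?j = "Inl i :: e7_idx"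
  have ss: "s * s = 1" using s by (auto simp: unit_sign_def)
  have "M $ ?k $ l * N $ l $ ?j = (if l = ?k then N $ ?k $ ?j else 0) + (if l
    = ?j then M $ ?k $ ?j else 0)" for l
  proof (cases "l = ?k \<or> l = ?j")
    case True
    then show ?thesis using M N by (auto simp: unitri_def)
  next
    case False
    have "M $ ?k $ l = 0 \<or> N $ l $ ?j = 0"
    proof (rule ccontr)
      assume nz: "\<not> ?thesis"
      then have 1: "wt ?k \<noteq> wt l" "nonneg (s *s (wt ?k - wt l))" "wt l \<noteq> wt ?j"
        "nonneg (s *s (wt l - wt ?j))"
        using M N False unfolding unitri_def by metis+
      then obtain b where l: "l = Inr b" by (cases l) auto
      have e: "s *s (wt ?k - wt l) = simple_root i - s *s root_vec b"
        using s ss by (simp add: l vector_ssub_ldistrib)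
      have nb: "nonneg (s *s root_vec b)" "nonneg (simple_root i - s *s root_vec b)"
        using 1 e l by simp_all
      have rb: "is_root (s *s root_vec b)" using is_root_root_vec[of b] s
        by (auto simp: unit_sign_def)
      have z: "(s *s root_vec b) $ k = 0" if "k \<noteq> i" for k
        using nb that unfolding nonneg_def
          by (metis antisym diff_0 neg_0_le_iff_le simple_root_nth vector_minus_component)
      have "s *s root_vec b = ((s *s root_vec b) $ i) *s simple_root i"
        using z by (auto simp: vec_eq_iff simple_root_nth)
      moreover have "(s *s root_vec b) $ i = 0 \<or> (s *s root_vec b) $ i = 1"
      proof -
        have "0 \<le> (s *s root_vec b) $ i" "(s *s root_vec b) $ i \<le> 1"
          using nb(1)[unfolded nonneg_def, rule_format, of i] nb(2)[unfolded nonneg_def,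
            rule_format, of i]
          by (simp_all add: simple_root_nth)
        then show ?thesis by arith
      qed
      ultimately have "s *s root_vec b = 0 \<or> s *s root_vec b = simple_root i"
        by (metis vector_smult_lzero vector_smult_lid)
      then have "s *s root_vec b = simple_root i" using is_root_nonzero[OF rb] by blast
      then have "root_vec b = s *s simple_root i" using ss
        by (metis vector_smult_assoc vector_smult_lid)
      then have "l = ?k" using l root_vec_sgn_root[OF s, of i] by (metis root_vec_inj)
      then show False using False by blast
    qed
    then show ?thesis using False by auto
  qed
  then have "(M ** N) $ ?k $ ?j = N $ ?k $ ?j + M $ ?k $ ?j"
    by (simp add: matrix_mul_nth sum.distrib)
  then show ?thesis by (simp add: chi_def field_simps)
qed

lemma chi_sgn_el: assumes s: "unit_sign s" shows "chi s i (sgn_el s j a) = (if i = j then a else 0)"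
proof -
  let ?k = "Inr (sgn_root s i) :: e7_idx" and ?j = "Inl i :: e7_idx"
  have ss: "s * s = 1" "s \<noteq> 0" using s by (auto simp: unit_sign_def)
  have "(sgn_ad s j a ** sgn_ad s j a) $ ?k $ ?j = 0"
  proof (rule ccontr)
    assume "\<not> ?thesis"
    then have "wt ?k = 2 *s (s *s simple_root j) + wt ?j" by (rule sgn_ad_sq_wt[OF s])
    from arg_cong[OF this, of "\<lambda>v. v $ i"] have
      "s * simple_root i $ i = 2 * (s * simple_root j $ i)"
      using s by simp
    then show False using ss by (auto simp: simple_root_nth split: if_splits)
  qed
  moreover have "sgn_ad s j a $ ?k $ ?j = (if i = j then - 2 * a else 0)"
  proof -
    have "sgn_root s i = sgn_root s j \<longleftrightarrow> i = j"
      using ss by (metis root_vec_sgn_root s simple_root_eq_iff vector_smult_assoc vector_smult_lid)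
    moreover have "complex_of_int s * complex_of_int s = 1" using ss by (metis of_int_1 of_int_mult)
    ultimately show ?thesis using s
      by (simp add: sgn_ad_nth axis_def mult.commute mult.left_commute)
  qed
  ultimately show ?thesis by (simp add: chi_def sgn_el_nth[OF s])
qed

lemma the_additive_character:
  assumes s: "unit_sign s" and u: "u \<in> sgn_U s"
  shows "(THE \<phi>. \<phi> \<in> extensional (sgn_U s) \<and> \<phi> \<in> hom (GL_e7\<lparr>carrier := sgn_U s\<rparr>) C_add \<and>
     (\<forall>j a. \<phi> (sgn_el s j a) = (if i = j then a else 0))) u = chi s i u"
proof -
  let ?P = "\<lambda>\<phi>. \<phi> \<in> extensional (sgn_U s) \<and> \<phi> \<in> hom (GL_e7\<lparr>carrier := sgn_U s\<rparr>) C_add \<and>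
     (\<forall>j a. \<phi> (sgn_el s j a) = (if i = j then a else 0))"
  let ?f = "restrict (chi s i) (sgn_U s)"
  note cl = sgn_U_closed[OF s] and un = unitri_sgn_U[OF s]
  have "(THE \<phi>. ?P \<phi>) = ?f"
  proof (rule the_equality)
    show "?P ?f"
    proof (intro conjI allI)
      show "?f \<in> hom (GL_e7\<lparr>carrier := sgn_U s\<rparr>) C_add"
        by (rule homI) (auto simp: C_add_def cl un chi_mult[OF s])
    qed (auto simp: cl chi_sgn_el[OF s])
    fix \<phi> assume P: "?P \<phi>"
    have add: "\<phi> (g ** h) = \<phi> g + \<phi> h" if "g \<in> sgn_U s" "h \<in> sgn_U s" for g h
      using P that by (auto simp: hom_def C_add_def)
    have one: "\<phi> (mat 1) = 0" using add[OF cl(1) cl(1)] by simp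
    have "\<phi> u = chi s i u" if "u \<in> sgn_U s" for u using s that
    proof (induction rule: sgn_U_induct)
      case one
      then show ?case using \<open>\<phi> (mat 1) = 0\<close> by (simp add: chi_def mat_def)
    next
      case (step j a u)
      then show ?case using add[OF cl(2), of u j a] P
        by (simp add: chi_mult[OF s] unitri_sgn_el[OF s] un chi_sgn_el[OF s])
    qed
    then show "\<phi> = ?f" using P by (intro extensionalityI[of _ "sgn_U s"]) auto
  qed
  then show ?thesis using u by simp
qed

lemma e_star_eq: "u \<in> U_plus \<Longrightarrow> e_star i u = chi 1 i u"
  using the_additive_character[of 1 u i] unfolding sgn_U_eq sgn_el_eq e_star_def unit_sign_def
    by blast

lemma f_star_eq: "u \<in> U_minus \<Longrightarrow> f_star i u = chi (-1) i u"
  using the_additive_character[of "-1" u i] unfolding sgn_U_eq sgn_el_eq f_star_def unit_sign_def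
    by blast

subsection \<open>Monomial elements and the torus\<close>

text \<open>\<open>monomial w g\<close>: \<open>g\<close> represents \<open>w\<close> in the normaliser of the torus.\<close>

definition monomial :: "(int ^ 7 \<Rightarrow> int ^ 7) \<Rightarrow> e7_mat \<Rightarrow> bool" where
  "monomial w g \<longleftrightarrow> (\<exists>A. lift g A \<and> (\<forall>u\<in>wts. \<exists>c. c \<noteq> 0 \<and> A (delta u) = (\<lambda>v. c * delta (w u) v)))"

lemma monomial_G: "monomial w g \<Longrightarrow> g \<in> G_dual"
  by (auto simp: monomial_def G_dual_iff_lift)

lemma monomial_one: "monomial id (mat 1)"
  unfolding monomial_def using lift_one by (intro exI[of _ "\<lambda>f. f"]) (auto intro!: exI[of _ 1])

lemma monomial_mult:
  assumes "monomial w g" "monomial w' h" and w': "\<And>u. u \<in> wts \<Longrightarrow> w' u \<in> wts"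
  shows "monomial (\<lambda>u. w (w' u)) (g ** h)"
proof -
  obtain A where A: "lift g A" "\<And>u. u \<in> wts \<Longrightarrow> \<exists>c. c \<noteq> 0 \<and> A (delta u) = (\<lambda>v. c * delta (w u) v)"
    using assms(1) by (auto simp: monomial_def)
  obtain B where B: "lift h B" "\<And>u. u \<in> wts \<Longrightarrow> \<exists>c. c \<noteq> 0 \<and> B (delta u) = (\<lambda>v. c * delta (w' u) v)"
    using assms(2) by (auto simp: monomial_def)
  have "\<exists>c. c \<noteq> 0 \<and> A (B (delta u)) = (\<lambda>v. c * delta (w (w' u)) v)" if "u \<in> wts" for u
  proof -
    obtain c where c: "c \<noteq> 0" "B (delta u) = (\<lambda>v. c * delta (w' u) v)" using B(2)[OF \<open>u \<in> wts\<close>]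
      by auto
    obtain d where d: "d \<noteq> 0" "A (delta (w' u)) = (\<lambda>v. d * delta (w (w' u)) v)"
      using A(2)[OF w'[OF \<open>u \<in> wts\<close>]] by auto
    have "A (B (delta u)) = (\<lambda>v. c * d * delta (w (w' u)) v)"
      unfolding c(2) lift_scale[OF A(1)] d(2) by (simp add: mult.assoc)
    then show ?thesis using c d by (intro exI[of _ "c * d"]) simp
  qed
  then show ?thesis unfolding monomial_def using lift_mult[OF A(1) B(1)] by blast
qed

lemma monomial_word_mult:
  "monomial (weyl_word is) g \<Longrightarrow> monomial (weyl_word js) h \<Longrightarrow> monomial (weyl_word (is @ js)) (g ** h)"
  using monomial_mult[of "weyl_word is" g "weyl_word js" h] by (simp add: weyl_word_append comp_def)

lemma monomial_inv:
  assumes "monomial (weyl_word is) g" shows "monomial (weyl_word (rev is)) (matrix_inv g)"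
proof -
  obtain A where A: "lift g A"
    "\<And>u. u \<in> wts \<Longrightarrow> \<exists>c. c \<noteq> 0 \<and> A (delta u) = (\<lambda>v. c * delta (weyl_word is u) v)"
    using assms by (auto simp: monomial_def)
  obtain h B where B: "lift h B" "g ** h = mat 1" "h ** g = mat 1" "\<forall>f. A (B f) = f"
    "\<forall>f. B (A f) = f"
    using lift_inverse[OF A(1)] by auto
  have "\<exists>c. c \<noteq> 0 \<and> B (delta u) = (\<lambda>v. c * delta (weyl_word (rev is) u) v)" if "u \<in> wts" for u
  proof -
    have "weyl_word (rev is) u \<in> wts" using that by simp
    from A(2)[OF this] obtain c where c: "c \<noteq> 0"
      "A (delta (weyl_word (rev is) u)) = (\<lambda>v. c * delta u v)" by auto
    have "delta (weyl_word (rev is) u) = B (\<lambda>v. c * delta u v)" using c(2) B(5) by metis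
    also have "\<dots> = (\<lambda>v. c * B (delta u) v)" by (rule lift_scale[OF B(1)])
    finally have "\<forall>v. delta (weyl_word (rev is) u) v = c * B (delta u) v" by metis
    then have "B (delta u) = (\<lambda>v. (1 / c) * delta (weyl_word (rev is) u) v)"
      using c(1) by (intro ext) simp
    then show ?thesis using c(1) by (intro exI[of _ "1 / c"]) simp
  qed
  moreover have "matrix_inv g = h" by (rule matrix_inv_eqI[OF B(2,3)])
  ultimately show ?thesis using B(1) unfolding monomial_def by blast
qed

lemma mat_col: "(g *v axis j 1) $ k = (g :: e7_mat) $ k $ j"
proof -
  have "g $ k $ i * (axis j 1 :: e7_alg) $ i = (if i = j then g $ k $ i else 0)" for i
    by (simp add: axis_def)
  then show ?thesis by (simp add: matrix_vector_mult_def)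
qed

lemma rho_basis_delta_root:
  assumes u: "u \<in> wts" "ip u (root_vec b) = -2"
  shows "rho_basis (Inr b) (delta u) = (\<lambda>v. eta (root_vec b) u * delta (u + 2 *s root_vec b) v)"
proof
  fix v
  note w = wts_add[OF u(1) is_root_root_vec u(2)]
  show "rho_basis (Inr b) (delta u) v = eta (root_vec b) u * delta (u + 2 *s root_vec b) v"
  proof (cases "v = u + 2 *s root_vec b")
    case True
    then show ?thesis using w by (simp add: rho_root_def del: ip_bilinear)
  next
    case False
    then have "v - 2 *s root_vec b \<noteq> u" by (auto simp: diff_eq_eq)
    then show ?thesis using False by (simp add: rho_root_def)
  qed
qed

lemma rho_basis_delta:
  assumes u: "u \<in> wts"
  shows "\<exists>c. rho_basis j (delta u) = (\<lambda>v. c * delta (u + 2 *s wt j) v) \<and> (c \<noteq> 0 \<longrightarrow> u + 2 *s wt j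
    \<in> wts)"
proof (cases j)
  case (Inl i)
  then show ?thesis using u
    by (intro exI[of _ "of_int (ip u (simple_root i)) / 2"]) (auto simp: rho_h_def delta_def
      fun_eq_iff)
next
  case (Inr b)
  show ?thesis
  proof (cases "ip u (root_vec b) = -2")
    case True
    note w = wts_add[OF u is_root_root_vec True]
    have "rho_basis j (delta u) = (\<lambda>v. eta (root_vec b) u * delta (u + 2 *s wt j) v)"
      unfolding Inr wt_simps by (rule rho_basis_delta_root[OF u True])
    then show ?thesis using w Inr by (intro exI[of _ "eta (root_vec b) u"]) auto
  next
    case False
    have "rho_basis j (delta u) v = 0" for v
    proof (cases "v - 2 *s root_vec b = u \<and> v \<in> wts \<and> ip v (root_vec b) = 2")
      case True
      then have "ip u (root_vec b) = -2" using wts_diff(2)[of v "root_vec b"] by auto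
      then show ?thesis using False by simp
    qed (auto simp: rho_root_def Inr delta_def)
    then show ?thesis by (intro exI[of _ 0]) auto
  qed
qed

lemma rho_support:
  assumes X: "\<And>u v. u \<in> wts \<Longrightarrow> rho X (delta u) v \<noteq> 0 \<Longrightarrow> v = u + 2 *s c" and k: "X $ k \<noteq> 0"
  shows "wt k = c"
proof (cases k)
  case (Inr b)
  obtain u where u: "u \<in> wts" "ip u (root_vec b) = -2"
    by (rule root_below_some_wt[OF is_root_root_vec])
  have "rho X (delta u) (u + 2 *s root_vec b) \<noteq> 0"
    using rho_delta_shift[OF u(1) is_root_root_vec u(2), of X] k Inr by (simp add: root_vec_inverse)
  then have "u + 2 *s root_vec b = u + 2 *s c" by (rule X[OF u(1)])
  then show ?thesis by (simp add: Inr vec_eq_iff)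
next
  case (Inl i)
  show ?thesis
  proof (rule ccontr)
    assume nc: "wt k \<noteq> c"
    have "X $ Inl i = 0"
    proof (rule cartan_part_eq_0)
      fix u assume u: "u \<in> wts"
      have "rho X (delta u) u = 0" using X[OF u, of u] nc Inl by (auto simp: vec_eq_iff)
      then show "(\<Sum>i\<in>UNIV. X $ Inl i * (of_int (ip u (simple_root i)) / 2)) = 0"
        using rho_delta_same[OF u, of X] by simp
    qed
    then show False using k Inl by simp
  qed
qed

text \<open>Through a lift, the image of a basis element is an operator that shifts every minuscule
  weight by the same vector, namely twice the transformed root; \<open>rho_support\<close>
  recognises the root from that shift.\<close>

lemma monomial_support:
  assumes m: "monomial (weyl_word is) g" and k: "g $ k $ j \<noteq> 0"
  shows "wt k = weyl_word is (wt j)"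
proof -
  let ?w = "weyl_word is"
  obtain A where A: "lift g A"
    "\<And>u. u \<in> wts \<Longrightarrow> \<exists>c. c \<noteq> 0 \<and> A (delta u) = (\<lambda>v. c * delta (?w u) v)"
    using m by (auto simp: monomial_def)
  let ?X = "g *v axis j 1"
  have "v = u + 2 *s ?w (wt j)" if u: "u \<in> wts" and nz: "rho ?X (delta u) v \<noteq> 0" for u v
  proof -
    let ?u = "weyl_word (rev is) u"
    have u': "?u \<in> wts" using u by simp
    obtain c where c: "c \<noteq> 0" "A (delta ?u) = (\<lambda>v. c * delta u v)" using A(2)[OF u'] by auto
    obtain d where d: "rho_basis j (delta ?u) = (\<lambda>v. d * delta (?u + 2 *s wt j) v)"
      "d \<noteq> 0 \<longrightarrow> ?u + 2 *s wt j \<in> wts" using rho_basis_delta[OF u'] by blast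
    have "rho (axis j 1) (delta ?u) = (\<lambda>v. d * delta (?u + 2 *s wt j) v)" using d(1)
      by (intro ext) simp
    then have "(\<lambda>v. c * rho ?X (delta u) v) = (\<lambda>v. d * A (delta (?u + 2 *s wt j)) v)"
      using lift_rho[OF A(1), of "axis j 1" "delta ?u"] c(2) lift_scale[OF A(1)] rho_scale by metis
    then have e: "c * rho ?X (delta u) v = d * A (delta (?u + 2 *s wt j)) v" by meson
    then have "d \<noteq> 0" using nz c(1) by auto
    then obtain b where b: "A (delta (?u + 2 *s wt j)) = (\<lambda>v. b * delta (?w (?u + 2 *s wt j)) v)"
      using A(2) d(2) by blast
    have "delta (?w (?u + 2 *s wt j)) v \<noteq> 0" using e b nz c(1) by auto
    then have "v = ?w (?u + 2 *s wt j)" by (auto simp: delta_def split: if_splits)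
    then show ?thesis by simp
  qed
  then show ?thesis using rho_support[of ?X "?w (wt j)" k] k by (simp add: mat_col)
qed

lemma lift_row:
  assumes A: "lift g A" and m: "\<And>u. u \<in> wts \<Longrightarrow> A (delta u) = (\<lambda>v. c u * delta (weyl_word is u) v)"
    and v: "v \<in> wts"
  shows "A f (weyl_word is v) = c v * f v"
proof -
  have "A f (weyl_word is v) = (\<Sum>u\<in>wts. f u * A (delta u) (weyl_word is v))"
    by (rule lift_expand[OF A]) (use v in simp)
  also have "\<dots> = (\<Sum>u\<in>wts. if u = v then c v * f v else 0)"
  proof (rule sum.cong[OF HOL.refl])
    fix u assume u: "u \<in> wts"
    have "weyl_word is v = weyl_word is u \<longleftrightarrow> u = v" by (metis weyl_word_rev(1))
    then show "f u * A (delta u) (weyl_word is v) = (if u = v then c v * f v else 0)"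
      using m[OF u] by (auto simp: delta_def)
  qed
  finally show ?thesis using v by simp
qed

lemma prod_powi_add:
  "(\<And>i. c $ i \<noteq> (0 :: complex)) \<Longrightarrow> (\<Prod>i\<in>(UNIV :: 7 set). c $ i powi (v $ i + w $ i))
    = (\<Prod>i\<in>UNIV. c $ i powi (v $ i)) * (\<Prod>i\<in>UNIV. c $ i powi (w $ i))"
  by (simp add: power_int_add prod.distrib)

text \<open>A diagonal lift commutes with the Cartan operators and scales the root vector of
  \<open>b\<close> by the ratio of its eigenvalues at \<open>u + 2 *s root_vec b\<close> and
  \<open>u\<close>. These ratios are multiplicative in the root, hence given by the values at the
  simple roots.\<close>

lemma diagonal_imp_torus:
  assumes A: "lift g A" and d: "\<And>u. u \<in> wts \<Longrightarrow> d u \<noteq> 0 \<and> A (delta u) = (\<lambda>v. d u * delta u v)"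
  shows "\<exists>c. (\<forall>i. c $ i \<noteq> 0) \<and> g = torus_el c"
    "\<And>u i. u \<in> wts \<Longrightarrow> ip u (simple_root i) = -2 \<Longrightarrow>
      d (u + 2 *s simple_root i) = g $ Inr (Abs_root (simple_root i)) $ Inr (Abs_root (simple_root
        i)) * d u"
proof -
  have mono: "monomial (weyl_word []) g" unfolding monomial_def using A d by auto
  have off: "wt k = wt j" if "g $ k $ j \<noteq> 0" for k j
    using monomial_support[OF mono that] by simp
  have comm: "d u * rho (g *v axis j 1) (delta u) v = A (rho_basis j (delta u)) v" if u: "u \<in> wts"
    for j u v
  proof -
    have "rho (axis j 1) (delta u) = rho_basis j (delta u)" by (intro ext) simp
    then show ?thesis using lift_rho[OF A, of "axis j 1" "delta u"] d[OF u] by (simp add: rho_scale)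
  qed
  have h: "g *v axis (Inl i) 1 = axis (Inl i) 1" for i
  proof -
    let ?X = "g *v axis (Inl i) 1 - axis (Inl i) 1"
    have "rho ?X (delta u) v = 0" if u: "u \<in> wts" for u v
    proof -
      have e: "rho_basis (Inl i) (delta u) = (\<lambda>v. of_int (ip u (simple_root i)) / 2 * delta u v)"
        using u by (auto simp: rho_h_def delta_def)
      have "d u * rho (g *v axis (Inl i) 1) (delta u) v = of_int (ip u (simple_root i)) / 2 * (d u *
        delta u v)"
        unfolding comm[OF u] e lift_scale[OF A] using d[OF u] by simp
      then have "rho (g *v axis (Inl i) 1) (delta u) v = of_int (ip u (simple_root i)) / 2 * delta u
        v"
        using d[OF u] by (simp add: field_simps)
      then have "rho (g *v axis (Inl i) 1) (delta u) v = rho (axis (Inl i) 1) (delta u) v"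
        by (simp only: rho_axis e mult_1)
      then show ?thesis by (simp add: rho_linear)
    qed
    then have "?X = 0" by (rule rho_eq_0_imp)
    then show ?thesis by simp
  qed
  have E: "d (u + 2 *s root_vec b) = g $ Inr b $ Inr b * d u" if u: "u \<in> wts" and b:
    "ip u (root_vec b) = -2" for u b
  proof -
    note w = wts_add[OF u is_root_root_vec b]
    note rho_basis_delta_root[OF u b]
    then have "d u * rho (g *v axis (Inr b) 1) (delta u) (u + 2 *s root_vec b)
        = eta (root_vec b) u * d (u + 2 *s root_vec b)"
      using comm[OF u, of "Inr b" "u + 2 *s root_vec b"] lift_scale[OF A] d[OF w(1)] by simp
    then show ?thesis
      using rho_delta_shift[OF u is_root_root_vec b, of "g *v axis (Inr b) 1"]
      by (simp add: mat_col root_vec_inverse mult.commute)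
  qed
  let ?c = "(\<chi> i. g $ Inr (Abs_root (simple_root i)) $ Inr (Abs_root (simple_root i))) :: complex ^
    7"
  show step: "d (u + 2 *s simple_root i)
      = g $ Inr (Abs_root (simple_root i)) $ Inr (Abs_root (simple_root i)) * d u"
    if "u \<in> wts" "ip u (simple_root i) = -2" for u i
    using E[OF that(1), of "Abs_root (simple_root i)"] that by simp
  have c0: "?c $ i \<noteq> 0" for i
  proof -
    obtain u where u: "u \<in> wts" "ip u (simple_root i) = -2"
      by (rule root_below_some_wt[OF is_root_simple_root])
    show ?thesis using step[OF u] d[OF wts_add(1)[OF u(1) is_root_simple_root u(2)]] by auto
  qed
  \<comment> \<open>Each weight is raised by simple roots until it reaches \<open>omega2\<close>.
    The measure is the number of steps left, since coset coordinates are nonpositive.\<close>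
  have dd: "d u = d omega2 * (\<Prod>i\<in>UNIV. ?c $ i powi (coset_coord u $ i))" if "u \<in> wts" for u
    using that
  proof (induction "nat (- (\<Sum>i\<in>UNIV. coset_coord u $ i))" arbitrary: u rule: less_induct)
    case less
    show ?case
    proof (cases "u = omega2")
      case True
      then show ?thesis by (simp add: coset_coord_def)
    next
      case False
      obtain i where i: "ip u (simple_root i) = -2" by (rule ex_raising[OF less.prems False])
      note w = wts_add[OF less.prems is_root_simple_root i]
      let ?u = "u + 2 *s simple_root i"
      have s: "(\<Sum>j\<in>UNIV. coset_coord ?u $ j) = (\<Sum>j\<in>UNIV. coset_coord u $ j) + 1"
        unfolding w(3) by (simp add: sum.distrib simple_root_nth)
      have "(\<Sum>j\<in>UNIV. coset_coord ?u $ j) \<le> 0"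
        using coset_coord_nonpos[OF w(1)] by (intro sum_nonpos) (simp add: nonneg_def)
      then have "d ?u = d omega2 * (\<Prod>j\<in>UNIV. ?c $ j powi (coset_coord ?u $ j))"
        by (intro less.hyps w(1)) (simp add: s)
      also have "(\<Prod>j\<in>UNIV. ?c $ j powi (coset_coord ?u $ j))
        = (\<Prod>j\<in>UNIV. ?c $ j powi (coset_coord u $ j)) * (\<Prod>j\<in>UNIV. ?c $ j powi (simple_root i $ j))"
        unfolding w(3) vector_add_component by (rule prod_powi_add[OF c0])
      also have "(\<Prod>j\<in>UNIV. ?c $ j powi (simple_root i $ j)) = (\<Prod>j\<in>UNIV. if j
        = i then ?c $ i else 1)"
        by (rule prod.cong) (auto simp: simple_root_nth)
      also have "\<dots> = ?c $ i" by simp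
      finally have "?c $ i * d u = d omega2 * (\<Prod>j\<in>UNIV. ?c $ j powi (coset_coord u $ j)) * ?c $ i"
        using step[OF less.prems i] by (simp add: mult.assoc)
      then show ?thesis using c0[of i] by (simp add: mult.commute)
    qed
  qed
  have diag: "g $ Inr b $ Inr b = (\<Prod>i\<in>UNIV. ?c $ i powi (root_vec b $ i))" for b
  proof -
    obtain u where u: "u \<in> wts" "ip u (root_vec b) = -2"
      by (rule root_below_some_wt[OF is_root_root_vec])
    note w = wts_add[OF u(1) is_root_root_vec u(2)]
    have "g $ Inr b $ Inr b * d u = d omega2 * (\<Prod>i\<in>UNIV. ?c $ i powi (coset_coord (u + 2 *s root_vec
      b) $ i))"
      using E[OF u] dd[OF w(1)] by simp
    also have "\<dots> = d u * (\<Prod>i\<in>UNIV. ?c $ i powi (root_vec b $ i))"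
      unfolding w(3) vector_add_component prod_powi_add[OF c0] dd[OF u(1)] by simp
    finally show ?thesis using d[OF u(1)] by simp
  qed
  have "g $ k $ j = torus_el ?c $ k $ j" for k j
  proof (cases j)
    case (Inl i)
    have "g $ k $ j = axis (Inl i) 1 $ k" using mat_col[of g j k] h Inl by simp
    then show ?thesis using Inl by (auto simp: torus_el_def axis_def)
  next
    case (Inr b)
    show ?thesis
    proof (cases "k = j")
      case True
      have "torus_el ?c $ Inr b $ Inr b = (\<Prod>i\<in>UNIV. ?c $ i powi (root_vec b $ i))"
        by (simp add: torus_el_def)
      then show ?thesis using diag[of b] True Inr by metis
    next
      case False
      have "wt k \<noteq> wt j" using False Inr is_root_nonzero[OF is_root_root_vec[of b]] 
        by (cases k) (auto simp: root_vec_inj)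
      then have "g $ k $ j = 0" using off by blast
      then show ?thesis using False by (simp add: torus_el_def)
    qed
  qed
  then have "g = torus_el ?c" unfolding vec_eq_iff by blast
  with c0 show "\<exists>c. (\<forall>i. c $ i \<noteq> 0) \<and> g = torus_el c" by (intro exI[of _ ?c] conjI allI)
qed

lemma monomial_id_torus:
  assumes "monomial id t" shows "t \<in> T_dual"
proof -
  obtain A where A: "lift t A" "\<forall>u\<in>wts. \<exists>c. c \<noteq> 0 \<and> A (delta u) = (\<lambda>v. c * delta u v)"
    using assms by (auto simp: monomial_def)
  from bchoice[OF A(2)] obtain d where d: "\<forall>u\<in>wts. d u \<noteq> 0 \<and> A (delta u) = (\<lambda>v. d u * delta u v)" ..
  have "\<exists>c. (\<forall>i. c $ i \<noteq> 0) \<and> t = torus_el c"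
    by (rule diagonal_imp_torus(1)[OF A(1)]) (use d in blast)
  then show ?thesis using A(1) by (auto simp: T_dual_def G_dual_iff_lift)
qed

text \<open>Fixing the Cartan subalgebra pointwise means commuting with the weight decomposition.\<close>

lemma fix_cartan_imp_diagonal:
  assumes A: "lift g A" and h: "\<And>i. g *v axis (Inl i) 1 = axis (Inl i) 1" and u: "u \<in> wts"
  shows "\<exists>c. c \<noteq> 0 \<and> A (delta u) = (\<lambda>v. c * delta u v)"
proof -
  have e: "rho (axis (Inl i) 1) (delta u) = (\<lambda>v. of_int (ip u (simple_root i)) / 2 * delta u v)"
    for i
    using u by (auto simp: rho_h_def delta_def)
  have z: "A (delta u) v = 0" if "v \<noteq> u" for v
  proof (cases "v \<in> wts")
    case True
    have "of_int (ip u (simple_root i)) / 2 * A (delta u) v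
      = of_int (ip v (simple_root i)) / 2 * A (delta u) v" for i
      using lift_rho[OF A, of "axis (Inl i) 1" "delta u"] h[of i] True
      unfolding e lift_scale[OF A] by (auto simp: fun_eq_iff rho_h_def dest: spec[of _ v])
    then have "A (delta u) v = 0 \<or> (\<forall>i. ip u (simple_root i) = ip v (simple_root i))" by auto
    then show ?thesis using ip_simple_roots_eqI[of u v] that by blast
  next
    case False
    then show ?thesis using lift_outside[OF A False] u by (auto simp: delta_def)
  qed
  have eq: "A (delta u) = (\<lambda>v. A (delta u) u * delta u v)" using z by (auto simp: delta_def)
  have "A (delta u) u \<noteq> 0"
  proof
    assume "A (delta u) u = 0"
    then have "A (delta u) = (\<lambda>v. 0)" using eq by (auto simp: fun_eq_iff)
    then have "A (delta u) = A (\<lambda>v. 0)" using lift_zero[OF A] by simp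
    then have "delta u = (\<lambda>v. 0)" using lift_inverse[OF A] by metis
    then have "delta u u = 0" by metis
    then show False by simp
  qed
  then show ?thesis using eq by blast
qed

lemma fix_cartan_imp_torus:
  assumes "g \<in> G_dual" and h: "\<And>i. g *v axis (Inl i) 1 = axis (Inl i) 1"
  shows "monomial id g"
proof -
  obtain A where A: "lift g A" using assms(1) by (auto simp: G_dual_iff_lift)
  show ?thesis unfolding monomial_def id_apply
    by (intro exI[of _ A] conjI ballI A fix_cartan_imp_diagonal[OF A h])
qed

lemma torus_el_fix: "torus_el c *v axis (Inl i) 1 = axis (Inl i) 1"
  unfolding vec_eq_iff mat_col by (auto simp: torus_el_def axis_def)

lemma torus_monomial: "t \<in> T_dual \<longleftrightarrow> monomial id t"
proof
  assume "t \<in> T_dual"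
  then obtain c where "t \<in> G_dual" "t = torus_el c" by (auto simp: T_dual_def)
  then show "monomial id t" by (metis fix_cartan_imp_torus torus_el_fix)
qed (rule monomial_id_torus)

lemma simple_root_char_eq:
  assumes "t \<in> T_dual"
  shows "simple_root_char i t = t $ Inr (Abs_root (simple_root i)) $ Inr (Abs_root (simple_root i))"
proof -
  let ?k = "Inr (Abs_root (simple_root i)) :: e7_idx"
  obtain c where t: "t = torus_el c" using assms by (auto simp: T_dual_def)
  have "t *v chev_e i = t $ ?k $ ?k *s chev_e i"
    unfolding chev_e_def vec_eq_iff mat_col by (auto simp: t torus_el_def axis_def)
  moreover have "chev_e i $ ?k = 1" by (simp add: chev_e_def axis_def)
  ultimately show ?thesis unfolding simple_root_char_def
    by (intro the_equality) (assumption, metis mult.right_neutral vector_smult_component)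
qed

lemma torus_rows:
  assumes t: "t \<in> T_dual"
  obtains A d where "lift t A" "\<And>v. d v \<noteq> 0" "\<And>f v. A f v = d v * f v"
    "\<And>u i. u \<in> wts \<Longrightarrow> ip u (simple_root i) = -2 \<Longrightarrow> d (u + 2 *s simple_root i)
      = simple_root_char i t * d u"
proof -
  obtain A where A: "lift t A" "\<forall>u\<in>wts. \<exists>c. c \<noteq> 0 \<and> A (delta u) = (\<lambda>v. c * delta u v)"
    using t unfolding torus_monomial by (auto simp: monomial_def)
  from bchoice[OF A(2)] obtain d where d: "\<forall>u\<in>wts. d u \<noteq> 0 \<and> A (delta u) = (\<lambda>v. d u * delta u v)" ..
  \<comment> \<open>Lifts are the identity off \<open>wts\<close>; the value 1 there makes
    \<open>A\<close> diagonal on all functions.\<close>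
  let ?d = "\<lambda>v. if v \<in> wts then d v else 1"
  show thesis
  proof (rule that[OF A(1), of ?d])
    show "?d v \<noteq> 0" for v using d by auto
    show "A f v = ?d v * f v" for f v
      using lift_row[OF A(1), of d "[]" v f] d lift_outside[OF A(1)] by auto
    show "?d (u + 2 *s simple_root i) = simple_root_char i t * ?d u"
      if u: "u \<in> wts" "ip u (simple_root i) = -2" for u i
      using diagonal_imp_torus(2)[OF A(1), of d u i] d u wts_add(1)[OF u(1) is_root_simple_root
        u(2)]
      by (simp add: simple_root_char_eq[OF t])
  qed
qed

lemma torus_x_el: assumes t: "t \<in> T_dual" shows
  "t ** x_el i a = x_el i (simple_root_char i t * a) ** t"
proof -
  obtain A d where A: "lift t A" "\<And>v. d v \<noteq> 0" "\<And>f v. A f v = d v * f v"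
    "\<And>u i. u \<in> wts \<Longrightarrow> ip u (simple_root i) = -2 \<Longrightarrow> d (u + 2 *s simple_root i)
      = simple_root_char i t * d u"
    by (rule torus_rows[OF t]) blast
  have d: "d v = simple_root_char i t * d (v - 2 *s simple_root i)" if "v \<in> wts"
    "ip v (simple_root i) = 2" for v
    using A(4)[OF wts_diff(1,2)[OF that(1) is_root_simple_root that(2)]] by simp
  have "A (X_op i a f) v = X_op i (simple_root_char i t * a) (A f) v" for f v
    using d[of v] by (simp add: A(3) X_op_def raise_op_def algebra_simps)
  then have "(\<lambda>f. A (X_op i a f)) = (\<lambda>f. X_op i (simple_root_char i t * a) (A f))" by blast
  then show ?thesis using lift_mult[OF A(1) lift_x_el] lift_mult[OF lift_x_el A(1)] lift_unique
    by metis
qed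

lemma T_dual_closed:
  "mat 1 \<in> T_dual" "t \<in> T_dual \<Longrightarrow> t' \<in> T_dual \<Longrightarrow> t ** t' \<in> T_dual"
  "t \<in> T_dual \<Longrightarrow> matrix_inv t \<in> T_dual" "t \<in> T_dual \<Longrightarrow> invertible t" "t \<in> T_dual \<Longrightarrow> t \<in> G_dual"
  using monomial_one monomial_word_mult[of "[]" t "[]" t'] monomial_inv[of "[]" t] G_dual_closed(4)
    monomial_G[of id t]
  by (simp_all add: torus_monomial weyl_word_Nil)

lemma torus_U_plus:
  assumes t: "t \<in> T_dual" shows "u \<in> U_plus \<Longrightarrow> \<exists>u'\<in>U_plus. t ** u = u' ** t"
proof (induction rule: U_plus_induct)
  case one
  show ?case using U_plus_closed(1) by (intro bexI[of _ "mat 1"]) auto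
next
  case (step i a u)
  then obtain u' where u': "u' \<in> U_plus" "t ** u = u' ** t" by auto
  have "t ** (x_el i a ** u) = x_el i (simple_root_char i t * a) ** (t ** u)"
    by (simp add: matrix_mul_assoc torus_x_el[OF t])
  also have "\<dots> = (x_el i (simple_root_char i t * a) ** u') ** t" by (simp add: u' matrix_mul_assoc)
  finally show ?case using U_plus_closed u' by blast
qed

lemma mat_cancel:
  assumes "invertible (g :: 'a :: comm_ring_1 ^ 'n ^ 'n)"
  shows "matrix_inv g ** (g ** h) = h" "g ** (matrix_inv g ** h) = h"
    "h ** g ** matrix_inv g = h" "h ** matrix_inv g ** g = h"
  using matrix_inv_inverse[OF assms] by (simp_all add: matrix_mul_assoc) (simp_all add:
    matrix_mul_assoc[symmetric])

lemma U_plus_torus: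
  assumes t: "t \<in> T_dual" and u: "u \<in> U_plus" shows "\<exists>u'\<in>U_plus. u ** t = t ** u'"
proof -
  obtain u' where u': "u' \<in> U_plus" "matrix_inv t ** u = u' ** matrix_inv t"
    using torus_U_plus[OF T_dual_closed(3)[OF t] u] by auto
  note it = T_dual_closed(4)[OF t]
  have "u ** t = t ** (matrix_inv t ** u) ** t" using mat_cancel[OF it] by metis
  also have "\<dots> = t ** u'" unfolding u' using mat_cancel(4)[OF it, of "t ** u'"]
    by (simp add: matrix_mul_assoc)
  finally show ?thesis using u' by blast
qed

lemma monomial_torus_conj:
  assumes w: "monomial (weyl_word is) g" "monomial (weyl_word is) h" shows
    "g ** matrix_inv h \<in> T_dual"
  using monomial_word_mult[OF w(1) monomial_inv[OF w(2)]]
  by (simp add: torus_monomial weyl_word_append weyl_word_rev_comp)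

lemma T_dual_nth: "t \<in> T_dual \<Longrightarrow> k \<noteq> j \<Longrightarrow> t $ k $ j = 0" "t \<in> T_dual \<Longrightarrow> t $ Inl i $ Inl i = 1"
  by (auto simp: T_dual_def torus_el_def)

lemma B_plus_iff: "b \<in> B_plus \<longleftrightarrow> (\<exists>t\<in>T_dual. \<exists>u\<in>U_plus. b = t ** u)"
  by (auto simp: B_plus_def set_mult_def)

lemma B_minus_iff: "b \<in> B_minus \<longleftrightarrow> (\<exists>t\<in>T_dual. \<exists>u\<in>U_minus. b = t ** u)"
  by (auto simp: B_minus_def set_mult_def)

subsection \<open>Representatives of simple reflections\<close>

text \<open>The monomial representative of \<open>s_i\<close> in the \<open>SL_2\<close> of node
  \<open>i\<close>, with parameter \<open>a\<close>. Solved for \<open>y_el i a\<close>, the formula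
  puts this element into the Bruhat cell of \<open>s_i\<close>.\<close>

definition n_el :: "7 \<Rightarrow> complex \<Rightarrow> e7_mat" where
  "n_el i a = x_el i (- 1 / a) ** y_el i a ** x_el i (- 1 / a)"

definition n_op :: "7 \<Rightarrow> complex \<Rightarrow> wfun \<Rightarrow> wfun" where
  "n_op i a f v = (if v \<in> wts \<and> ip v (simple_root i) = 2 then - f (v - 2 *s simple_root i) / a
     else if v \<in> wts \<and> ip v (simple_root i) = -2 then a * f (v + 2 *s simple_root i) else f v)"

lemma s_bar_n_el: "s_bar i = n_el i 1"
  by (simp add: s_bar_def n_el_def)

lemma lift_n_el: assumes a: "a \<noteq> 0" shows "lift (n_el i a) (n_op i a)"
proof -
  have "X_op i (- 1 / a) (Y_op i a (X_op i (- 1 / a) f)) v = n_op i a f v" for f v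
  proof (cases "v \<in> wts")
    case True
    then show ?thesis using a ip_wts_root[OF True is_root_simple_root, of i]
        wts_diff(1)[OF True is_root_simple_root, of i] wts_add(1)[OF True is_root_simple_root, of i]
      by (auto simp: X_op_def Y_op_def n_op_def raise_op_def lower_op_def field_simps)
  qed (simp add: X_op_def Y_op_def n_op_def raise_op_def lower_op_def)
  then have "(\<lambda>f. X_op i (- 1 / a) (Y_op i a (X_op i (- 1 / a) f))) = n_op i a" by blast
  then show ?thesis unfolding n_el_def
    using lift_mult[OF lift_mult[OF lift_x_el lift_y_el] lift_x_el, of i "- 1 / a" i a i "- 1 / a"]
      by simp
qed

lemma monomial_n_el: assumes a: "a \<noteq> 0" shows "monomial (refl i) (n_el i a)"
  unfolding monomial_def
proof (rule exI[of _ "n_op i a"], intro conjI ballI)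
  show "lift (n_el i a) (n_op i a)" by (rule lift_n_el[OF a])
  fix u assume u: "u \<in> wts"
  let ?a = "simple_root i"
  let ?c = "if ip u ?a = 2 then a else if ip u ?a = -2 then - 1 / a else 1"
  have "n_op i a (delta u) v = ?c * delta (refl i u) v" for v
  proof (cases "v \<in> wts")
    case v: True
    have r: "refl i u = u - ip u ?a *s ?a" by (simp add: refl_def)
    have 1: "delta u (v - 2 *s ?a) = delta (u + 2 *s ?a) v"
      "delta u (v + 2 *s ?a) = delta (u - 2 *s ?a) v"
      by (simp_all add: delta_def diff_eq_eq eq_diff_eq)
    have 2: "ip v ?a \<noteq> ip u ?a + 4 \<Longrightarrow> delta (u + 2 *s ?a) v = 0"
      "ip v ?a \<noteq> ip u ?a - 4 \<Longrightarrow> delta (u - 2 *s ?a) v = 0"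
      "ip v ?a \<noteq> ip u ?a \<Longrightarrow> delta u v = 0"
      by (auto simp: delta_def)
    have e: "u - - 2 *s ?a = u + 2 *s ?a" "u - 0 *s ?a = u" by (simp_all add: vec_eq_iff)
    have n: "n_op i a (delta u) v = (if ip v ?a = 2 then - delta (u + 2 *s ?a) v / a
      else if ip v ?a = - 2 then a * delta (u - 2 *s ?a) v else delta u v)"
      unfolding n_op_def 1 using v by simp
    show ?thesis unfolding n r
      using ip_wts_root[OF u is_root_simple_root, of i] ip_wts_root[OF v is_root_simple_root, of i]
        2
      by (elim disjE) (simp_all add: e)
  next
    case False
    then show ?thesis using u by (auto simp: n_op_def delta_def)
  qed
  then have "n_op i a (delta u) = (\<lambda>v. ?c * delta (refl i u) v)" by blast
  then show "\<exists>c. c \<noteq> 0 \<and> n_op i a (delta u) = (\<lambda>v. c * delta (refl i u) v)"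
    using a by (intro exI[of _ ?c]) auto
qed

lemma mat_prod_simps [simp]: "mat_prod [] = mat 1" "mat_prod (g # gs) = g ** mat_prod gs"
  by (simp_all add: mat_prod_def)

lemma mat_prod_append: "mat_prod (gs @ hs) = mat_prod gs ** mat_prod hs"
  by (induction gs) (simp_all add: matrix_mul_assoc)

lemma monomial_word: "monomial (weyl_word is) (mat_prod (map s_bar is))"
proof (induction "is")
  case (Cons i "is")
  have "monomial (weyl_word [i]) (s_bar i)"
    unfolding s_bar_n_el weyl_word_Cons weyl_word_Nil comp_id by (rule monomial_n_el) simp
  from monomial_word_mult[OF this Cons] show ?case
    by (simp only: append_Cons append_Nil list.map mat_prod_simps)
next
  case Nil
  show ?case by (simp only: weyl_word_Nil list.map mat_prod_simps monomial_one)
qed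

lemma w_bar_word:
  assumes "w \<in> weyl_group"
  obtains "is" where "reduced_expr is w" "w_bar w = mat_prod (map s_bar is)" "w = weyl_word is"
proof -
  obtain js where "reduced_expr js w" using ex_reduced[OF assms] by blast
  then have "reduced_expr (SOME is. reduced_expr is w) w" by (rule someI)
  then show thesis using that[of "SOME is. reduced_expr is w"]
    by (auto simp: w_bar_def reduced_expr_def)
qed

lemma monomial_w_bar: "w \<in> weyl_group \<Longrightarrow> monomial w (w_bar w)"
  by (metis w_bar_word monomial_word)

subsection \<open>Bruhat cells\<close>

lemma cartan_cases: "i \<noteq> j \<Longrightarrow> cartan i j = 0 \<or> cartan i j = -1"
  by (simp add: cartan_def)

lemma cartan_sym: "cartan i j = cartan j i"
  by (auto simp: cartan_def)

lemma wts_diff_simple: "v \<in> wts \<Longrightarrow> ip v (simple_root i) = 2 \<Longrightarrow> v - 2 *s simple_root i \<in> wts"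
  and wts_add_simple: "v \<in> wts \<Longrightarrow> ip v (simple_root i) = -2 \<Longrightarrow> v + 2 *s simple_root i \<in> wts"
  by (simp_all add: wts_diff wts_add)

lemma conj_reflection_commuting:
  assumes "i \<noteq> j" "cartan i j = 0"
  shows "n_op i 1 (X_op i c (X_op j a (X_op i (- c) f))) v = X_op j a (n_op i 1 f) v"
proof (cases "v \<in> wts")
  case True
  have c: "ip (simple_root i) (simple_root j) = 0" "ip (simple_root j) (simple_root i) = 0"
    using assms(2) by (simp_all add: ip_simple_root cartan_sym[of j i])
  have com: "v - 2 *s simple_root i - 2 *s simple_root j
    = v - 2 *s simple_root j - 2 *s simple_root i"
    "v + 2 *s simple_root i - 2 *s simple_root j = v - 2 *s simple_root j + 2 *s simple_root i"
    by (simp_all add: algebra_simps)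
  show ?thesis
    using ip_wts_root[OF True is_root_simple_root, of i] ip_wts_root[OF True is_root_simple_root, of
      j] True
    by (elim disjE) (simp_all add: n_op_def X_op_def raise_op_def wts_diff_simple wts_add_simple c
      com
        right_diff_distrib distrib_left mult.left_commute)
next
  case False
  then show ?thesis by (simp add: n_op_def X_op_def raise_op_def)
qed

context
  fixes i j :: 7
  assumes ij: "cartan i j = -1"
begin

lemma adj_ip: "ip (simple_root i) (simple_root j) = -1" "ip (simple_root j) (simple_root i) = -1"
  using ij by (simp_all add: ip_simple_root cartan_sym[of j i])

lemma adj_ip_sum:
  assumes "v \<in> wts"
  shows "ip v (simple_root i) + ip v (simple_root j) \<le> 2"
    "- 2 \<le> ip v (simple_root i) + ip v (simple_root j)"
proof -
  have "is_root (simple_root i + simple_root j)" using adj_ip by (simp add: root_add_iff)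
  from ip_wts_root[OF assms this]
  show "ip v (simple_root i) + ip v (simple_root j) \<le> 2"
    "- 2 \<le> ip v (simple_root i) + ip v (simple_root j)" by auto
qed

lemma adj_wts:
  assumes "v \<in> wts" "ip v (simple_root i) = 0" "ip v (simple_root j) = 2"
  shows "v - 2 *s simple_root i - 2 *s simple_root j \<in> wts"
proof -
  have "v - 2 *s simple_root j \<in> wts" by (rule wts_diff_simple) (use assms in auto)
  then have "v - 2 *s simple_root j - 2 *s simple_root i \<in> wts"
    by (rule wts_diff_simple) (use assms adj_ip in simp)
  then show ?thesis by (simp add: algebra_simps)
qed

lemma adj_shift:
  "v - 2 *s simple_root j - 2 *s simple_root i = v - 2 *s simple_root i - 2 *s simple_root j"
  "v + 2 *s simple_root i - 2 *s simple_root j = v - 2 *s simple_root j + 2 *s simple_root i"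
  "v - 2 *s simple_root i - 2 *s simple_root j + 2 *s simple_root i = v - 2 *s simple_root j"
  by (simp_all add: algebra_simps)

text \<open>The conjugate on the left is a product from the root groups of \<alpha>_j and \<alpha>_i
  + \<alpha>_j, which \<open>s_i\<close> exchanges. The result is again a conjugate of
  \<open>x_j\<close> under \<open>x_i\<close>, with parameters \<open>a * c\<close> and
  \<open>- 1 / c\<close>.\<close>

lemma conj_reflection_adjacent:
  assumes "c \<noteq> 0"
  shows "n_op i 1 (X_op i c (X_op j a (X_op i (- c) f))) v
    = X_op i (- 1 / c) (X_op j (a * c) (X_op i (1 / c) (n_op i 1 f))) v"
proof (cases "v \<in> wts")
  case True
  show ?thesis
    using ip_wts_root[OF True is_root_simple_root, of i] ip_wts_root[OF True is_root_simple_root, of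
      j] True
      adj_ip_sum[OF True] assms
    by (elim disjE) (simp_all add: n_op_def X_op_def raise_op_def wts_diff_simple wts_add_simple
      adj_ip adj_shift
        adj_wts divide_simps, simp_all add: algebra_simps)
next
  case False
  then show ?thesis by (simp add: n_op_def X_op_def raise_op_def)
qed

text \<open>The degenerate case \<open>c = 0\<close>: the image lies in the root group of \<alpha>_i
  + \<alpha>_j, which the generators reach as a commutator.\<close>

lemma conj_reflection_adjacent0:
  "n_op i 1 (X_op j a f) v = X_op i (- a) (X_op j 1 (X_op i a (X_op j (- 1) (n_op i 1 f)))) v"
proof (cases "v \<in> wts")
  case True
  show ?thesis
    using ip_wts_root[OF True is_root_simple_root, of i] ip_wts_root[OF True is_root_simple_root, of
      j] True
      adj_ip_sum[OF True]
    by (elim disjE) (simp_all add: n_op_def X_op_def raise_op_def wts_diff_simple wts_add_simple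
      adj_ip adj_shift
        adj_wts right_diff_distrib distrib_left)
next
  case False
  then show ?thesis by (simp add: n_op_def X_op_def raise_op_def)
qed

end

lemma matrix_inv_mult:
  fixes A B :: "'a :: semiring_1 ^ 'n ^ 'n"
  assumes A: "invertible A" and B: "invertible B"
  shows "matrix_inv (A ** B) = matrix_inv B ** matrix_inv A"
proof (rule matrix_inv_eqI)
  have "A ** B ** (matrix_inv B ** matrix_inv A) = A ** (B ** matrix_inv B) ** matrix_inv A"
    "matrix_inv B ** matrix_inv A ** (A ** B) = matrix_inv B ** (matrix_inv A ** A) ** B"
    by (simp_all only: matrix_mul_assoc)
  then show "A ** B ** (matrix_inv B ** matrix_inv A) = mat 1"
    "matrix_inv B ** matrix_inv A ** (A ** B) = mat 1"
    by (simp_all add: matrix_inv_inverse[OF A] matrix_inv_inverse[OF B])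
qed

lemma lift_s_bar: "lift (s_bar i) (n_op i 1)"
  unfolding s_bar_n_el by (rule lift_n_el) simp

lemma invertible_s_bar [simp]: "invertible (s_bar i)"
  using lift_matrix_inv(3)[OF lift_s_bar] .

lemma U_plus_s_bar_generator:
  assumes "i \<noteq> j"
  shows "\<exists>u\<in>U_plus. s_bar i ** (x_el i c ** (x_el j a ** x_el i (- c))) = u ** s_bar i"
proof -
  have L: "lift (s_bar i ** (x_el i c ** (x_el j a ** x_el i (- c)))) (\<lambda>f. n_op i 1 (X_op i c (X_op
    j a (X_op i (- c) f))))"
    by (intro lift_mult lift_s_bar lift_x_el)
  consider "cartan i j = 0" | "cartan i j = -1" "c \<noteq> 0" | "cartan i j = -1" "c = 0"
    using cartan_cases[OF assms] by blast
  then show ?thesis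
  proof cases
    case 1
    have "lift (x_el j a ** s_bar i) (\<lambda>f. X_op j a (n_op i 1 f))"
      by (intro lift_mult lift_s_bar lift_x_el)
    then have "s_bar i ** (x_el i c ** (x_el j a ** x_el i (- c))) = x_el j a ** s_bar i"
      using L conj_reflection_commuting[OF assms 1] lift_unique by presburger
    then show ?thesis using U_plus_closed(2) by blast
  next
    case 2
    have "lift (x_el i (- 1 / c) ** (x_el j (a * c) ** (x_el i (1 / c) ** s_bar i)))
      (\<lambda>f. X_op i (- 1 / c) (X_op j (a * c) (X_op i (1 / c) (n_op i 1 f))))"
      by (intro lift_mult lift_s_bar lift_x_el)
    moreover have "(\<lambda>f. n_op i 1 (X_op i c (X_op j a (X_op i (- c) f))))
      = (\<lambda>f. X_op i (- 1 / c) (X_op j (a * c) (X_op i (1 / c) (n_op i 1 f))))"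
      using conj_reflection_adjacent[OF 2] by (intro ext)
    ultimately have "s_bar i ** (x_el i c ** (x_el j a ** x_el i (- c)))
      = x_el i (- 1 / c) ** (x_el j (a * c) ** (x_el i (1 / c) ** s_bar i))"
      using L lift_unique by metis
    also have "\<dots> = (x_el i (- 1 / c) ** (x_el j (a * c) ** x_el i (1 / c))) ** s_bar i"
      by (simp only: matrix_mul_assoc)
    finally show ?thesis using U_plus_closed(2,3) by blast
  next
    case 3
    have "lift (x_el i (- a) ** (x_el j 1 ** (x_el i a ** (x_el j (- 1) ** s_bar i))))
      (\<lambda>f. X_op i (- a) (X_op j 1 (X_op i a (X_op j (- 1) (n_op i 1 f)))))"
      by (intro lift_mult lift_s_bar lift_x_el)
    moreover have "(\<lambda>f. n_op i 1 (X_op i c (X_op j a (X_op i (- c) f))))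
      = (\<lambda>f. X_op i (- a) (X_op j 1 (X_op i a (X_op j (- 1) (n_op i 1 f)))))"
      unfolding 3(2) using conj_reflection_adjacent0[OF 3(1)] by (intro ext) simp
    ultimately have "s_bar i ** (x_el i c ** (x_el j a ** x_el i (- c)))
      = x_el i (- a) ** (x_el j 1 ** (x_el i a ** (x_el j (- 1) ** s_bar i)))"
      using L lift_unique by metis
    also have "\<dots> = (x_el i (- a) ** (x_el j 1 ** (x_el i a ** x_el j (- 1)))) ** s_bar i"
      by (simp only: matrix_mul_assoc)
    finally show ?thesis using U_plus_closed(2,3) by blast
  qed
qed

lemma chi_plus_mult: "u \<in> U_plus \<Longrightarrow> v \<in> U_plus \<Longrightarrow> chi 1 i (u ** v) = chi 1 i u + chi 1 i v"
  using chi_mult[of 1 u v i] unitri_sgn_U[of 1] unfolding sgn_U_eq by (simp add: unit_sign_def)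

lemma chi_plus_x_el: "chi 1 i (x_el j a) = (if i = j then a else 0)"
  using chi_sgn_el[of 1 i j a] by (simp add: unit_sign_def sgn_el_eq)

text \<open>The kernel of \<open>e\<^sub>i\<^sup>*\<close> is generated by the conjugates of the \<open>x\<^sub>j\<close>, \<open>j \<noteq> i\<close>, under \<open>x\<^sub>i\<close>.\<close>

lemma s_bar_conj_aux:
  "u \<in> U_plus \<Longrightarrow> \<exists>v\<in>U_plus. s_bar i ** (x_el i c ** (u ** x_el i (- chi 1 i u - c))) = v ** s_bar i"
proof (induction arbitrary: c rule: U_plus_induct)
  case one
  have "chi 1 i (mat 1) = 0" by (simp add: chi_def mat_def)
  then have "x_el i c ** (mat 1 ** x_el i (- chi 1 i (mat 1) - c)) = mat 1" by (simp add: x_el_add)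
  then show ?case using U_plus_closed(1) by (intro bexI[of _ "mat 1"]) simp_all
next
  case (step j a u)
  have chi: "chi 1 i (x_el j a ** u) = (if i = j then a else 0) + chi 1 i u"
    using step.hyps U_plus_closed(2) by (simp add: chi_plus_mult chi_plus_x_el)
  show ?case
  proof (cases "i = j")
    case True
    have e: "- chi 1 i (x_el j a ** u) - c = - chi 1 i u - (c + a)" unfolding chi using True by simp
    have "x_el i c ** (x_el j a ** u ** x_el i (- chi 1 i (x_el j a ** u) - c))
      = (x_el i c ** x_el i a) ** (u ** x_el i (- chi 1 i u - (c + a)))"
      unfolding e by (simp only: True matrix_mul_assoc)
    then show ?thesis using step.IH[of "c + a"] by (simp add: x_el_add)
  next
    case False
    have e: "- chi 1 i (x_el j a ** u) - c = - chi 1 i u - c" using chi False by simp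
    \<comment> \<open>Inserting \<open>x_i(-c) x_i(c)\<close> splits off one conjugate generator and
      leaves the tail with the same \<open>c\<close>.\<close>
    have "x_el i c ** (x_el j a ** u ** x_el i (- chi 1 i u - c))
      = x_el i c ** (x_el j a ** (x_el i (- c) ** x_el i c) ** (u ** x_el i (- chi 1 i u - c)))"
      by (simp add: x_el_add matrix_mul_assoc)
    also have "\<dots> = (x_el i c ** (x_el j a ** x_el i (- c))) ** (x_el i c ** (u ** x_el i (- chi 1 i
      u - c)))"
      by (simp only: matrix_mul_assoc)
    finally have f: "s_bar i ** (x_el i c ** (x_el j a ** u ** x_el i (- chi 1 i u - c)))
      = (s_bar i ** (x_el i c ** (x_el j a ** x_el i (- c)))) ** (x_el i c ** (u ** x_el i (- chi 1
        i u - c)))"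
      by (simp only: matrix_mul_assoc)
    obtain v1 where v1: "v1 \<in> U_plus" "s_bar i ** (x_el i c ** (x_el j a ** x_el i (- c)))
      = v1 ** s_bar i"
      using U_plus_s_bar_generator[OF False] by blast
    obtain v2 where v2: "v2 \<in> U_plus" "s_bar i ** (x_el i c ** (u ** x_el i (- chi 1 i u - c)))
      = v2 ** s_bar i"
      using step.IH by blast
    have "s_bar i ** (x_el i c ** (x_el j a ** u ** x_el i (- chi 1 i u - c)))
        = v1 ** (s_bar i ** (x_el i c ** (u ** x_el i (- chi 1 i u - c))))"
      unfolding f v1(2) by (simp only: matrix_mul_assoc)
    also have "\<dots> = v1 ** v2 ** s_bar i" unfolding v2(2) by (simp only: matrix_mul_assoc)
    finally have "s_bar i ** (x_el i c ** (x_el j a ** u ** x_el i (- chi 1 i (x_el j a ** u) - c)))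
      = v1 ** v2 ** s_bar i"
      unfolding e .
    then show ?thesis using U_plus_closed(3)[OF v1(1) v2(1)] by blast
  qed
qed

lemma s_bar_conj_left:
  assumes "u \<in> U_plus" "chi 1 i u = 0" shows "\<exists>v\<in>U_plus. s_bar i ** u = v ** s_bar i"
  using s_bar_conj_aux[OF assms(1), of i 0] assms(2) by simp

lemma s_bar_square_torus: "s_bar i ** s_bar i \<in> T_dual"
proof -
  have "monomial (weyl_word [i]) (s_bar i)" using monomial_word[of "[i]"] by simp
  from monomial_word_mult[OF this this] have
    "monomial (weyl_word ([i] @ [i])) (s_bar i ** s_bar i)" .
  moreover have "weyl_word ([i] @ [i]) = id" by (rule ext) simp
  ultimately show ?thesis by (metis torus_monomial)
qed

text \<open>The square of \<open>s_bar i\<close> lies in the torus, which normalises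
  \<open>U_plus\<close>; this converts passage in one direction into passage in the other.\<close>

lemma s_bar_conj_right:
  assumes u: "u \<in> U_plus" "chi 1 i u = 0" shows "\<exists>v\<in>U_plus. u ** s_bar i = s_bar i ** v"
proof -
  let ?t = "s_bar i ** s_bar i"
  obtain v where v: "v \<in> U_plus" "s_bar i ** u = v ** s_bar i" using s_bar_conj_left[OF u] by blast
  obtain v' where v': "v' \<in> U_plus" "v ** ?t = ?t ** v'"
    using U_plus_torus[OF s_bar_square_torus v(1)] by blast
  have "s_bar i ** (u ** s_bar i) = (s_bar i ** u) ** s_bar i" by (simp only: matrix_mul_assoc)
  also have "\<dots> = v ** ?t" unfolding v(2) by (simp only: matrix_mul_assoc)
  also have "\<dots> = s_bar i ** (s_bar i ** v')" unfolding v'(2) by (simp only: matrix_mul_assoc)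
  finally have "s_bar i ** (u ** s_bar i) = s_bar i ** (s_bar i ** v')" .
  from arg_cong[OF this, of "\<lambda>g. matrix_inv (s_bar i) ** g"] have "u ** s_bar i = s_bar i ** v'"
    by (simp only: mat_cancel(1)[OF invertible_s_bar])
  then show ?thesis using v'(1) by blast
qed

section \<open>Products of lower unipotents and Bruhat cells\<close>

lemma ascending_tl: assumes "ascending (j # is)" shows "ascending is"
proof -
  obtain js where js: "reduced_expr js (weyl_word is)" using ex_reduced[OF parabolic_word[of
    "is" UNIV]] by auto
  have "reduced_expr (j # is) (weyl_word (j # is))" using assms reduced_iff_ascending by blast
  then have "Suc (length is) = len (weyl_word (j # is))" by (simp add: reduced_expr_def)
  also have "weyl_word (j # is) = weyl_word (j # js)"
    using js unfolding weyl_word_Cons reduced_expr_def by metis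
  also have "len (weyl_word (j # js)) \<le> Suc (length js)" using len_le[of "j # js"] by simp
  finally have "length is \<le> length js" by simp
  then have "reduced_expr is (weyl_word is)" using js len_le[of "is"] unfolding reduced_expr_def
    by auto
  then show ?thesis using reduced_iff_ascending by blast
qed

lemma root_multiple:
  assumes "is_root c" "nonneg c" "m *s c = simple_root j" shows "c = simple_root j"
proof -
  have "ip (m *s c) (m *s c) = 2" unfolding assms(3) by simp
  then have "m * m = 1" using assms(1) by (simp add: is_root_def)
  then have "m = 1 \<or> m = -1" by (auto simp: zmult_eq_1_iff)
  then show ?thesis
  proof
    assume "m = -1"
    then have "- c = simple_root j" using assms(3) by simp
    then have "c = - simple_root j" by (metis minus_minus)
    then have False using assms(2) nonneg_uminus_both[of "simple_root j"] nonneg_simple_root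
      is_root_nonzero[OF is_root_simple_root] by metis
    then show ?thesis ..
  qed (use assms(3) in simp)
qed

lemma matrix_mul_nonzero:
  assumes "((A :: e7_mat) ** B) $ k $ j \<noteq> 0" obtains l where "A $ k $ l \<noteq> 0" "B $ l $ j \<noteq> 0"
  using assms unfolding matrix_mul_nth by (metis (mono_tags, lifting) mult_zero_left mult_zero_right
    sum.neutral)

lemma conj_root_support:
  assumes g: "monomial (weyl_word is) g" and nz: "(g ** x_el i e ** matrix_inv g) $ k $ j \<noteq> 0"
  shows "\<exists>m. wt k - wt j = m *s weyl_word is (simple_root i)"
proof -
  obtain q where q: "(g ** x_el i e) $ k $ q \<noteq> 0" "matrix_inv g $ q $ j \<noteq> 0"
    by (rule matrix_mul_nonzero[OF nz])
  obtain p where p: "g $ k $ p \<noteq> 0" "x_el i e $ p $ q \<noteq> 0" by (rule matrix_mul_nonzero[OF q(1)])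
  have "\<exists>m. wt p - wt q = m *s simple_root i"
  proof (cases "p = q")
    case True
    then show ?thesis by (intro exI[of _ 0]) simp
  next
    case False
    then obtain n :: int where "wt p - wt q = n *s (1 *s simple_root i)"
      using sgn_el_support(2)[of 1 p q i e] p(2) unfolding unit_sign_def sgn_el_eq by blast
    then show ?thesis by (intro exI[of _ n]) simp
  qed
  then obtain m where m: "wt p - wt q = m *s simple_root i" by blast
  have "wt q = weyl_word (rev is) (wt j)" by (rule monomial_support[OF monomial_inv[OF g] q(2)])
  then have "wt j = weyl_word is (wt q)" by simp
  moreover have "wt k = weyl_word is (wt p)" by (rule monomial_support[OF g p(1)])
  ultimately have "wt k - wt j = weyl_word is (wt p - wt q)" by simp
  then show ?thesis unfolding m by (intro exI[of _ m]) simp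
qed

text \<open>The root group of a positive root is reached by conjugating with one reflection at a
  time. Before each letter \<open>j\<close> the conjugate has entries only along multiples of a
  positive root other than \<alpha>_j, so \<open>e_j^*\<close> vanishes on it and
  \<open>s_bar j\<close> keeps it in \<open>U_plus\<close>.\<close>

lemma root_subgroup_in_U_plus:
  "ascending (is @ [i]) \<Longrightarrow> mat_prod (map s_bar is) ** x_el i e ** matrix_inv (mat_prod (map s_bar
    is)) \<in> U_plus"
proof (induction "is")
  case Nil
  have "matrix_inv (mat 1 :: e7_mat) = mat 1" by (rule matrix_inv_eqI) simp_all
  then show ?case using U_plus_closed(2) by simp
next
  case (Cons j "is")
  let ?n = "mat_prod (map s_bar is)"
  let ?g = "?n ** x_el i e ** matrix_inv ?n"
  have asc: "ascending (is @ [i])" using Cons.prems ascending_tl by auto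
  then have g: "?g \<in> U_plus" by (rule Cons.IH)
  let ?c = "weyl_word is (simple_root i)"
  have c: "is_root ?c" "nonneg ?c" using asc by (simp_all add: ascending_snoc)
  have "nonneg (refl j ?c)" using Cons.prems ascending_snoc[of "j # is" i] by simp
  then have cj: "?c \<noteq> simple_root j"
    using nonneg_uminus_both[of "simple_root j"] nonneg_simple_root is_root_nonzero[OF
      is_root_simple_root]
    by (metis refl_simple_root)
  have "chi 1 j ?g = 0"
  proof (rule ccontr)
    assume "chi 1 j ?g \<noteq> 0"
    then have "?g $ Inr (sgn_root 1 j) $ Inl j \<noteq> 0" by (simp add: chi_def)
    then obtain m where "wt (Inr (sgn_root 1 j)) - wt (Inl j) = m *s ?c"
      using conj_root_support[OF monomial_word] by blast
    then have "m *s ?c = simple_root j" by (simp add: unit_sign_def)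
    then show False using root_multiple[OF c] cj by blast
  qed
  then obtain v where v: "v \<in> U_plus" "s_bar j ** ?g = v ** s_bar j" using s_bar_conj_left[OF g]
    by blast
  have n: "invertible ?n" using G_dual_closed(4) monomial_G[OF monomial_word] by blast
  have "matrix_inv (s_bar j ** ?n) = matrix_inv ?n ** matrix_inv (s_bar j)"
    by (rule matrix_inv_mult[OF invertible_s_bar n])
  then have "mat_prod (map s_bar (j # is)) ** x_el i e ** matrix_inv (mat_prod (map s_bar (j # is)))
    = s_bar j ** ?g ** matrix_inv (s_bar j)" by (simp add: matrix_mul_assoc)
  also have "\<dots> = v" unfolding v(2) by (rule mat_cancel(3)[OF invertible_s_bar])
  finally show ?case using v(1) by simp
qed

lemma T_dual_B_plus: "t \<in> T_dual \<Longrightarrow> t \<in> B_plus"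
  unfolding B_plus_iff using U_plus_closed(1) by (intro bexI[of _ t] bexI[of _ "mat 1"]) auto

lemma U_plus_B_plus: "u \<in> U_plus \<Longrightarrow> u \<in> B_plus"
  unfolding B_plus_iff using T_dual_closed(1) by (intro bexI[of _ "mat 1"] bexI[of _ u]) auto

lemma B_plus_mult: assumes "b \<in> B_plus" "b' \<in> B_plus" shows "b ** b' \<in> B_plus"
proof -
  obtain t u t' u' where b: "t \<in> T_dual" "u \<in> U_plus" "b = t ** u" "t' \<in> T_dual" "u' \<in> U_plus"
    "b' = t' ** u'"
    using assms by (auto simp: B_plus_iff)
  obtain v where v: "v \<in> U_plus" "u ** t' = t' ** v" using U_plus_torus[OF b(4,2)] by blast
  have "b ** b' = t ** (u ** t') ** u'" unfolding b(3,6) by (simp only: matrix_mul_assoc)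
  also have "\<dots> = (t ** t') ** (v ** u')" unfolding v(2) by (simp only: matrix_mul_assoc)
  finally have "b ** b' = (t ** t') ** (v ** u')" .
  then show ?thesis unfolding B_plus_iff using b v T_dual_closed(2) U_plus_closed(3) by blast
qed

text \<open>Each factor \<open>y_i(a)\<close> with \<open>a\<close> nonzero lies in the cell of
  \<open>s_i\<close>, and the cell of \<open>w\<close> times that of \<open>s_i\<close> is the cell
  of \<open>w s_i\<close> as long as the length grows.\<close>

lemma lower_product_in_bruhat_cell:
  "ascending (map fst ps) \<Longrightarrow> (\<forall>p\<in>set ps. snd p \<noteq> 0) \<Longrightarrow>
    \<exists>b\<in>B_plus. \<exists>b'\<in>B_plus. mat_prod (map (\<lambda>p. y_el (fst p) (snd p)) ps)
      = b ** mat_prod (map s_bar (map fst ps)) ** b'"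
proof (induction ps rule: rev_induct)
  case Nil
  show ?case using T_dual_B_plus[OF T_dual_closed(1)]
    by (intro bexI[of _ "mat 1"]) simp_all
next
  case (snoc p ps)
  obtain i a where p: "p = (i, a)" by (cases p)
  have a: "a \<noteq> 0" using snoc.prems p by simp
  let ?is = "map fst ps" let ?n = "mat_prod (map s_bar ?is)"
  have asc: "ascending (?is @ [i])" using snoc.prems p by simp
  obtain b b' where b: "b \<in> B_plus" "b' \<in> B_plus"
    "mat_prod (map (\<lambda>p. y_el (fst p) (snd p)) ps) = b ** ?n ** b'"
    using snoc.IH asc snoc.prems by (auto simp: ascending_snoc)
  have y: "y_el i a = x_el i (1 / a) ** (n_el i a ** x_el i (1 / a))"
  proof -
    have "x_el i (1 / a) ** (n_el i a ** x_el i (1 / a))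
      = (x_el i (1 / a) ** x_el i (- 1 / a)) ** y_el i a ** (x_el i (- 1 / a) ** x_el i (1 / a))"
      by (simp only: n_el_def matrix_mul_assoc)
    then show ?thesis by (simp add: x_el_add)
  qed
  have ms: "monomial (weyl_word [i]) (s_bar i)" using monomial_word[of "[i]"] by simp
  have mn: "monomial (weyl_word [i]) (n_el i a)"
    using monomial_n_el[OF a, of i] by (simp only: weyl_word_Cons weyl_word_Nil comp_id)
  define t where "t = n_el i a ** matrix_inv (s_bar i)"
  have t: "t \<in> T_dual" unfolding t_def by (rule monomial_torus_conj[OF mn ms])
  have nt: "n_el i a = t ** s_bar i" unfolding t_def
    by (rule mat_cancel(4)[OF invertible_s_bar, symmetric])
  have "b' ** x_el i (1 / a) \<in> B_plus"
    by (rule B_plus_mult[OF b(2) U_plus_B_plus[OF U_plus_closed(2)]])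
  from B_plus_mult[OF this T_dual_B_plus[OF t]] have "b' ** x_el i (1 / a) ** t \<in> B_plus" .
  then obtain t' u where tu: "t' \<in> T_dual" "u \<in> U_plus" "b' ** x_el i (1 / a) ** t = t' ** u"
    by (auto simp: B_plus_iff)
  \<comment> \<open>\<open>u\<close> is split into an \<open>x_i\<close> factor and a rest in the
    kernel of \<open>e_i^*\<close>. The rest passes \<open>s_bar i\<close> to the right; the
    \<open>x_i\<close> factor passes \<open>?n\<close> to the left, because the word
    ascends.\<close>
  define v where "v = x_el i (- chi 1 i u) ** u"
  have v: "v \<in> U_plus" "chi 1 i v = 0"
    unfolding v_def using tu(2) U_plus_closed(2,3) by (simp_all add: chi_plus_mult chi_plus_x_el)
  have uv: "u = x_el i (chi 1 i u) ** v" unfolding v_def by (simp add: matrix_mul_assoc x_el_add)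
  obtain v' where v': "v' \<in> U_plus" "v ** s_bar i = s_bar i ** v'" using s_bar_conj_right[OF v]
    by blast
  let ?r = "?n ** x_el i (chi 1 i u) ** matrix_inv ?n"
  have r: "?r \<in> U_plus" by (rule root_subgroup_in_U_plus[OF asc])
  have n: "invertible ?n" using G_dual_closed(4) monomial_G[OF monomial_word] by blast
  let ?t = "?n ** t' ** matrix_inv ?n"
  have "monomial (weyl_word (?is @ [] @ rev ?is)) (?n ** (t' ** matrix_inv ?n))"
    by (intro monomial_word_mult monomial_word monomial_inv) (use tu(1) torus_monomial in \<open>simp
      only: weyl_word_Nil\<close>)
  moreover have "weyl_word (?is @ [] @ rev ?is) = id" by (rule ext) simp
  ultimately have t2: "?t \<in> T_dual" by (simp only: torus_monomial matrix_mul_assoc)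
  have "mat_prod (map (\<lambda>p. y_el (fst p) (snd p)) (ps @ [p])) = b ** ?n ** b' ** y_el i a"
    by (simp add: mat_prod_append b(3) p)
  also have "\<dots> = b ** ?n ** (b' ** x_el i (1 / a) ** t) ** s_bar i ** x_el i (1 / a)"
    unfolding y nt by (simp only: matrix_mul_assoc)
  also have "\<dots> = b ** ?n ** t' ** x_el i (chi 1 i u) ** (v ** s_bar i) ** x_el i (1 / a)"
    unfolding tu(3) by (subst uv) (simp only: matrix_mul_assoc)
  also have "\<dots> = b ** ?n ** t' ** (matrix_inv ?n ** ?n) ** x_el i (chi 1 i u) ** (matrix_inv ?n **
    ?n) ** (s_bar i ** v') ** x_el i (1 / a)"
    unfolding v'(2) matrix_inv_inverse(2)[OF n] by simp
  also have "\<dots> = (b ** (?t ** ?r)) ** (?n ** s_bar i) ** (v' ** x_el i (1 / a))"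
    by (simp only: matrix_mul_assoc)
  also have "?n ** s_bar i = mat_prod (map s_bar (map fst (ps @ [p])))"
    by (simp add: mat_prod_append p)
  finally have e: "mat_prod (map (\<lambda>p. y_el (fst p) (snd p)) (ps @ [p]))
    = (b ** (?t ** ?r)) ** mat_prod (map s_bar (map fst (ps @ [p]))) ** (v' ** x_el i (1 / a))" .
  have "b ** (?t ** ?r) \<in> B_plus" by (rule B_plus_mult[OF b(1) B_plus_mult[OF T_dual_B_plus[OF t2]
    U_plus_B_plus[OF r]]])
  moreover have "v' ** x_el i (1 / a) \<in> B_plus" by (intro U_plus_B_plus U_plus_closed(2,3) v'(1))
  ultimately show ?case using e by blast
qed

text \<open>The factors of \<open>u_-\<close> carry the letters of \<open>r_word\<close> in reverse,
  which is why the cell in \<open>U_minus_P\<close> is that of \<open>w_P w_0\<close> and not of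
  \<open>w_0 w_P\<close>.\<close>

lemma rev_r_word_eq: "weyl_word (rev r_word) = weyl_word (wP_word @ w0_word)"
proof (rule weyl_word_eqI)
  have "\<forall>i. weyl_word (rev r_word) (simple_root i) = weyl_word (wP_word @ w0_word) (simple_root i)"
    unfolding all_7 weyl_word_append_apply w0_word_simple weyl_word_linear wP_word_simple
    unfolding simple_root_v7 r_word_def by (simp add: vec_eq_iff all_7)
  then show "weyl_word (rev r_word) (simple_root i) = weyl_word (wP_word @ w0_word) (simple_root i)"
    for i by blast
qed

lemma w_0_in: "w_0 \<in> weyl_group" and w_P_in: "w_P \<in> weyl_group"
  unfolding w_0_eq(1) w_P_eq(1) by (auto intro: parabolic_word)

lemma monomial_w0: "monomial (weyl_word w0_word) (w_bar w_0)"
  and monomial_wP: "monomial (weyl_word wP_word) (w_bar w_P)"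
  using monomial_w_bar[OF w_0_in] monomial_w_bar[OF w_P_in]
    by (simp_all only: w_0_eq(1)[symmetric] w_P_eq(1)[symmetric])

lemma U_minus_P_iff:
  "u \<in> U_minus_P \<longleftrightarrow> u \<in> U_minus \<and> (\<exists>b\<in>B_plus. \<exists>b'\<in>B_plus. u = b ** w_bar w_P ** w_bar w_0 ** b')"
  by (auto simp: U_minus_P_def set_mult_def r_coset_def)

lemma length_r_word: "length r_word = 27" by (simp add: r_word_def)

lemma mat_prod_y_in_U_minus: "mat_prod (map (\<lambda>p. y_el (fst p) (snd p)) ps) \<in> U_minus"
  by (induction ps) (auto intro: U_minus_closed(1) U_minus_closed(2,3))

lemma U_minus_circ_subset:
  assumes "u \<in> U_minus_circ" shows "u \<in> U_minus_P"
proof -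
  obtain a where a: "\<forall>i\<in>{1..27::nat}. a i \<noteq> (0 :: complex)" and u:
    "u = mat_prod (rev (map2 y_el r_word (map a [1..<28])))"
    using assms by (auto simp: U_minus_circ_def)
  let ?ps = "rev (zip r_word (map a [1..<28]))"
  have u2: "u = mat_prod (map (\<lambda>p. y_el (fst p) (snd p)) ?ps)"
    unfolding u rev_map by (simp add: case_prod_unfold)
  have fst: "map fst ?ps = rev r_word" by (simp add: rev_map[symmetric] length_r_word)
  have nz: "\<forall>p\<in>set ?ps. snd p \<noteq> 0"
    using a by (auto dest!: set_zip_rightD)
  obtain b b' where b: "b \<in> B_plus" "b' \<in> B_plus" "u = b ** mat_prod (map s_bar (rev r_word)) ** b'"
    using lower_product_in_bruhat_cell[of ?ps, OF _ nz] ascending_r_word(2) unfolding fst u2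
      by blast
  let ?n = "mat_prod (map s_bar (rev r_word))" and ?m = "w_bar w_P ** w_bar w_0"
  have n: "monomial (weyl_word (wP_word @ w0_word)) ?n" using monomial_word[of "rev r_word"]
    by (simp only: rev_r_word_eq)
  have m: "monomial (weyl_word (wP_word @ w0_word)) ?m"
    by (rule monomial_word_mult[OF monomial_wP monomial_w0])
  have t: "?n ** matrix_inv ?m \<in> T_dual" by (rule monomial_torus_conj[OF n m])
  have "invertible ?m" using G_dual_closed(4) monomial_G[OF m] by blast
  then have "?n = ?n ** matrix_inv ?m ** ?m" by (simp only: mat_cancel)
  then have "u = b ** (?n ** matrix_inv ?m ** ?m) ** b'" using b(3) by (simp only:)
  also have "\<dots> = (b ** (?n ** matrix_inv ?m)) ** w_bar w_P ** w_bar w_0 ** b'"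
    by (simp only: matrix_mul_assoc)
  finally have "u = (b ** (?n ** matrix_inv ?m)) ** w_bar w_P ** w_bar w_0 ** b'" .
  moreover have "b ** (?n ** matrix_inv ?m) \<in> B_plus"
    by (rule B_plus_mult[OF b(1) T_dual_B_plus[OF t]])
  moreover have "u \<in> U_minus" unfolding u2 by (rule mat_prod_y_in_U_minus)
  ultimately show ?thesis unfolding U_minus_P_iff using b(2) by blast
qed

subsection \<open>Uniqueness of the decomposition\<close>

text \<open>Conditions on weights stand for subspaces: \<open>nonneg\<close> for \<open>b_+\<close>,
  coordinate 7 nonnegative for \<open>p_+\<close>, coordinate 7 positive for the nilradical of
  \<open>p_+\<close>.\<close>

definition supp :: "e7_alg \<Rightarrow> (int ^ 7 \<Rightarrow> bool) \<Rightarrow> bool" where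
  "supp X P \<longleftrightarrow> (\<forall>k. X $ k \<noteq> 0 \<longrightarrow> P (wt k))"

lemma supp_mult:
  assumes X: "supp X P" and A: "\<And>k j. (A :: e7_mat) $ k $ j \<noteq> 0 \<Longrightarrow> P (wt j) \<Longrightarrow> Q (wt k)"
  shows "supp (A *v X) Q"
  unfolding supp_def
proof (intro allI impI)
  fix k assume "(A *v X) $ k \<noteq> 0"
  then obtain j where "A $ k $ j \<noteq> 0" "X $ j \<noteq> 0" unfolding matrix_vector_mult_def
    by (simp) (metis (mono_tags, lifting) mult_zero_left mult_zero_right sum.neutral)
  then show "Q (wt k)" using X A unfolding supp_def by blast
qed

lemma supp_diff: "supp X P \<Longrightarrow> supp Y P \<Longrightarrow> supp (X - Y) P"
  unfolding supp_def by (metis diff_zero vector_minus_component)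

lemma supp_add: "supp X P \<Longrightarrow> supp Y P \<Longrightarrow> supp (X + Y) P"
  unfolding supp_def by (metis add.right_neutral vector_add_component)

lemma supp_mono: "supp X P \<Longrightarrow> (\<And>k. P (wt k) \<Longrightarrow> Q (wt k)) \<Longrightarrow> supp X Q"
  by (auto simp: supp_def)

lemma wt_cases: "wt k = 0 \<or> is_root (wt k)"
  by (cases k) auto

lemma nonneg_0 [simp]: "nonneg 0" by (simp add: nonneg_def)

lemma unitri_nonzero:
  "unitri s M \<Longrightarrow> M $ k $ j \<noteq> 0 \<Longrightarrow> nonneg (s *s (wt k - wt j))"
  by (cases "k = j") (auto simp: unitri_def)

lemma U_plus_unitri: "u \<in> U_plus \<Longrightarrow> unitri 1 u"
  using unitri_sgn_U[of 1 u] by (simp add: sgn_U_eq unit_sign_def)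

lemma U_minus_unitri: "u \<in> U_minus \<Longrightarrow> unitri (-1) u"
  using unitri_sgn_U[of "-1" u] by (simp add: sgn_U_eq unit_sign_def)

lemma torus_mult_nth:
  assumes "t \<in> T_dual" shows "(t ** M) $ k $ j = t $ k $ k * M $ k $ j"
    "(M ** t) $ k $ j = M $ k $ j * t $ j $ j"
proof -
  have 1: "(\<Sum>l\<in>UNIV. t $ k $ l * M $ l $ j) = (\<Sum>l\<in>UNIV. if l = k then t $ k $ k * M $ k $ j else 0)"
    by (rule sum.cong) (use T_dual_nth(1)[OF assms, of k] in auto)
  have 2: "(\<Sum>l\<in>UNIV. M $ k $ l * t $ l $ j) = (\<Sum>l\<in>UNIV. if l = j then M $ k $ j * t $ j $ j else 0)"
    by (rule sum.cong) (use T_dual_nth(1)[OF assms, of _ j] in auto)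
  show "(t ** M) $ k $ j = t $ k $ k * M $ k $ j" "(M ** t) $ k $ j = M $ k $ j * t $ j $ j"
    unfolding matrix_mul_nth 1 2 by simp_all
qed

lemma B_plus_inv: assumes "b \<in> B_plus" shows "matrix_inv b \<in> B_plus" "invertible b"
proof -
  obtain t u where b: "t \<in> T_dual" "u \<in> U_plus" "b = t ** u" using assms by (auto simp: B_plus_iff)
  have i: "invertible t" "invertible u" using b T_dual_closed(4) U_plus_closed(4) by auto
  show "invertible b" unfolding b(3) by (rule invertible_mult[OF i])
  have "matrix_inv b = matrix_inv u ** matrix_inv t" unfolding b(3) by (rule matrix_inv_mult[OF i])
  then show "matrix_inv b \<in> B_plus"
    using B_plus_mult[OF U_plus_B_plus[OF U_plus_closed(5)[OF b(2)]] T_dual_B_plus[OF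
      T_dual_closed(3)[OF b(1)]]] by simp
qed

lemma B_plus_support:
  assumes "b \<in> B_plus" "b $ k $ j \<noteq> 0" shows "nonneg (wt k - wt j)" "wt k = wt j \<Longrightarrow> k = j"
proof -
  obtain t u where b: "t \<in> T_dual" "u \<in> U_plus" "b = t ** u" using assms by (auto simp: B_plus_iff)
  then have u: "u $ k $ j \<noteq> 0" using assms(2) by (simp add: torus_mult_nth)
  show "nonneg (wt k - wt j)" using unitri_nonzero[OF U_plus_unitri[OF b(2)] u] by simp
  show "wt k = wt j \<Longrightarrow> k = j" using U_plus_unitri[OF b(2)] u unfolding unitri_def by blast
qed

lemma B_minus_inv_support:
  assumes "b \<in> B_minus"
  shows "invertible b" "matrix_inv b $ k $ j \<noteq> 0 \<Longrightarrow> nonneg (wt j - wt k)"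
proof -
  obtain t u where b: "t \<in> T_dual" "u \<in> U_minus" "b = t ** u" using assms
    by (auto simp: B_minus_iff)
  have i: "invertible t" "invertible u" using b T_dual_closed(4) U_minus_closed(4) by auto
  show "invertible b" unfolding b(3) by (rule invertible_mult[OF i])
  assume "matrix_inv b $ k $ j \<noteq> 0"
  then have "matrix_inv u $ k $ j \<noteq> 0"
    unfolding b(3) matrix_inv_mult[OF i] torus_mult_nth(2)[OF T_dual_closed(3)[OF b(1)]] by auto
  from unitri_nonzero[OF U_minus_unitri[OF U_minus_closed(5)[OF b(2)]] this]
  show "nonneg (wt j - wt k)" by simp
qed

lemma wP_word_involution: "weyl_word wP_word (weyl_word wP_word v) = v"
proof -
  have "\<forall>i. weyl_word wP_word (simple_root i) = weyl_word (rev wP_word) (simple_root i)"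
    unfolding all_7 simple_root_v7 wP_word_def by simp
  then have "weyl_word wP_word = weyl_word (rev wP_word)" by (intro weyl_word_eqI) blast
  then show ?thesis by (metis weyl_word_rev(1))
qed

abbreviation wP :: "int ^ 7 \<Rightarrow> int ^ 7" where "wP \<equiv> weyl_word wP_word"

lemma wP_coord7 [simp]: "wP v $ 7 = v $ 7"
  by (rule parabolic_fix_coord[OF wP_in]) simp

lemma wP_negates: "v \<in> pos_roots (UNIV - {7}) \<Longrightarrow> nonneg (- wP v)"
proof -
  assume v: "v \<in> pos_roots (UNIV - {7})"
  then have "v \<in> inversions wP" using w_P_eq by simp
  then show "nonneg (- wP v)" using root_neg_iff[of "wP v"] by (simp add: inversions_def)
qed

lemma pos_roots_P_iff: "v \<in> pos_roots (UNIV - {7}) \<longleftrightarrow> is_root v \<and> nonneg v \<and> v $ 7 = 0"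
  by (auto simp: pos_roots_def)

text \<open>\<open>b\<^sub>L\<^sub>+ + n\<^sub>-\<close> is the image of \<open>b\<^sub>+\<close> under \<open>w\<^sub>P w\<^sub>0\<close>; its part in \<open>p\<^sub>+\<close> lies in \<open>b\<^sub>+\<close>.\<close>

definition opp_wt :: "int ^ 7 \<Rightarrow> bool" where "opp_wt v \<longleftrightarrow> nonneg (- wP v)"

lemma opp_wt_nonneg:
  assumes "opp_wt (wt k)" "0 \<le> wt k $ 7" shows "nonneg (wt k)"
proof (cases "wt k = 0")
  case False
  then have r: "is_root (wt k)" using wt_cases by blast
  have "0 \<le> (- wP (wt k)) $ 7" using assms(1) unfolding opp_wt_def nonneg_def by blast
  then have "wt k $ 7 = 0" using assms(2) by simp
  then have "- wP (wt k) \<in> pos_roots (UNIV - {7})" using assms(1) r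
    by (simp add: pos_roots_P_iff opp_wt_def)
  from wP_negates[OF this] show ?thesis by (simp add: wP_word_involution)
qed simp

lemma wt_coord7_pos: "0 < wt k $ 7 \<Longrightarrow> nonneg (wt k)"
  using root_sign[of "wt k"] wt_cases[of k] unfolding nonneg_def
  by (metis less_le_not_le neg_0_le_iff_le order_less_irrefl vector_uminus_component zero_index)

lemma supp_B_plus:
  assumes "b \<in> B_plus"
  shows "supp X nonneg \<Longrightarrow> supp (b *v X) nonneg"
    "supp X (\<lambda>v. 0 \<le> v $ 7) \<Longrightarrow> supp (b *v X) (\<lambda>v. 0 \<le> v $ 7)"
    "supp X (\<lambda>v. 0 < v $ 7) \<Longrightarrow> supp (b *v X) (\<lambda>v. 0 < v $ 7)"
proof -
  have c7: "wt j $ 7 \<le> wt k $ 7" if "b $ k $ j \<noteq> 0" for k j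
    using B_plus_support(1)[OF assms that] unfolding nonneg_def
      by (metis diff_ge_0_iff_ge vector_minus_component)
  show "supp X nonneg \<Longrightarrow> supp (b *v X) nonneg"
    by (erule supp_mult) (use B_plus_support(1)[OF assms] nonneg_add in fastforce)
  show "supp X (\<lambda>v. 0 \<le> v $ 7) \<Longrightarrow> supp (b *v X) (\<lambda>v. 0 \<le> v $ 7)"
    by (erule supp_mult) (use c7 order_trans in blast)
  show "supp X (\<lambda>v. 0 < v $ 7) \<Longrightarrow> supp (b *v X) (\<lambda>v. 0 < v $ 7)"
    by (erule supp_mult) (use c7 less_le_trans in blast)
qed

abbreviation n_P0 :: e7_mat where "n_P0 \<equiv> w_bar w_P ** w_bar w_0"

lemma monomial_n_P0: "monomial (weyl_word (wP_word @ w0_word)) n_P0"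
  by (rule monomial_word_mult[OF monomial_wP monomial_w0])

lemma weyl_word_w0: "weyl_word w0_word v = - v"
  using w_0_eq by metis

lemma n_P0_support: "n_P0 $ k $ j \<noteq> 0 \<Longrightarrow> wt j = - wP (wt k)"
  using monomial_support[OF monomial_n_P0, of k j] by (simp add: weyl_word_w0 wP_word_involution)

lemma w_bar_P_support: "w_bar w_P $ k $ j \<noteq> 0 \<Longrightarrow> wt j = wP (wt k)"
  using monomial_support[OF monomial_wP, of k j] by (simp add: wP_word_involution)

lemma w_bar_P_inv_support: "matrix_inv (w_bar w_P) $ k $ j \<noteq> 0 \<Longrightarrow> wt j = wP (wt k)"
  using monomial_support[OF monomial_inv[OF monomial_wP], of k j] by simp

lemma w_bar_0_support: "w_bar w_0 $ k $ j \<noteq> 0 \<Longrightarrow> wt j = - wt k"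
  using monomial_support[OF monomial_w0, of k j] by (simp add: weyl_word_w0)

lemma n_P0_inv_support: "matrix_inv n_P0 $ k $ j \<noteq> 0 \<Longrightarrow> wt k = - wP (wt j)"
proof -
  assume "matrix_inv n_P0 $ k $ j \<noteq> 0"
  then have "wt k = weyl_word (rev (wP_word @ w0_word)) (wt j)"
    by (rule monomial_support[OF monomial_inv[OF monomial_n_P0]])
  then have "weyl_word (wP_word @ w0_word) (wt k) = wt j" by simp
  then have "wP (wt k) = - wt j" by (simp add: weyl_word_w0 minus_equation_iff)
  then have "wP (wP (wt k)) = - wP (wt j)" by simp
  then show "wt k = - wP (wt j)" by (simp only: wP_word_involution)
qed

lemma invertible_w_bar: "invertible (w_bar w_P)" "invertible (w_bar w_0)" "invertible n_P0"
  using G_dual_closed(4) monomial_G monomial_wP monomial_w0 monomial_n_P0 by blast+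

text \<open>\<open>B_plus\<close> preserves \<open>p_+\<close>, so \<open>M\<close> lies in
  \<open>p_+\<close> as well. There its opposite weights are nonnegative, and \<open>B_plus\<close>
  preserves \<open>b_+\<close>.\<close>

lemma B_plus_opp_nonneg:
  assumes b: "b \<in> B_plus" and M: "supp M opp_wt" and bM: "supp (b *v M) (\<lambda>v. 0 \<le> v $ 7)"
  shows "supp (b *v M) nonneg"
proof -
  have "matrix_inv b *v (b *v M) = M"
    using matrix_inv_inverse(2)[OF B_plus_inv(2)[OF b]] by (simp add: matrix_vector_mul_assoc)
  then have "supp M (\<lambda>v. 0 \<le> v $ 7)" using supp_B_plus(2)[OF B_plus_inv(1)[OF b] bM] by simp
  then have "supp M nonneg" using M opp_wt_nonneg unfolding supp_def by blast
  then show ?thesis by (rule supp_B_plus(1)[OF b])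
qed

definition levi_part :: "e7_alg \<Rightarrow> e7_alg" where
  "levi_part X = (\<chi> k. if wt k $ 7 = 0 then X $ k else 0)"

lemma levi_part_nonzero: "levi_part X $ k \<noteq> 0 \<Longrightarrow> wt k $ 7 = 0 \<and> X $ k \<noteq> 0"
  by (simp add: levi_part_def split: if_splits)

lemma supp_minus_levi_part:
  assumes "supp X nonneg" shows "supp (X - levi_part X) (\<lambda>v. 0 < v $ 7)"
  unfolding supp_def
proof (intro allI impI)
  fix k assume "(X - levi_part X) $ k \<noteq> 0"
  then have "X $ k \<noteq> 0" "wt k $ 7 \<noteq> 0" by (auto simp: levi_part_def split: if_splits)
  moreover from this have "0 \<le> wt k $ 7" using assms unfolding supp_def nonneg_def by blast
  ultimately show "0 < wt k $ 7" by linarith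
qed

lemma matrix_vector_nonzero:
  assumes "((A :: e7_mat) *v X) $ k \<noteq> 0" obtains j where "A $ k $ j \<noteq> 0" "X $ j \<noteq> 0"
proof -
  have "(\<Sum>j\<in>UNIV. A $ k $ j * X $ j) \<noteq> 0" using assms by (simp add: matrix_vector_mult_def)
  then obtain j where "A $ k $ j * X $ j \<noteq> 0" by (meson sum.neutral)
  then show ?thesis using that by auto
qed

text \<open>\<open>h_i\<close> is corrected by an element of the nilradical of \<open>p_+\<close> to
  a vector \<open>u *v ?V\<close> with \<open>?V\<close> in \<open>b_+\<close>. Then
  \<open>l\<close> maps it to \<open>u' *v ?V\<close>, which the cell of \<open>u'\<close> together
  with \<open>l7\<close> forces into \<open>b_+\<close>. As \<open>l\<close> preserves the
  nilradical, \<open>l *v h_i\<close> lies in \<open>b_+\<close>; but \<open>l\<close> changes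
  \<open>h_i\<close> only in negative weights.\<close>

lemma levi_part_fixes_cartan:
  assumes u: "u \<in> U_minus_P" and u': "u' \<in> U_minus_P" and l: "l ** u = u'"
    and l7: "\<And>k j. l $ k $ j \<noteq> 0 \<Longrightarrow> wt j $ 7 \<le> wt k $ 7" and lm: "l \<in> U_minus"
  shows "l *v axis (Inl i) 1 = axis (Inl i) 1"
proof -
  obtain b b' where b: "b \<in> B_plus" "b' \<in> B_plus" "u = b ** w_bar w_P ** w_bar w_0 ** b'"
    using u by (auto simp: U_minus_P_iff)
  obtain c c' where c: "c \<in> B_plus" "c' \<in> B_plus" "u' = c ** w_bar w_P ** w_bar w_0 ** c'"
    using u' by (auto simp: U_minus_P_iff)
  let ?h = "axis (Inl i) 1 :: e7_alg"
  let ?H = "matrix_inv b *v ?h"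
  \<comment> \<open>The Levi part has only positive \<open>E_6\<close> weights and 0. The inverse of
    \<open>n_P0\<close> acts on weights by \<open>- wP\<close>, which keeps these
    nonnegative.\<close>
  let ?Y = "levi_part ?H"
  let ?N = "?H - ?Y"
  let ?Z = "matrix_inv n_P0 *v ?Y"
  let ?V = "matrix_inv b' *v ?Z"
  have h: "supp ?h nonneg" by (auto simp: supp_def axis_def)
  have H: "supp ?H nonneg" by (rule supp_B_plus(1)[OF B_plus_inv(1)[OF b(1)] h])
  have N: "supp ?N (\<lambda>v. 0 < v $ 7)" by (rule supp_minus_levi_part[OF H])
  have Z: "supp ?Z nonneg" unfolding supp_def
  proof (intro allI impI)
    fix k assume "?Z $ k \<noteq> 0"
    then obtain j where j: "matrix_inv n_P0 $ k $ j \<noteq> 0" "?Y $ j \<noteq> 0"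
      by (rule matrix_vector_nonzero)
    from j(1) have k: "wt k = - wP (wt j)" by (intro n_P0_inv_support)
    have "nonneg (wt j)" "wt j $ 7 = 0"
      using levi_part_nonzero[OF j(2)] H unfolding supp_def by blast+
    then show "nonneg (wt k)" using wP_negates[of "wt j"] wt_cases[of j] unfolding k pos_roots_P_iff
      by (metis neg_0_equal_iff_equal nonneg_0 weyl_word_linear(5))
  qed
  have V: "supp ?V nonneg" by (rule supp_B_plus(1)[OF B_plus_inv(1)[OF b(2)] Z])
  have "u *v ?V = b *v (n_P0 *v (b' *v ?V))"
    unfolding b(3) by (simp only: matrix_vector_mul_assoc matrix_mul_assoc)
  also have "b' *v ?V = ?Z"
    by (simp only: matrix_vector_mul_assoc matrix_inv_inverse(1)[OF B_plus_inv(2)[OF b(2)]]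
      matrix_vector_mul_lid mat_cancel(4)[OF B_plus_inv(2)[OF b(2)]] matrix_mul_assoc
        matrix_mul_lid)
  also have "n_P0 *v ?Z = ?Y"
    by (simp only: matrix_vector_mul_assoc matrix_inv_inverse(1)[OF invertible_w_bar(3)]
      matrix_vector_mul_lid)
  finally have uV: "u *v ?V = b *v ?Y" .
  have "b *v ?Y = b *v ?H - b *v ?N" by (simp add: matrix_vector_mult_diff_distrib)
  also have "b *v ?H = ?h"
    by (simp only: matrix_vector_mul_assoc matrix_inv_inverse(1)[OF B_plus_inv(2)[OF b(1)]]
      matrix_vector_mul_lid)
  finally have X: "b *v ?Y = ?h - b *v ?N" .
  have bN: "supp (b *v ?N) (\<lambda>v. 0 < v $ 7)" by (rule supp_B_plus(3)[OF b(1) N])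
  have lbN: "supp (l *v (b *v ?N)) (\<lambda>v. 0 < v $ 7)"
    by (rule supp_mult[OF bN]) (use l7 less_le_trans in blast)
  have "supp ?h (\<lambda>v. 0 \<le> v $ 7)" by (auto simp: supp_def axis_def)
  moreover have "supp (b *v ?N) (\<lambda>v. 0 \<le> v $ 7)" using bN by (rule supp_mono) simp
  ultimately have "supp (u *v ?V) (\<lambda>v. 0 \<le> v $ 7)" unfolding uV X by (rule supp_diff)
  then have lX: "supp (l *v (u *v ?V)) (\<lambda>v. 0 \<le> v $ 7)"
    by (rule supp_mult) (use l7 order_trans in blast)
  let ?M = "n_P0 *v (c' *v ?V)"
  have M: "supp ?M opp_wt"
  proof (rule supp_mult[OF supp_B_plus(1)[OF c(2) V]])
    show "n_P0 $ k $ j \<noteq> 0 \<Longrightarrow> nonneg (wt j) \<Longrightarrow> opp_wt (wt k)" for k j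
      using n_P0_support[of k j] by (simp add: opp_wt_def)
  qed
  have e: "l *v (u *v ?V) = c *v ?M"
  proof -
    have "l *v (u *v ?V) = (l ** u) *v ?V" by (rule matrix_vector_mul_assoc)
    also have "\<dots> = u' *v ?V" unfolding l ..
    also have "\<dots> = c *v ?M" unfolding c(3) by (simp only: matrix_vector_mul_assoc matrix_mul_assoc)
    finally show ?thesis .
  qed
  have "supp (c *v ?M) nonneg" by (rule B_plus_opp_nonneg[OF c(1) M lX[unfolded e]])
  then have 1: "supp (l *v (?h - b *v ?N)) nonneg" unfolding e[symmetric] uV X .
  have 2: "supp (l *v (b *v ?N)) nonneg" using lbN by (rule supp_mono) (rule wt_coord7_pos)
  have "supp (l *v ?h) nonneg" using supp_add[OF 1 2] by (simp add: matrix_vector_mult_diff_distrib)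
  then have nn: "nonneg (wt k)" if "l $ k $ Inl i \<noteq> 0" for k
    using that unfolding supp_def mat_col by blast
  have "l $ k $ Inl i = (if k = Inl i then 1 else 0)" for k
  proof (cases "k = Inl i")
    case True
    then show ?thesis using U_minus_unitri[OF lm] by (simp add: unitri_def)
  next
    case False
    have "l $ k $ Inl i = 0"
    proof (rule ccontr)
      assume nz: "l $ k $ Inl i \<noteq> 0"
      then have "wt k \<noteq> wt (Inl i)" "nonneg ((-1) *s (wt k - wt (Inl i)))"
        using U_minus_unitri[OF lm] False unfolding unitri_def by blast+
      then show False using nn[OF nz] nonneg_uminus_both[of "wt k"] by simp
    qed
    then show ?thesis using False by simp
  qed
  then show ?thesis unfolding vec_eq_iff mat_col by (simp add: axis_def)
qed

lemma unipotent_torus: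
  assumes "unitri s g" "g \<in> T_dual" shows "g = mat 1"
proof -
  have "g $ k $ j = mat 1 $ k $ j" for k j
    using assms T_dual_nth(1)[OF assms(2), of k j] by (cases
      "k = j") (auto simp: unitri_def mat_def)
  then show ?thesis by (simp add: vec_eq_iff)
qed

lemma T_P_T_dual: "t \<in> T_P \<Longrightarrow> t \<in> T_dual"
  by (simp add: T_P_def)

text \<open>The quotient of the two lower factors is \<open>w_P\<close>-conjugate to an element of
  \<open>B_plus\<close>. Since \<open>w_P\<close> fixes coordinate 7, it does not lower that
  coordinate, and \<open>levi_part_fixes_cartan\<close> puts it into the torus. Being unipotent it
  is 1; the other factors follow in the same way.\<close>

lemma decomposition_unique:
  assumes u: "u\<^sub>p \<in> U_plus" "t \<in> T_dual" "u\<^sub>m \<in> U_minus_P"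
    and u': "u\<^sub>p' \<in> U_plus" "t' \<in> T_dual" "u\<^sub>m' \<in> U_minus_P"
    and eq: "u\<^sub>p ** t ** w_bar w_P ** u\<^sub>m = u\<^sub>p' ** t' ** w_bar w_P ** u\<^sub>m'"
  shows "u\<^sub>p = u\<^sub>p' \<and> t = t' \<and> u\<^sub>m = u\<^sub>m'"
proof -
  let ?w = "w_bar w_P"
  note iw = invertible_w_bar(1)
  have um: "u\<^sub>m \<in> U_minus" "u\<^sub>m' \<in> U_minus" using u u' by (auto simp: U_minus_P_iff)
  have inv: "invertible u\<^sub>p" "invertible u\<^sub>p'" "invertible t" "invertible t'" "invertible u\<^sub>m"
    using u u' um U_plus_closed(4) T_dual_closed(4) U_minus_closed(4) by auto
  let ?c = "(matrix_inv t' ** (matrix_inv u\<^sub>p' ** u\<^sub>p)) ** t"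
  let ?l = "u\<^sub>m' ** matrix_inv u\<^sub>m"
  have c: "?c \<in> B_plus"
    by (rule B_plus_mult[OF B_plus_mult[OF T_dual_B_plus[OF T_dual_closed(3)[OF u'(2)]]
      U_plus_B_plus[OF U_plus_closed(3)[OF U_plus_closed(5)[OF u'(1)] u(1)]]] T_dual_B_plus[OF
        u(2)]])
  have l: "?l \<in> U_minus" by (rule U_minus_closed(3)[OF um(2) U_minus_closed(5)[OF um(1)]])
  have lu: "?l ** u\<^sub>m = u\<^sub>m'" by (rule mat_cancel(4)[OF inv(5)])
  have "?l = matrix_inv ?w ** (?w ** u\<^sub>m') ** matrix_inv u\<^sub>m"
    by (simp only: mat_cancel(1)[OF iw])
  also have "\<dots> = matrix_inv ?w ** (matrix_inv t' ** (t' ** (?w ** u\<^sub>m'))) ** matrix_inv u\<^sub>m"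
    by (simp only: mat_cancel(1)[OF inv(4)])
  also have "\<dots> = matrix_inv ?w ** (matrix_inv t' ** (matrix_inv u\<^sub>p' ** (u\<^sub>p' ** (t' ** (?w **
    u\<^sub>m'))))) ** matrix_inv u\<^sub>m"
    by (simp only: mat_cancel(1)[OF inv(2)])
  also have "\<dots> = matrix_inv ?w ** (matrix_inv t' ** (matrix_inv u\<^sub>p' ** (u\<^sub>p' ** t' ** ?w ** u\<^sub>m')))
    ** matrix_inv u\<^sub>m"
    by (simp only: matrix_mul_assoc)
  also have "\<dots> = matrix_inv ?w ** ?c ** ?w ** (u\<^sub>m ** matrix_inv u\<^sub>m)"
    unfolding eq[symmetric] by (simp only: matrix_mul_assoc)
  also have "\<dots> = matrix_inv ?w ** ?c ** ?w"
    by (simp only: matrix_inv_inverse(1)[OF inv(5)] matrix_mul_rid)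
  finally have lc: "?l = matrix_inv ?w ** ?c ** ?w" .
  have l7: "wt j $ 7 \<le> wt k $ 7" if nz: "?l $ k $ j \<noteq> 0" for k j
  proof -
    obtain q where q: "(matrix_inv ?w ** ?c) $ k $ q \<noteq> 0" "?w $ q $ j \<noteq> 0"
      using nz unfolding lc by (rule matrix_mul_nonzero)
    obtain p where p: "matrix_inv ?w $ k $ p \<noteq> 0" "?c $ p $ q \<noteq> 0"
      by (rule matrix_mul_nonzero[OF q(1)])
    have "0 \<le> (wt p - wt q) $ 7" using B_plus_support(1)[OF c p(2)] unfolding nonneg_def by blast
    then show ?thesis using w_bar_P_inv_support[OF p(1)] w_bar_P_support[OF q(2)] by simp
  qed
  have "?l *v axis (Inl i) 1 = axis (Inl i) 1" for i
    by (rule levi_part_fixes_cartan[OF u(3) u'(3) lu l7 l])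
  then have "?l \<in> T_dual" using fix_cartan_imp_torus[OF U_minus_G[OF l]] torus_monomial by blast
  then have "?l = mat 1" by (rule unipotent_torus[OF U_minus_unitri[OF l]])
  then have um_eq: "u\<^sub>m = u\<^sub>m'" using lu by (simp only: matrix_mul_lid)
  let ?g = "matrix_inv u\<^sub>p' ** u\<^sub>p"
  have iwu: "invertible (?w ** u\<^sub>m)" by (rule invertible_mult[OF iw inv(5)])
  have "u\<^sub>p ** t ** (?w ** u\<^sub>m) = u\<^sub>p' ** t' ** (?w ** u\<^sub>m)"
    using eq unfolding um_eq by (simp only: matrix_mul_assoc)
  from arg_cong[OF this, of "\<lambda>g. g ** matrix_inv (?w ** u\<^sub>m)"]
  have ut: "u\<^sub>p ** t = u\<^sub>p' ** t'" by (simp only: mat_cancel(3)[OF iwu])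
  have "?g = matrix_inv u\<^sub>p' ** (u\<^sub>p ** t) ** matrix_inv t"
    by (simp only: matrix_mul_assoc mat_cancel(3)[OF inv(3)])
  also have "\<dots> = matrix_inv u\<^sub>p' ** (u\<^sub>p' ** t') ** matrix_inv t" unfolding ut ..
  also have "\<dots> = t' ** matrix_inv t" by (simp only: mat_cancel(1)[OF inv(2)])
  finally have "?g \<in> T_dual" using T_dual_closed(2)[OF u'(2) T_dual_closed(3)[OF u(2)]] by simp
  then have "?g = mat 1"
    by (rule unipotent_torus[OF U_plus_unitri[OF U_plus_closed(3)[OF U_plus_closed(5)[OF u'(1)]
      u(1)]]])
  from arg_cong[OF this, of "\<lambda>g. u\<^sub>p' ** g"]
  have up: "u\<^sub>p = u\<^sub>p'" by (simp only: mat_cancel(2)[OF inv(2)] matrix_mul_rid)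
  from arg_cong[OF ut, of "\<lambda>g. matrix_inv u\<^sub>p ** g"] have "t = t'"
    unfolding up by (simp only: mat_cancel(1)[OF inv(2)])
  then show ?thesis using up um_eq by blast
qed

subsection \<open>Vanishing of \<open>e\<^sub>i\<^sup>*\<close> for \<open>i \<noteq> 7\<close>\<close>

text \<open>Computed from the right side, the inverse of \<open>u\<^sub>p\<close> maps
  \<open>h_i\<close> to \<open>t w_P b M\<close> with \<open>M\<close> of opposite weights; being
  upper unipotent, it maps \<open>h_i\<close> into \<open>b_+\<close>. Hence \<open>b M\<close> is
  in \<open>b_+\<close> and only weights that \<open>wP\<close> makes nonnegative occur. But
  \<open>wP\<close> makes \<alpha>_i negative for \<open>i \<noteq> 7\<close>.\<close>

lemma chi_inv_vanishes:
  assumes u: "u\<^sub>p \<in> U_plus" "t \<in> T_dual" "u\<^sub>m \<in> U_minus_P" and b: "b\<^sub>m \<in> B_minus"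
    and eq: "u\<^sub>p ** t ** w_bar w_P ** u\<^sub>m = b\<^sub>m ** matrix_inv (w_bar w_0)" and i: "i \<noteq> 7"
  shows "chi 1 i (matrix_inv u\<^sub>p) = 0"
proof -
  let ?w = "w_bar w_P" and ?wz = "w_bar w_0" and ?h = "axis (Inl i) 1 :: e7_alg"
  obtain b b' where bb: "b \<in> B_plus" "b' \<in> B_plus" "u\<^sub>m = b ** ?w ** ?wz ** b'"
    using u(3) by (auto simp: U_minus_P_iff)
  have inv: "invertible u\<^sub>p" "invertible t" using u U_plus_closed(4) T_dual_closed(4) by auto
  note ib = B_minus_inv_support[OF b]
  have "matrix_inv u\<^sub>p = matrix_inv u\<^sub>p ** (b\<^sub>m ** matrix_inv ?wz) ** ?wz ** matrix_inv b\<^sub>m"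
    by (simp only: matrix_mul_assoc mat_cancel(3)[OF ib(1)] mat_cancel(4)[OF invertible_w_bar(2)])
  also have "\<dots> = matrix_inv u\<^sub>p ** u\<^sub>p ** t ** ?w ** u\<^sub>m ** ?wz ** matrix_inv b\<^sub>m"
    unfolding eq[symmetric] by (simp only: matrix_mul_assoc)
  also have "\<dots> = t ** ?w ** u\<^sub>m ** ?wz ** matrix_inv b\<^sub>m"
    by (simp only: matrix_inv_inverse(2)[OF inv(1)] matrix_mul_lid)
  finally have n: "matrix_inv u\<^sub>p = t ** ?w ** u\<^sub>m ** ?wz ** matrix_inv b\<^sub>m" .
  let ?V = "?wz *v (b' *v (?wz *v (matrix_inv b\<^sub>m *v ?h)))"
  let ?M = "?w *v ?V"
  have nh: "matrix_inv u\<^sub>p *v ?h = t *v (?w *v (b *v ?M))"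
    unfolding n bb(3) by (simp only: matrix_vector_mul_assoc matrix_mul_assoc)
  have "supp ?h (\<lambda>v. nonneg (- v))" by (auto simp: supp_def axis_def)
  then have "supp (matrix_inv b\<^sub>m *v ?h) (\<lambda>v. nonneg (- v))"
    by (rule supp_mult) (use ib(2) nonneg_add in fastforce)
  then have "supp (?wz *v (matrix_inv b\<^sub>m *v ?h)) nonneg"
    by (rule supp_mult) (use w_bar_0_support in fastforce)
  then have "supp (b' *v (?wz *v (matrix_inv b\<^sub>m *v ?h))) nonneg" by (rule supp_B_plus(1)[OF bb(2)])
  then have "supp ?V (\<lambda>v. nonneg (- v))" by (rule supp_mult) (use w_bar_0_support in fastforce)
  then have M: "supp ?M opp_wt" by (rule supp_mult) (use w_bar_P_support in \<open>simp add: opp_wt_def\<close>)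
  have "supp ?h nonneg" by (auto simp: supp_def axis_def)
  then have "supp (matrix_inv u\<^sub>p *v ?h) nonneg"
    by (rule supp_B_plus(1)[OF U_plus_B_plus[OF U_plus_closed(5)[OF u(1)]]])
  then have 7: "supp (t *v (?w *v (b *v ?M))) (\<lambda>v. 0 \<le> v $ 7)"
    unfolding nh by (rule supp_mono) (simp add: nonneg_def)
  have "?w *v (b *v ?M) = matrix_inv t *v (t *v (?w *v (b *v ?M)))"
    by (simp only: matrix_vector_mul_assoc mat_cancel(1)[OF inv(2)])
  moreover have "supp (matrix_inv t *v (t *v (?w *v (b *v ?M)))) (\<lambda>v. 0 \<le> v $ 7)"
    by (rule supp_B_plus(2)[OF T_dual_B_plus[OF T_dual_closed(3)[OF u(2)]] 7])
  ultimately have 7: "supp (?w *v (b *v ?M)) (\<lambda>v. 0 \<le> v $ 7)" by simp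
  have "b *v ?M = matrix_inv ?w *v (?w *v (b *v ?M))"
    by (simp only: matrix_vector_mul_assoc mat_cancel(1)[OF invertible_w_bar(1)])
  moreover have "supp (matrix_inv ?w *v (?w *v (b *v ?M))) (\<lambda>v. 0 \<le> v $ 7)"
    by (rule supp_mult[OF 7]) (use w_bar_P_inv_support in fastforce)
  ultimately have "supp (b *v ?M) (\<lambda>v. 0 \<le> v $ 7)" by simp
  then have "supp (b *v ?M) nonneg" by (rule B_plus_opp_nonneg[OF bb(1) M])
  then have "supp (?w *v (b *v ?M)) (\<lambda>v. nonneg (wP v))"
    by (rule supp_mult) (use w_bar_P_support in fastforce)
  then have s: "supp (matrix_inv u\<^sub>p *v ?h) (\<lambda>v. nonneg (wP v))"
    unfolding nh by (rule supp_mult) (metis T_dual_nth(1) u(2))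
  have "simple_root i \<in> pos_roots (UNIV - {7})" using i
    by (simp add: pos_roots_P_iff simple_root_nth)
  then have "nonneg (- wP (simple_root i))" by (rule wP_negates)
  then have "\<not> nonneg (wP (simple_root i))"
    using root_neg_iff[of "wP (simple_root i)"] by simp
  then have "(matrix_inv u\<^sub>p *v ?h) $ Inr (sgn_root 1 i) = 0"
    using s unfolding supp_def by (auto simp: unit_sign_def)
  then show ?thesis by (simp add: chi_def mat_col)
qed

subsection \<open>Lowering paths in the minuscule representation\<close>

text \<open>The leftmost factor of \<open>u_-\<close> carries the index 27, so the list starts with
  the factor that acts last.\<close>

definition steps :: "(nat \<times> 7) list" where "steps = rev (zip [1..<28] r_word)"

text \<open>Index lists of the lowerings from \<open>omega2\<close> down to \<open>v\<close>, traced
  back from \<open>v\<close>: the head, which acts last, either left the weight alone or lowered it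
  to \<open>v\<close>.\<close>

primrec paths :: "(nat \<times> 7) list \<Rightarrow> int ^ 7 \<Rightarrow> nat list list" where
  "paths [] v = (if v = omega2 then [[]] else [])"
| "paths (q # ps) v = paths ps v @
    (if ip v (simple_root (snd q)) = -2
     then map (\<lambda>p. p @ [fst q]) (paths ps (v + 2 *s simple_root (snd q))) else [])"

primrec y_prod :: "(nat \<Rightarrow> complex) \<Rightarrow> (nat \<times> 7) list \<Rightarrow> e7_mat" where
  "y_prod a [] = mat 1"
| "y_prod a (q # ps) = y_el (snd q) (a (fst q)) ** y_prod a ps"

primrec Y_prod :: "(nat \<Rightarrow> complex) \<Rightarrow> (nat \<times> 7) list \<Rightarrow> wfun \<Rightarrow> wfun" where
  "Y_prod a [] f = f"
| "Y_prod a (q # ps) f = Y_op (snd q) (a (fst q)) (Y_prod a ps f)"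

lemma lift_y_prod: "lift (y_prod a ps) (Y_prod a ps)"
proof (induction ps)
  case Nil
  have "Y_prod a [] = (\<lambda>f. f)" by (rule ext) simp
  then show ?case using lift_one by simp
next
  case (Cons q ps)
  have "Y_prod a (q # ps) = (\<lambda>f. Y_op (snd q) (a (fst q)) (Y_prod a ps f))" by (rule ext) simp
  then show ?case using lift_y[OF Cons] by simp
qed

lemma Y_prod_paths:
  "v \<in> wts \<Longrightarrow> Y_prod a ps (delta omega2) v = (\<Sum>p\<leftarrow>paths ps v. prod_list (map a p))"
proof (induction ps arbitrary: v)
  case Nil
  then show ?case by (simp add: delta_def)
next
  case (Cons q ps)
  have "(\<Sum>p\<leftarrow>map (\<lambda>p. p @ [fst q]) ps'. prod_list (map a p))
    = a (fst q) * (\<Sum>p\<leftarrow>ps'. prod_list (map a p))" for ps'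
    by (induction ps') (simp_all add: algebra_simps)
  then show ?case using Cons wts_add(1)[OF Cons.prems is_root_simple_root]
    by (simp add: Y_op_def lower_op_def)
qed

text \<open>Twice the number of lowerings from the highest weight to \<open>v\<close>.\<close>

definition depth2 :: "int ^ 7 \<Rightarrow> int" where "depth2 v = (\<Sum>i\<in>UNIV. omega2 $ i - v $ i)"

lemma depth2_v7 [simp]: "depth2 (v7 a b c d e f g) = 27 - (a + b + c + d + e + f + g)"
  by (simp add: depth2_def sum_7 omega2_def)

lemma depth2_omega2 [simp]: "depth2 omega2 = 0"
  by (simp add: depth2_def)

lemma depth2_add: "depth2 (v + m *s simple_root i) = depth2 v - m"
proof -
  have "(\<Sum>j\<in>UNIV. m * simple_root i $ j) = (\<Sum>j\<in>UNIV. if j = i then m else 0)"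
    by (rule sum.cong) (auto simp: simple_root_nth)
  then show ?thesis by (simp add: depth2_def sum_subtractf sum.distrib)
qed

lemma paths_too_deep: "2 * int (length ps) < depth2 v \<Longrightarrow> paths ps v = []"
  by (induction ps arbitrary: v) (auto simp: depth2_add)

text \<open>When the tail is too short to reach \<open>v\<close>, the head has to lower. For the
  lowest weight, 27 levels down, this removes all branching.\<close>

lemma paths_deep:
  "2 * int (length ps) < depth2 v \<Longrightarrow> paths (q # ps) v =
    (if ip v (simple_root (snd q)) = -2
     then map (\<lambda>p. p @ [fst q]) (paths ps (v + 2 *s simple_root (snd q))) else [])"
  by (simp add: paths_too_deep)

lemma paths_set: "p \<in> set (paths ps v) \<Longrightarrow> set p \<subseteq> fst ` set ps"
  by (induction ps arbitrary: p v) (fastforce split: if_splits)+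

lemma distinct_paths: "distinct (map fst ps) \<Longrightarrow> distinct (paths ps v)"
proof (induction ps arbitrary: v)
  case (Cons q ps)
  have "inj_on (\<lambda>p. p @ [fst q]) A" for A by (simp add: inj_on_def)
  moreover have "p @ [fst q] \<notin> set (paths ps v)" for p
    using paths_set[of "p @ [fst q]" ps v] Cons.prems by auto
  ultimately show ?case using Cons by (auto simp: distinct_map)
qed simp

lemma depth2_refl: 
  "depth2 (refl i v) = depth2 v + ip v (simple_root i)"
proof -
  have "refl i v = v + (- ip v (simple_root i)) *s simple_root i" by (simp add: refl_def vec_eq_iff)
  then show ?thesis by (simp only: depth2_add)
qed

lemma depth2_weyl_word:
  "depth2 (weyl_word is omega2) \<le> 2 * int (length is)"
proof (induction "is")
  case (Cons i "is")
  have "weyl_word is omega2 \<in> wts" by simp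
  from ip_wts_root[OF this is_root_simple_root, of i]
  have "ip (weyl_word is omega2) (simple_root i) \<le> 2" by auto
  then show ?case using Cons by (simp add: depth2_refl)
qed simp

text \<open>Each reflection changes the depth by at most one, so a word of length equal to the depth
  of the weight reached lowers in every step.\<close>

lemma reduced_imp_path:
  assumes "sorted_wrt (>) (map fst ps)"
  shows "sorted_wrt (<) p \<Longrightarrow> set p \<subseteq> fst ` set ps \<Longrightarrow>
    weyl_word (rev (map (\<lambda>m. the (map_of ps m)) p)) omega2 = v \<Longrightarrow> depth2 v = 2 * int (length p) \<Longrightarrow>
    p \<in> set (paths ps v)"
  using assms
proof (induction ps arbitrary: p v)
  case Nil
  then show ?case by simp
next
  case (Cons q ps)
  have desc: "sorted_wrt (>) (map fst ps)" "\<forall>m\<in>fst ` set ps. m < fst q" using Cons.prems(5) by auto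
  have mo: "map_of (q # ps) m = map_of ps m" if "m \<noteq> fst q" for m
    using that by (cases q) simp
  show ?case
  proof (cases "fst q \<in> set p")
    case False
    then have sub: "set p \<subseteq> fst ` set ps" using Cons.prems(2) by auto
    have "map (\<lambda>m. the (map_of (q # ps) m)) p = map (\<lambda>m. the (map_of ps m)) p"
      by (rule map_cong) (use False mo in auto)
    then have "weyl_word (rev (map (\<lambda>m. the (map_of ps m)) p)) omega2 = v" using Cons.prems(3)
      by (simp only:)
    then have "p \<in> set (paths ps v)" by (rule Cons.IH[OF Cons.prems(1) sub _ Cons.prems(4) desc(1)])
    then show ?thesis by simp
  next
    case True
    obtain p' where p: "p = p' @ [fst q]"
    proof -
      have "p \<noteq> []" using True by auto
      then obtain p' m where pm: "p = p' @ [m]" by (metis rev_exhaust)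
      have "m = fst q"
      proof (rule ccontr)
        assume m: "m \<noteq> fst q"
        then have "fst q \<in> set p'" using True pm by auto
        then have "fst q < m" using Cons.prems(1) pm by (auto simp: sorted_wrt_append)
        moreover have "m \<in> fst ` set (q # ps)" using Cons.prems(2) pm by auto
        ultimately show False using desc(2) m by auto
      qed
      then show thesis using that pm by blast
    qed
    have lt: "\<forall>m\<in>set p'. m < fst q" using Cons.prems(1) p by (auto simp: sorted_wrt_append)
    have sub: "set p' \<subseteq> fst ` set ps" using Cons.prems(2) p lt by auto
    define v' where "v' = weyl_word (rev (map (\<lambda>m. the (map_of ps m)) p')) omega2"
    have mp: "map (\<lambda>m. the (map_of (q # ps) m)) p' = map (\<lambda>m. the (map_of ps m)) p'"
      by (rule map_cong) (use lt mo in auto)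
    have mq: "the (map_of (q # ps) (fst q)) = snd q" by (cases q) simp
    have v: "v = refl (snd q) v'"
      using Cons.prems(3) unfolding p v'_def map_append mp by (simp add: mq)
    have v'w: "v' \<in> wts" by (simp add: v'_def)
    have le: "depth2 v' \<le> 2 * int (length p')" using depth2_weyl_word[of
      "rev (map (\<lambda>m. the (map_of ps m)) p')"] by (simp add: v'_def)
    have d: "depth2 v' + ip v' (simple_root (snd q)) = 2 * int (length p') + 2"
      using Cons.prems(4) p by (simp add: v depth2_refl)
    have i2: "ip v' (simple_root (snd q)) = 2"
      using ip_wts_root[OF v'w is_root_simple_root, of "snd q"] le d by auto
    have d': "depth2 v' = 2 * int (length p')" using d i2 by simp
    have "p' \<in> set (paths ps v')"
      by (rule Cons.IH[OF _ sub _ d' desc(1)]) (use Cons.prems(1) p in \<open>simp_all add: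
        sorted_wrt_append v'_def\<close>)
    moreover have "v + 2 *s simple_root (snd q) = v'" "ip v (simple_root (snd q)) = -2"
      by (simp_all add: v refl_def i2)
    ultimately show ?thesis unfolding p by simp
  qed
qed

text \<open>Ten lowerings below \<open>omega2\<close>; \<open>w_p\<close> maps it to
  \<open>omega2\<close>.\<close>

definition nu2 :: "int ^ 7" where "nu2 = v7 2 1 2 2 1 0 (-1)"

lemma nu2_wts [simp]: "nu2 \<in> wts"
  by (simp add: nu2_def wts_v7 ip_expand)

section \<open>Enumeration of the two sets of paths\<close>

lemma v7_arith:
  "v7 a b c d e f g + 2 *s simple_root 1 = v7 (a + 2) b c d e f g"
  "v7 a b c d e f g + 2 *s simple_root 2 = v7 a (b + 2) c d e f g"
  "v7 a b c d e f g + 2 *s simple_root 3 = v7 a b (c + 2) d e f g"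
  "v7 a b c d e f g + 2 *s simple_root 4 = v7 a b c (d + 2) e f g"
  "v7 a b c d e f g + 2 *s simple_root 5 = v7 a b c d (e + 2) f g"
  "v7 a b c d e f g + 2 *s simple_root 6 = v7 a b c d e (f + 2) g"
  "v7 a b c d e f g + 2 *s simple_root 7 = v7 a b c d e f (g + 2)"
  by (simp_all add: vec_eq_iff all_7 simple_root_nth)

lemma steps_eq: "steps =
  [(27,7),(26,6),(25,5),(24,4),(23,3),(22,1),(21,2),(20,4),(19,3),(18,5),(17,4),
   (16,6),(15,5),(14,2),(13,4),(12,3),(11,1),(10,7),(9,6),(8,5),(7,4),(6,3),(5,2),(4,4),(3,5),(2,6),(1,7)]"
  by (simp add: steps_def r_word_def upt_conv_Cons)

lemma paths_bottom: "paths steps (- omega2) = [[1..<28]]"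
proof -
  have "- omega2 = v7 (-2) (-3) (-4) (-6) (-5) (-4) (-3)"
    by (simp add: omega2_def vec_eq_iff all_7)
  then show ?thesis
    unfolding steps_eq by (simp add: paths_deep ip_simple_root_right v7_arith upt_conv_Cons del:
      paths.simps(2))
      (simp add: omega2_def)
qed

text \<open>The two letter lists are the reduced words of \<open>w_p\<close>; they differ by
  exchanging the commuting letters 2 and 3.\<close>

definition is_w_p_path :: "nat list \<Rightarrow> bool" where
  "is_w_p_path p \<longleftrightarrow> length p = 10 \<and> sorted_wrt (<) p \<and> set p \<subseteq> {1..27} \<and>
    map (\<lambda>i. r_word ! (i - 1)) p \<in> {[7,6,5,4,2,3,4,5,6,7], [7,6,5,4,3,2,4,5,6,7]}"

text \<open>Naming the tails of \<open>steps\<close> by a numeral keeps the terms short while the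
  branching recursion is unfolded by rewriting.\<close>

definition steps_upto :: "nat \<Rightarrow> (nat \<times> 7) list" where "steps_upto n = drop (27 - n) steps"

lemma paths_steps_upto_0: "paths (steps_upto 0) v = (if v = omega2 then [[]] else [])"
  by (simp add: steps_upto_def steps_eq)

lemma paths_steps_upto:
  assumes n: "0 < n" "n \<le> 27"
  shows "paths (steps_upto n) v = paths (steps_upto (n - 1)) v @
    (if ip v (simple_root (r_word ! (n - 1))) = -2
     then map (\<lambda>p. p @ [n]) (paths (steps_upto (n - 1)) (v + 2 *s simple_root (r_word ! (n - 1))))
       else [])"
proof -
  have "steps ! (27 - n) = (n, r_word ! (n - 1))"
    using n by (simp add: steps_def rev_nth length_r_word del: upt.simps)
  moreover have "27 - (n - 1) = Suc (27 - n)" "27 - n < length steps" using n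
    by (auto simp: steps_eq)
  ultimately have "steps_upto n = (n, r_word ! (n - 1)) # steps_upto (n - 1)"
    unfolding steps_upto_def using Cons_nth_drop_Suc[of "27 - n" steps] by metis
  then show ?thesis by simp
qed

lemma paths_nu2: "length (paths steps nu2) = 78" "list_all is_w_p_path (paths steps nu2)"
proof -
  have "steps = steps_upto 27" by (simp add: steps_upto_def)
  then have s: "paths steps nu2 = paths (steps_upto 27) (v7 2 1 2 2 1 0 (-1))"
    by (simp add: nu2_def)
  show "length (paths steps nu2) = 78" unfolding s
    by (simp add: paths_steps_upto paths_steps_upto_0 r_word_def ip_simple_root_right v7_arith
        omega2_def del: One_nat_def)
  show "list_all is_w_p_path (paths steps nu2)" unfolding s
    by (simp add: paths_steps_upto paths_steps_upto_0 r_word_def ip_simple_root_right v7_arith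
        omega2_def del: One_nat_def)
      (simp add: is_w_p_path_def r_word_def)
qed

lemma w_p_other_word: "weyl_word [7,6,5,4,3,2,4,5,6,7] = w_p"
proof -
  have "\<forall>i. weyl_word [7,6,5,4,3,2,4,5,6,7] (simple_root i)
    = weyl_word [7,6,5,4,2,3,4,5,6,7] (simple_root i)"
    unfolding all_7 simple_root_v7 by simp
  then show ?thesis unfolding w_p_eq by (intro weyl_word_eqI) blast
qed

lemma map_of_steps:
  assumes "m \<in> {1..27}" shows "the (map_of steps m) = r_word ! (m - 1)"
proof -
  have "\<forall>m\<in>set [1..<28]. the (map_of steps m) = r_word ! (m - 1)"
    unfolding steps_eq r_word_def by (simp add: upt_conv_Cons)
  then show ?thesis using assms by simp
qed

text \<open>A tuple with product \<open>w_p\<close> has a reversed word taking \<open>omega2\<close>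
  to \<open>nu2\<close>. Its ten letters equal the depth of \<open>nu2\<close>, so each of them
  lowers and the tuple is a path. Conversely, every enumerated path spells one of the two words of
  \<open>w_p\<close>.\<close>

lemma index_tuples_eq: "index_tuples = set (paths steps nu2)"
proof (intro equalityI subsetI)
  fix p assume "p \<in> set (paths steps nu2)"
  then have "is_w_p_path p" using paths_nu2(2) by (simp add: list_all_iff)
  then show "p \<in> index_tuples" unfolding is_w_p_path_def index_tuples_def
    using w_p_eq w_p_other_word by auto
next
  fix p assume "p \<in> index_tuples"
  then have p: "length p = 10" "sorted_wrt (<) p" "set p \<subseteq> {1..27}"
    "w_p = weyl_word (map (\<lambda>i. r_word ! (i - 1)) p)" by (auto simp: index_tuples_def)
  have m: "map (\<lambda>m. the (map_of steps m)) p = map (\<lambda>i. r_word ! (i - 1)) p"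
    by (rule map_cong) (use p(3) map_of_steps in auto)
  have "weyl_word (map (\<lambda>i. r_word ! (i - 1)) p) nu2 = weyl_word [7,6,5,4,2,3,4,5,6,7] nu2"
    using p(4) w_p_eq by metis
  also have "\<dots> = omega2" by (simp add: nu2_def omega2_def)
  finally have "weyl_word (rev (map (\<lambda>i. r_word ! (i - 1)) p)) omega2 = nu2"
    by (metis weyl_word_rev(1))
  moreover have "fst ` set steps = {1..27}"
  proof -
    have "fst ` set steps = set (map fst steps)" by simp
    also have "map fst steps = rev [1..<28]"
      by (simp add: steps_def rev_map[symmetric] length_r_word)
    finally show ?thesis by auto
  qed
  moreover have "sorted_wrt (>) (map fst steps)" by (simp add: steps_eq)
  ultimately show "p \<in> set (paths steps nu2)"
    using reduced_imp_path[of steps p nu2] p m by (simp add: nu2_def)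
qed

lemma distinct_paths_nu2: "distinct (paths steps nu2)"
  by (rule distinct_paths) (simp add: steps_eq)

lemma card_index_tuples: "finite index_tuples" "card index_tuples = 78"
  unfolding index_tuples_eq by (simp_all add: distinct_card[OF distinct_paths_nu2] paths_nu2(1))

subsection \<open>The polynomial \<open>P\<close>\<close>

definition mono_of :: "nat list \<Rightarrow> (nat \<Rightarrow>\<^sub>0 nat)" where
  "mono_of p = sum_list (map (\<lambda>i. Poly_Mapping.single i 1) p)"

lemma prod_Var: "prod_list (map Var p) = Poly_Mapping.single (mono_of p) 1"
  by (induction p) (simp_all add: mono_of_def Var_def mult_single single_one)

lemma lookup_mono_of: "distinct p \<Longrightarrow> Poly_Mapping.lookup (mono_of p) i = (if i
  \<in> set p then 1 else 0)"
  by (induction p) (auto simp: mono_of_def lookup_add lookup_single when_def)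

lemma keys_mono_of: "distinct p \<Longrightarrow> Poly_Mapping.keys (mono_of p) = set p"
  by (auto simp: keys.rep_eq lookup_mono_of split: if_splits)

lemma index_tuples_distinct: "p \<in> index_tuples \<Longrightarrow> distinct p \<and> length p = 10"
  by (auto simp: index_tuples_def strict_sorted_iff)

text \<open>A strictly increasing tuple is determined by its set of entries. So no two tuples share
  a monomial, and all coefficients of \<open>P_poly\<close> are 1.\<close>

lemma inj_mono_of: "inj_on mono_of index_tuples"
proof (rule inj_onI)
  fix p q assume pq: "p \<in> index_tuples" "q \<in> index_tuples" "mono_of p = mono_of q"
  then have "set p = set q" using keys_mono_of index_tuples_distinct by metis
  then show "p = q" using pq by (auto simp: index_tuples_def strict_sorted_equal)
qed

lemma lookup_P_poly: "Poly_Mapping.lookup P_poly m = (if m \<in> mono_of ` index_tuples then 1 else 0)"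
proof -
  have "Poly_Mapping.lookup P_poly m = (\<Sum>p\<in>index_tuples. if m = mono_of p then 1 else 0)"
    unfolding P_poly_def prod_Var lookup_sum by (rule sum.cong) (auto simp: lookup_single when_def)
  also have "\<dots> = (\<Sum>n\<in>mono_of ` index_tuples. if m = n then 1 else 0)"
    by (subst sum.reindex[OF inj_mono_of]) (simp add: o_def)
  finally show ?thesis using card_index_tuples(1) by simp
qed

lemma keys_P_poly: "Poly_Mapping.keys P_poly = mono_of ` index_tuples"
  by (auto simp: keys.rep_eq lookup_P_poly split: if_splits)

lemma card_keys_P_poly: "card (Poly_Mapping.keys P_poly) = 78"
  unfolding keys_P_poly by (simp add: card_image[OF inj_mono_of] card_index_tuples)

lemma homogeneous_P_poly: "homogeneous 10 P_poly"
  unfolding homogeneous_def keys_P_poly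
proof
  fix m assume "m \<in> mono_of ` index_tuples"
  then obtain p where p: "p \<in> index_tuples" "m = mono_of p" by auto
  then have d: "distinct p" "length p = 10" using index_tuples_distinct by auto
  then show "(\<Sum>i\<in>Poly_Mapping.keys m. Poly_Mapping.lookup m i) = 10"
    by (simp add: p(2) keys_mono_of lookup_mono_of distinct_card)
qed

lemma poly_eval_P_poly: "poly_eval P_poly a = (\<Sum>p\<leftarrow>paths steps nu2. prod_list (map a p))"
proof -
  have "poly_eval P_poly a = (\<Sum>m\<in>mono_of ` index_tuples. \<Prod>i\<in>Poly_Mapping.keys m. a i ^
    Poly_Mapping.lookup m i)"
    unfolding poly_eval_def keys_P_poly by (rule sum.cong) (auto simp: lookup_P_poly)
  also have "\<dots> = (\<Sum>p\<in>index_tuples. \<Prod>i\<in>Poly_Mapping.keys (mono_of p). a i ^ Poly_Mapping.lookup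
    (mono_of p) i)"
    by (subst sum.reindex[OF inj_mono_of]) (simp add: o_def)
  also have "\<dots> = (\<Sum>p\<in>index_tuples. prod_list (map a p))"
  proof (rule sum.cong)
    fix p assume "p \<in> index_tuples"
    then have d: "distinct p" using index_tuples_distinct by auto
    have "(\<Prod>i\<in>set p. a i ^ Poly_Mapping.lookup (mono_of p) i) = (\<Prod>i\<in>set p. a i)"
      by (rule prod.cong) (auto simp: lookup_mono_of[OF d])
    then show "(\<Prod>i\<in>Poly_Mapping.keys (mono_of p). a i ^ Poly_Mapping.lookup (mono_of p) i)
      = prod_list (map a p)"
      by (simp add: keys_mono_of[OF d] prod.distinct_set_conv_list[OF d])
  qed simp
  also have "\<dots> = (\<Sum>p\<leftarrow>paths steps nu2. prod_list (map a p))"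
    unfolding index_tuples_eq by (rule sum.distinct_set_conv_list[OF distinct_paths_nu2])
  finally show ?thesis .
qed

subsection \<open>The value of \<open>e\<^sub>7\<^sup>*\<close>\<close>

text \<open>Twice the weight of \<open>e\<^sub>7 v\<^sup>-\<close>; it is the image of \<open>nu2\<close> under \<open>w\<^sub>P\<close>.\<close>

definition nu1 :: "int ^ 7" where "nu1 = - omega2 + 2 *s simple_root 7"

lemma ip_nu1: "ip nu1 (simple_root i) = (if i = 7 then 2 else if i = 6 then -2 else 0)"
  using exhaust_7[of i] by (auto simp: nu1_def ip_expand omega2_def simple_root_v7)

lemma ip_minus_omega2: "ip (- omega2) (simple_root i) = (if i = 7 then -2 else 0)"
  by (auto simp: ip_omega2 simple_root_nth)

lemma nu1_wts [simp]: "nu1 \<in> wts"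
  unfolding nu1_def by (rule wts_add_simple) (simp_all add: ip_minus_omega2 del: ip_bilinear)

text \<open>Nothing is raised into the lowest weight, and the only simple raising into
  \<open>nu1\<close> is that of node 7, out of the lowest weight. These two rows therefore see only
  \<open>e_7^*\<close>.\<close>

lemma U_plus_bottom:
  "u \<in> U_plus \<Longrightarrow> \<exists>A. lift u A \<and> (\<forall>f. A f (- omega2) = f (- omega2) \<and>
     A f nu1 = f nu1 + chi 1 7 u * f (- omega2))"
proof (induction rule: U_plus_induct)
  case one
  then show ?case using lift_one by (intro exI[of _ "\<lambda>f. f"]) (simp add: chi_def mat_def)
next
  case (step i a u)
  then obtain A where A: "lift u A" "\<And>f. A f (- omega2) = f (- omega2)"
    "\<And>f. A f nu1 = f nu1 + chi 1 7 u * f (- omega2)" by auto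
  have chi: "chi 1 7 (x_el i a ** u) = (if 7 = i then a else 0) + chi 1 7 u"
    using step.hyps U_plus_closed(2) by (simp add: chi_plus_mult chi_plus_x_el)
  have n: "nu1 - 2 *s simple_root 7 = - omega2" by (simp add: nu1_def)
  have "X_op i a (A f) (- omega2) = f (- omega2)" for f
    by (simp add: X_op_def raise_op_def ip_minus_omega2 A del: ip_bilinear)
  moreover have "X_op i a (A f) nu1 = f nu1 + chi 1 7 (x_el i a ** u) * f (- omega2)" for f
    by (auto simp: X_op_def raise_op_def ip_nu1 A chi n algebra_simps)
  ultimately show ?case using lift_x[OF A(1), of i a] by blast
qed

lemma U_minus_bottom:
  "u \<in> U_minus \<Longrightarrow> \<exists>A. lift u A \<and> A (delta (- omega2)) = delta (- omega2)"
proof (induction rule: U_minus_induct)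
  case one
  then show ?case using lift_one by (intro exI[of _ "\<lambda>f. f"]) simp
next
  case (step i a u)
  then obtain A where A: "lift u A" "A (delta (- omega2)) = delta (- omega2)" by auto
  have "lower_op i (delta (- omega2)) v = 0" for v
  proof (cases "v + 2 *s simple_root i = - omega2 \<and> v \<in> wts \<and> ip v (simple_root i) = -2")
    case True
    then have "ip (- omega2) (simple_root i) = 2" using wts_add(2)[of v "simple_root i"] by auto
    then show ?thesis using ip_minus_omega2[of i] by (simp del: ip_bilinear split: if_splits)
  next
    case False
    then show ?thesis by (auto simp: lower_op_def delta_def)
  qed
  then have "Y_op i a (A (delta (- omega2))) = delta (- omega2)" by (auto simp: Y_op_def A(2))
  then show ?case using lift_y[OF A(1), of i a] by blast
qed

lemma ascending_rev: assumes "ascending is" shows "ascending (rev is)"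
proof -
  obtain js where js: "reduced_expr js (weyl_word (rev is))"
    using ex_reduced[OF parabolic_word[of "rev is" UNIV]] by auto
  have "weyl_word (rev js) v = weyl_word is v" for v
  proof -
    have "weyl_word js (weyl_word is v) = v" using js by (simp add: reduced_expr_def)
    then show ?thesis by (metis weyl_word_rev(1))
  qed
  then have "len (weyl_word is) \<le> length (rev js)" by (intro len_le ext)
  moreover have "reduced_expr is (weyl_word is)" using assms reduced_iff_ascending by blast
  ultimately have "length (rev is) \<le> length js" by (simp add: reduced_expr_def)
  then have "reduced_expr (rev is) (weyl_word (rev is))"
    using js len_le[OF HOL.refl, of "rev is"] unfolding reduced_expr_def by auto
  then show ?thesis using reduced_iff_ascending by blast
qed

primrec n_ops :: "7 list \<Rightarrow> wfun \<Rightarrow> wfun" where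
  "n_ops [] f = f"
| "n_ops (i # is) f = n_op i 1 (n_ops is f)"

lemma lift_n_ops: "lift (mat_prod (map s_bar is)) (n_ops is)"
proof (induction "is")
  case Nil
  have "n_ops [] = (\<lambda>f. f)" by (rule ext) simp
  then show ?case using lift_one by simp
next
  case (Cons i "is")
  have "n_ops (i # is) = (\<lambda>f. n_op i 1 (n_ops is f))" by (rule ext) simp
  then show ?case using lift_mult[OF lift_s_bar Cons, of i] by simp
qed

text \<open>\<open>n_op i 1\<close> produces a sign only when it moves a weight upwards; for a reduced word and a
  weight that is antidominant on its inversions this does not happen.\<close>

lemma n_ops_no_sign:
  "ascending is \<Longrightarrow> v \<in> wts \<Longrightarrow>
    (\<And>c. is_root c \<Longrightarrow> nonneg c \<Longrightarrow> \<not> nonneg (weyl_word (rev is) c) \<Longrightarrow> ip v c \<le> 0) \<Longrightarrow>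
    n_ops is f v = f (weyl_word (rev is) v)"
proof (induction "is" arbitrary: v)
  case (Cons j "is")
  have asc: "ascending is" by (rule ascending_tl[OF Cons.prems(1)])
  have "ascending (rev is @ [j])" using ascending_rev[OF Cons.prems(1)] by simp
  then have nj: "nonneg (weyl_word (rev is) (simple_root j))" by (simp add: ascending_snoc)
  have nnj: "\<not> nonneg (- weyl_word (rev is) (simple_root j))"
    using root_neg_iff[of "- weyl_word (rev is) (simple_root j)"] nj by simp
  have le: "ip v (simple_root j) \<le> 0" by (rule Cons.prems(3)) (simp_all add: nnj)
  have "n_op j 1 (n_ops is f) v = n_ops is f (refl j v)"
  proof -
    have "ip v (simple_root j) = -2 \<Longrightarrow> refl j v = v + 2 *s simple_root j"
      "ip v (simple_root j) = 0 \<Longrightarrow> refl j v = v"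
      by (simp_all add: refl_def vec_eq_iff)
    then show ?thesis using le ip_wts_root[OF Cons.prems(2) is_root_simple_root, of j] Cons.prems(2)
      by (auto simp: n_op_def)
  qed
  also have "\<dots> = f (weyl_word (rev is) (refl j v))"
  proof (rule Cons.IH[OF asc])
    show "refl j v \<in> wts" using Cons.prems(2) by simp
    fix c assume c: "is_root c" "nonneg c" "\<not> nonneg (weyl_word (rev is) c)"
    then have "c \<noteq> simple_root j" using nj by auto
    then have "nonneg (refl j c)" using refl_nonneg c by blast
    then have "ip v (refl j c) \<le> 0" by (intro Cons.prems(3)) (use c in simp_all)
    then show "ip (refl j v) c \<le> 0" by (simp add: ip_refl_left)
  qed
  finally show ?case by simp
qed simp

text \<open>Both weights pair nonpositively with the inversions of \<open>w_P\<close>, so no sign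
  arises, whichever reduced word \<open>w_bar\<close> selects.\<close>

lemma w_bar_P_rows:
  obtains A where "lift (w_bar w_P) A" "\<And>f. A f (- omega2) = f (- omega2)" "\<And>f. A f nu1 = f nu2"
proof -
  obtain "is" where w: "reduced_expr is w_P" "w_bar w_P = mat_prod (map s_bar is)"
    "w_P = weyl_word is"
    by (rule w_bar_word[OF w_P_in])
  have asc: "ascending is" using w(1) reduced_iff_ascending by blast
  have is_wP: "weyl_word is = wP" using w(3) w_P_eq(1) by simp
  have rev: "weyl_word (rev is) v = wP v" for v
    using weyl_word_rev(1)[of "is" "wP v"] is_wP wP_word_involution by simp
  have inv: "c $ 7 = 0 \<and> 0 \<le> c $ 6"
    if "is_root c" "nonneg c" "\<not> nonneg (weyl_word (rev is) c)" for c
  proof -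
    have "c \<in> inversions w_P" using that rev w_P_eq(1) by (simp add: inversions_def)
    then have "c \<in> pos_roots (UNIV - {7})" using w_P_eq(2) by simp
    then show ?thesis by (auto simp: pos_roots_def nonneg_def)
  qed
  have 1: "n_ops is f (- omega2) = f (wP (- omega2))" for f
    unfolding rev[symmetric] by (rule n_ops_no_sign[OF asc]) (use inv in \<open>auto simp: ip_omega2\<close>)
  have 2: "n_ops is f nu1 = f (wP nu1)" for f
    unfolding rev[symmetric]
  proof (rule n_ops_no_sign[OF asc nu1_wts])
    fix c assume "is_root c" "nonneg c" "\<not> nonneg (weyl_word (rev is) c)"
    then have "c $ 7 = 0" "0 \<le> c $ 6" using inv by auto
    \<comment> \<open>With \<open>c $ 7 = 0\<close> the pairing equals
      \<open>- 2 * c $ 6\<close>.\<close>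
    then show "ip nu1 c \<le> 0"
      by (simp add: nu1_def ip_omega2 ip_sym[of "simple_root 7"] ip_simple_root_right)
  qed
  have o: "wP omega2 = omega2" by (simp add: omega2_def wP_word_def)
  have n: "wP nu1 = nu2"
    by (simp add: nu1_def o wP_word_simple) (simp add: vec_eq_iff all_7 omega2_def nu2_def)
  show thesis by (rule that[of "n_ops is"]) (use lift_n_ops[of "is"] w(2) 1 2 o n in simp_all)
qed

text \<open>Two lifts of one element differ by a lift of the identity. That lift commutes with the
  Cartan operators and so is diagonal on weight vectors.\<close>

lemma lift_proportional:
  assumes A: "lift g A" and B: "lift g B" and u: "u \<in> wts"
  shows "\<exists>c. c \<noteq> 0 \<and> A (delta u) = (\<lambda>v. c * B (delta u) v)"
proof -
  obtain h C where C: "lift h C" "g ** h = mat 1" "h ** g = mat 1" "\<forall>f. B (C f) = f"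
    "\<forall>f. C (B f) = f"
    using lift_inverse[OF B] by auto
  have "lift (mat 1) (\<lambda>f. C (A f))" using lift_mult[OF C(1) A] C(3) by simp
  then obtain c where c: "c \<noteq> 0" "C (A (delta u)) = (\<lambda>v. c * delta u v)"
    using fix_cartan_imp_diagonal[OF _ _ u, of "mat 1" "\<lambda>f. C (A f)"] by auto
  have "A (delta u) = B (C (A (delta u)))" using C(4) by simp
  also have "\<dots> = (\<lambda>v. c * B (delta u) v)" unfolding c(2) by (rule lift_scale[OF B])
  finally show ?thesis using c(1) by blast
qed

lemma chi_7_value:
  assumes u: "u\<^sub>p \<in> U_plus" "t \<in> T_dual" and b: "b\<^sub>m \<in> B_minus"
    and eq: "u\<^sub>p ** t ** w_bar w_P ** y_prod a steps = b\<^sub>m ** matrix_inv (w_bar w_0)"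
  shows "chi 1 7 (matrix_inv u\<^sub>p) * prod_list (map a [1..<28])
    = simple_root_char 7 t * poly_eval P_poly a"
proof -
  let ?y = "y_prod a steps" and ?wz = "w_bar w_0"
  obtain \<tau> y where ty: "\<tau> \<in> T_dual" "y \<in> U_minus" "b\<^sub>m = \<tau> ** y" using b by (auto simp: B_minus_iff)
  have inv: "invertible u\<^sub>p" using u(1) U_plus_closed(4) by blast
  have "matrix_inv u\<^sub>p ** (\<tau> ** y) = matrix_inv u\<^sub>p ** (b\<^sub>m ** matrix_inv ?wz) ** ?wz"
    unfolding ty(3) by (simp only: matrix_mul_assoc mat_cancel(4)[OF invertible_w_bar(2)])
  also have "\<dots> = matrix_inv u\<^sub>p ** u\<^sub>p ** (t ** (w_bar w_P ** (?y ** ?wz)))"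
    unfolding eq[symmetric] by (simp only: matrix_mul_assoc)
  also have "\<dots> = t ** (w_bar w_P ** (?y ** ?wz))"
    by (simp only: matrix_inv_inverse(2)[OF inv] matrix_mul_lid)
  finally have g: "matrix_inv u\<^sub>p ** (\<tau> ** y) = t ** (w_bar w_P ** (?y ** ?wz))" .
  obtain U where U: "lift (matrix_inv u\<^sub>p) U" "\<And>f. U f (- omega2) = f (- omega2)"
    "\<And>f. U f nu1 = f nu1 + chi 1 7 (matrix_inv u\<^sub>p) * f (- omega2)"
    using U_plus_bottom[OF U_plus_closed(5)[OF u(1)]] by auto
  obtain Y where Y: "lift y Y" "Y (delta (- omega2)) = delta (- omega2)"
    using U_minus_bottom[OF ty(2)] by auto
  obtain S e where S: "lift \<tau> S" "\<And>v. e v \<noteq> 0" "\<And>f v. S f v = e v * f v"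
    by (rule torus_rows[OF ty(1)]) blast
  obtain T d where T: "lift t T" "\<And>v. d v \<noteq> 0" "\<And>f v. T f v = d v * f v"
    "\<And>u i. u \<in> wts \<Longrightarrow> ip u (simple_root i) = -2 \<Longrightarrow> d (u + 2 *s simple_root i)
      = simple_root_char i t * d u"
    by (rule torus_rows[OF u(2)]) blast
  obtain A where A: "lift (w_bar w_P) A" "\<And>f. A f (- omega2) = f (- omega2)" "\<And>f. A f nu1 = f nu2"
    by (rule w_bar_P_rows) blast
  obtain B where B: "lift ?wz B" "\<forall>u\<in>wts. \<exists>c. c \<noteq> 0 \<and> B (delta u)
    = (\<lambda>v. c * delta (weyl_word w0_word u) v)"
    using monomial_w0 by (auto simp: monomial_def)
  have "weyl_word w0_word (- omega2) = omega2" by (simp only: weyl_word_w0 minus_minus)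
  then obtain s where s: "s \<noteq> 0" "B (delta (- omega2)) = (\<lambda>v. s * delta omega2 v)"
    using B(2)[rule_format, OF omega2_wts(2)] by auto
  let ?L = "\<lambda>f. T (A (Y_prod a steps (B f)))" and ?R = "\<lambda>f. U (S (Y f))"
  have L: "lift (t ** (w_bar w_P ** (?y ** ?wz))) ?L"
    by (intro lift_mult T(1) A(1) lift_y_prod B(1))
  have R: "lift (t ** (w_bar w_P ** (?y ** ?wz))) ?R"
    unfolding g[symmetric] by (intro lift_mult U(1) S(1) Y(1))
  obtain c where c: "c \<noteq> 0" "?L (delta (- omega2)) = (\<lambda>v. c * ?R (delta (- omega2)) v)"
    using lift_proportional[OF L R omega2_wts(2)] by blast
  note cv = fun_cong[OF c(2)]
  have YB: "Y_prod a steps (B (delta (- omega2))) v = s * Y_prod a steps (delta omega2) v" for v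
    unfolding s(2) by (rule lift_scale[OF lift_y_prod, THEN fun_cong])
  have p1: "Y_prod a steps (delta omega2) (- omega2) = prod_list (map a [1..<28])"
    by (subst Y_prod_paths) (simp_all add: paths_bottom del: upt.simps)
  have p2: "Y_prod a steps (delta omega2) nu2 = poly_eval P_poly a"
    by (subst Y_prod_paths) (simp_all add: poly_eval_P_poly)
  have d1: "d nu1 = simple_root_char 7 t * d (- omega2)"
    unfolding nu1_def by (rule T(4)) (simp_all add: ip_minus_omega2 del: ip_bilinear)
  have nz: "nu1 \<noteq> - omega2" unfolding nu1_def by (rule wt_shift_neq) simp
  \<comment> \<open>Lowest row: on the left only the full path contributes, on the right the
    unipotent factors act trivially.\<close>
  have E1: "d (- omega2) * (s * prod_list (map a [1..<28])) = c * e (- omega2)"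
    using cv[of "- omega2"] by (simp add: T(3) A(2) YB p1 U(2) S(3) Y(2) del: upt.simps)
  \<comment> \<open>Row \<open>nu1\<close>: the 78 paths to \<open>nu2\<close> on the left. On the
    right the lowest weight vector has no component at \<open>nu1\<close>, so only the term with
    \<open>chi\<close> remains. Dividing by E1 removes the scalars, and the ratio of the values of
    \<open>d\<close> leaves \<alpha>_7(t).\<close>
  have E2: "simple_root_char 7 t * d (- omega2) * (s * poly_eval P_poly a)
    = c * (chi 1 7 (matrix_inv u\<^sub>p) * e (- omega2))"
    using cv[of nu1] nz by (simp add: T(3) A(3) YB p2 U(3) S(3) Y(2) d1)
  have "d (- omega2) * s * (chi 1 7 (matrix_inv u\<^sub>p) * prod_list (map a [1..<28]))
    = chi 1 7 (matrix_inv u\<^sub>p) * (c * e (- omega2))"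
    unfolding E1[symmetric] by (simp only: mult.assoc mult.left_commute mult.commute)
  also have "\<dots> = d (- omega2) * s * (simple_root_char 7 t * poly_eval P_poly a)"
    using E2 by (simp only: mult.assoc mult.left_commute mult.commute)
  finally show ?thesis using T(2) s(1) by simp
qed

subsection \<open>The potential\<close>

lemma chi_minus_mult: "u \<in> U_minus \<Longrightarrow> v \<in> U_minus \<Longrightarrow> chi (-1) i (u ** v)
  = chi (-1) i u + chi (-1) i v"
  using chi_mult[of "-1" u v i] U_minus_unitri by (simp add: unit_sign_def)

lemma chi_minus_y_el: "chi (-1) i (y_el j a) = (if i = j then a else 0)"
  using chi_sgn_el[of "-1" i j a] by (simp add: unit_sign_def sgn_el_eq)

lemma y_prod_U_minus: "y_prod a ps \<in> U_minus"
  by (induction ps) (auto intro: U_minus_closed(1) U_minus_closed(2,3))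

lemma sum_chi_y_prod: "(\<Sum>i\<in>UNIV. chi (-1) i (y_prod a ps)) = (\<Sum>q\<leftarrow>ps. a (fst q))"
proof (induction ps)
  case Nil
  then show ?case by (simp add: chi_def mat_def)
next
  case (Cons q ps)
  then show ?case
    by (simp add: chi_minus_mult U_minus_closed(2) y_prod_U_minus chi_minus_y_el sum.distrib)
qed

lemma y_prod_inverse:
  "mat_prod (map (\<lambda>q. y_el (snd q) (- a (fst q))) (rev ps)) ** y_prod a ps = mat 1 \<and>
   y_prod a ps ** mat_prod (map (\<lambda>q. y_el (snd q) (- a (fst q))) (rev ps)) = mat 1"
proof (induction ps)
  case (Cons q ps)
  let ?V = "mat_prod (map (\<lambda>q. y_el (snd q) (- a (fst q))) (rev ps))"
  let ?y = "y_el (snd q) (a (fst q))" and ?y' = "y_el (snd q) (- a (fst q))"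
  have V: "mat_prod (map (\<lambda>q. y_el (snd q) (- a (fst q))) (rev (q # ps))) = ?V ** ?y'"
    by (simp add: mat_prod_append)
  have "?V ** ?y' ** (?y ** y_prod a ps) = ?V ** (?y' ** ?y) ** y_prod a ps"
    "?y ** y_prod a ps ** (?V ** ?y') = ?y ** (y_prod a ps ** ?V) ** ?y'"
    by (simp_all only: matrix_mul_assoc)
  then show ?case using Cons.IH unfolding V y_prod.simps by (simp add: y_el_add)
qed simp

lemma steps_word:
  "map2 y_el r_word (map (\<lambda>i. - a i) [1..<28]) = map (\<lambda>q. y_el (snd q) (- a (fst q))) (rev steps)"
proof -
  have "zip r_word (map (\<lambda>i. - a i) [1..<28]) = map (\<lambda>q. (snd q, - a (fst q))) (zip [1..<28]
    r_word)"
    by (rule nth_equalityI) (simp_all add: length_r_word del: upt.simps)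
  then show ?thesis by (simp add: steps_def o_def del: upt.simps)
qed

lemma potential_value:
  fixes a :: "nat \<Rightarrow> complex"
  assumes z: "z \<in> Z_P_circ" "z = u\<^sub>p ** t ** w_bar w_P ** u\<^sub>m"
    and u: "u\<^sub>p \<in> U_plus" "t \<in> T_P" "u\<^sub>m \<in> U_minus_circ"
    and a: "\<forall>i\<in>{1..27}. a i \<noteq> 0"
    and um: "matrix_inv u\<^sub>m = mat_prod (map2 y_el r_word (map (\<lambda>i. - a i) [1..<28]))"
  shows "potential_circ z = (\<Sum>i=1..27. a i) + simple_root_char 7 t * (poly_eval P_poly a /
    (\<Prod>i=1..27. a i))"
proof -
  have t: "t \<in> T_dual" using u(2) by (rule T_P_T_dual)
  have mP: "u\<^sub>m \<in> U_minus_P" by (rule U_minus_circ_subset[OF u(3)])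
  then have mU: "u\<^sub>m \<in> U_minus" by (simp add: U_minus_P_iff)
  \<comment> \<open>Inversion reverses the order of the factors and negates their parameters, which
    turns the given product into \<open>y_prod a steps\<close>.\<close>
  have um_eq: "u\<^sub>m = y_prod a steps"
  proof -
    have iu: "invertible u\<^sub>m" by (rule U_minus_closed(4)[OF mU])
    have "matrix_inv (matrix_inv u\<^sub>m) = u\<^sub>m"
      by (rule matrix_inv_eqI[OF matrix_inv_inverse(2,1)[OF iu]])
    moreover have "matrix_inv (matrix_inv u\<^sub>m) = y_prod a steps"
      unfolding um steps_word by (rule matrix_inv_eqI) (use y_prod_inverse[of a steps] in blast)+
    ultimately show ?thesis by simp
  qed
  obtain b\<^sub>m where b: "b\<^sub>m \<in> B_minus" "z = b\<^sub>m ** matrix_inv (w_bar w_0)"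
    using z(1) by (auto simp: Z_P_circ_def r_coset_def)
  have "\<exists>x\<in>U_plus. \<exists>y\<in>T_P. \<exists>v\<in>U_minus. z = x ** y ** w_bar w_P ** v"
    using u(1,2) mU z(2) by blast
  then have zP: "z \<in> Z_P" unfolding Z_P_def r_coset_def set_mult_def
    using b by auto
  have dec: "decomposition z = (u\<^sub>p, t, u\<^sub>m)" unfolding decomposition_def
  proof (rule the_equality)
    show "case (u\<^sub>p, t, u\<^sub>m) of (u\<^sub>p, t, u\<^sub>m) \<Rightarrow> u\<^sub>p \<in> U_plus \<and> t \<in> T_P \<and> u\<^sub>m \<in> U_minus_P \<and>
      z = u\<^sub>p ** t ** w_bar w_P ** u\<^sub>m" using u mP z(2) by simp
    fix x assume "case x of (u\<^sub>p, t, u\<^sub>m) \<Rightarrow> u\<^sub>p \<in> U_plus \<and> t \<in> T_P \<and> u\<^sub>m \<in> U_minus_P \<and>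
      z = u\<^sub>p ** t ** w_bar w_P ** u\<^sub>m"
    then obtain p' t' m' where x: "x = (p', t', m')" "p' \<in> U_plus" "t' \<in> T_P" "m' \<in> U_minus_P"
      "z = p' ** t' ** w_bar w_P ** m'" by (cases x) auto
    show "x = (u\<^sub>p, t, u\<^sub>m)"
      using decomposition_unique[OF x(2) T_P_T_dual[OF x(3)] x(4) u(1) t mP] x(1,5) z(2) by simp
  qed
  have eq: "u\<^sub>p ** t ** w_bar w_P ** u\<^sub>m = b\<^sub>m ** matrix_inv (w_bar w_0)" using z(2) b(2) by simp
  have iup: "matrix_inv u\<^sub>p \<in> U_plus" by (rule U_plus_closed(5)[OF u(1)])
  have sum_e: "(\<Sum>i\<in>UNIV. e_star i (matrix_inv u\<^sub>p)) = chi 1 7 (matrix_inv u\<^sub>p)"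
  proof -
    have "(\<Sum>i\<in>UNIV. e_star i (matrix_inv u\<^sub>p)) = (\<Sum>i\<in>(UNIV :: 7 set). if i
      = 7 then chi 1 7 (matrix_inv u\<^sub>p) else 0)"
      by (rule sum.cong) (auto simp: e_star_eq[OF iup] chi_inv_vanishes[OF u(1) t mP b(1) eq])
    then show ?thesis by simp
  qed
  have sum_f: "(\<Sum>i\<in>UNIV. f_star i u\<^sub>m) = (\<Sum>i=1..27. a i)"
  proof -
    have "(\<Sum>i\<in>UNIV. f_star i u\<^sub>m) = (\<Sum>i\<in>UNIV. chi (-1) i u\<^sub>m)"
      by (rule sum.cong) (simp_all add: f_star_eq[OF mU])
    also have "\<dots> = sum_list (map a (map fst steps))" unfolding um_eq sum_chi_y_prod
      by (simp add: o_def)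
    also have "map fst steps = rev [1..<28]"
      by (simp add: steps_def rev_map[symmetric] length_r_word del: upt.simps)
    also have "sum_list (map a (rev [1..<28])) = sum a (set [1..<28])"
      by (simp only: rev_map[symmetric] sum_list_rev sum.distinct_set_conv_list[OF distinct_upt])
    also have "set [1..<28] = {1..27::nat}" by auto
    finally show ?thesis .
  qed
  have prod_a: "prod_list (map a [1..<28]) = (\<Prod>i=1..27. a i)"
  proof -
    have "prod_list (map a [1..<28]) = prod a (set [1..<28])"
      by (simp only: prod.distinct_set_conv_list[OF distinct_upt])
    also have "set [1..<28] = {1..27::nat}" by auto
    finally show ?thesis .
  qed
  have "(\<Prod>i=1..27. a i) \<noteq> 0" using a by simp
  then have "chi 1 7 (matrix_inv u\<^sub>p) = simple_root_char 7 t * (poly_eval P_poly a / (\<Prod>i=1..27. a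
    i))"
    using chi_7_value[OF u(1) t b(1) eq[unfolded um_eq]] unfolding prod_a by (simp add: field_simps)
  moreover have "potential_circ z = chi 1 7 (matrix_inv u\<^sub>p) + (\<Sum>i=1..27. a i)"
    using z(1) zP by (simp add: potential_circ_def potential_def dec sum_e sum_f)
  ultimately show ?thesis by simp
qed

theorem mainTheorem4:
  shows "reduced_expr r_word w_sup_P \<and>
    reduced_expr [7,6,5,4,2,3,4,5,6,7] w_p \<and>
    (\<forall>z u\<^sub>p t u\<^sub>m (a :: nat \<Rightarrow> complex).
       z \<in> Z_P_circ \<longrightarrow> z = u\<^sub>p ** t ** w_bar w_P ** u\<^sub>m \<longrightarrow>
       u\<^sub>p \<in> U_plus \<longrightarrow> t \<in> T_P \<longrightarrow> u\<^sub>m \<in> U_minus_circ \<longrightarrow>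
       (\<forall>i\<in>{1..27}. a i \<noteq> 0) \<longrightarrow>
       matrix_inv u\<^sub>m = mat_prod (map2 y_el r_word (map (\<lambda>i. - a i) [1..<28])) \<longrightarrow>
       potential_circ z =
         (\<Sum>i=1..27. a i) +
         simple_root_char 7 t * (poly_eval P_poly a / (\<Prod>i=1..27. a i))) \<and>
    homogeneous 10 P_poly \<and>
    card (Poly_Mapping.keys P_poly) = 78"
  using reduced_r_word reduced_w_p potential_value homogeneous_P_poly card_keys_P_poly by blast

end
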